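(* Let $n\ge 1$ and let $a_1,\dots,a_n>0$ be rationally independent real numbers. Let $H=-\Delta+V(x)$ on $\mathbb{R}^n$ with $V(x)=\sum_{i=1}^n a_i^2x_i^2$. Let $\lambda_1<\lambda_2<\lambda_3<\cdots$ be the eigenvalues of $H$ (which are all simple), let $f_k$ be a real-valued eigenfunction of $H$ with eigenvalue $\lambda_k$, and let $\mu(f_k)$ be the number of nodal domains of $f_k$. Then $$\limsup_{k\to\infty}\frac{\mu(f_k)}{k}=\frac{n!}{n^n}.$$
   Context: A nodal domain of a function is a connected component of the complement of its zero set. Real numbers $a_1,\dots,a_n$ are rationally independent if the only integers $k_1,\dots,k_n$ with $a_1k_1+\cdots+a_nk_n=0$ are $k_1=\cdots=k_n=0$. The operator $Hf=-\Delta f+Vf$ is first defined on the Schwartz space $S(\mathbb{R}^n)$; it has a unique self-adjoint extension to $L^2(\mathbb{R}^n)$, whose spectrum is discrete. Eigenvalues and eigenfunctions of $H$ are those of this extension. A basis of eigenfunctions of $L^2(\mathbb{R}^n)$ is given by $f_{k_1,\dots,k_n}(x)=\prod_{i=1}^n e^{-a_ix_i^2/2}H_{k_i}(\sqrt{a_i}\,x_i)$ for nonnegative integers $k_1,\dots,k_n$, where $H_m$ is the $m$-th Hermite polynomial, with eigenvalue $\sum_{i=1}^n a_i(2k_i+1)$. *)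

theory Defs
  imports "HOL-Analysis.Analysis"
begin

definition rationally_independent :: "real^'n \<Rightarrow> bool" where
  "rationally_independent a \<longleftrightarrow>
     (\<forall>k :: 'n \<Rightarrow> int. (\<Sum>i\<in>UNIV. a $ i * of_int (k i)) = 0 \<longrightarrow> (\<forall>i. k i = 0))"


subsection \<open>Schwartz functions and the differential expression\<close>

definition partial :: "'n \<Rightarrow> (real^'n \<Rightarrow> complex) \<Rightarrow> (real^'n \<Rightarrow> complex)" where
  "partial i f = (\<lambda>x. frechet_derivative f (at x) (axis i 1))"

definition partials :: "'n list \<Rightarrow> (real^'n \<Rightarrow> complex) \<Rightarrow> (real^'n \<Rightarrow> complex)" where
  "partials is f = foldr partial is f"

text \<open>
  \<^const>\<open>frechet_derivative\<close> is arbitrary at points of non-differentiability, hence the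
  explicit differentiability requirement. Imposed on the partial derivatives of all orders, it
  says that the function is smooth.
\<close>

definition schwartz :: "(real^'n \<Rightarrow> complex) set" where
  "schwartz = {f. \<forall>is. (\<forall>x. partials is f differentiable (at x)) \<and>
                        (\<forall>m::nat. \<exists>C. \<forall>x. norm x ^ m * norm (partials is f x) \<le> C)}"

definition laplacian :: "(real^'n \<Rightarrow> complex) \<Rightarrow> (real^'n \<Rightarrow> complex)" where
  "laplacian f = (\<lambda>x. \<Sum>i\<in>UNIV. partial i (partial i f) x)"

definition schroedinger_expr ::
    "(real^'n \<Rightarrow> real) \<Rightarrow> (real^'n \<Rightarrow> complex) \<Rightarrow> (real^'n \<Rightarrow> complex)" where
  "schroedinger_expr V f = (\<lambda>x. - laplacian f x + of_real (V x) * f x)"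


subsection \<open>Unbounded operators on the space of square-integrable functions\<close>

text \<open>
  Elements of $L^2$ are represented by Borel functions, two of which are identified if they agree
  almost everywhere. An operator is represented by its graph, a set of pairs of such functions
  that is closed under this identification.
\<close>

definition L2 :: "(real^'n \<Rightarrow> complex) set" where
  "L2 = {f \<in> borel_measurable lborel. integrable lborel (\<lambda>x. (norm (f x))\<^sup>2)}"

definition L2_inner :: "(real^'n \<Rightarrow> complex) \<Rightarrow> (real^'n \<Rightarrow> complex) \<Rightarrow> complex" where
  "L2_inner f g = (LINT x|lborel. f x * cnj (g x))"

definition L2_norm :: "(real^'n \<Rightarrow> complex) \<Rightarrow> real" where
  "L2_norm f = sqrt (LINT x|lborel. (norm (f x))\<^sup>2)"

definition ae_eq :: "(real^'n \<Rightarrow> complex) \<Rightarrow> (real^'n \<Rightarrow> complex) \<Rightarrow> bool" where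
  "ae_eq f g \<longleftrightarrow> (AE x in lborel. f x = g x)"

type_synonym 'n graph = "((real^'n \<Rightarrow> complex) \<times> (real^'n \<Rightarrow> complex)) set"

definition linear_operator :: "'n::finite graph \<Rightarrow> bool" where
  "linear_operator T \<longleftrightarrow>
     T \<subseteq> L2 \<times> L2 \<and>
     (\<forall>f g f' g'. (f, g) \<in> T \<and> f' \<in> L2 \<and> g' \<in> L2 \<and> ae_eq f f' \<and> ae_eq g g' \<longrightarrow> (f', g') \<in> T) \<and>
     (\<forall>f g f' g'. (f, g) \<in> T \<and> (f', g') \<in> T \<and> ae_eq f f' \<longrightarrow> ae_eq g g') \<and>
     (\<forall>f g f' g' c d. (f, g) \<in> T \<and> (f', g') \<in> T \<longrightarrow>
        ((\<lambda>x. c * f x + d * f' x), (\<lambda>x. c * g x + d * g' x)) \<in> T)"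

definition densely_defined :: "'n::finite graph \<Rightarrow> bool" where
  "densely_defined T \<longleftrightarrow> (\<forall>f\<in>L2. \<forall>\<epsilon>>0. \<exists>u\<in>Domain T. L2_norm (\<lambda>x. f x - u x) < \<epsilon>)"

definition adjoint_op :: "'n::finite graph \<Rightarrow> 'n graph" where
  "adjoint_op T = {(f, g) \<in> L2 \<times> L2. \<forall>(u, v)\<in>T. L2_inner v f = L2_inner u g}"

definition self_adjoint_op :: "'n::finite graph \<Rightarrow> bool" where
  "self_adjoint_op T \<longleftrightarrow> linear_operator T \<and> densely_defined T \<and> adjoint_op T = T"

definition eigenfunction :: "'n::finite graph \<Rightarrow> complex \<Rightarrow> (real^'n \<Rightarrow> complex) \<Rightarrow> bool" where
  "eigenfunction T z f \<longleftrightarrow> (f, \<lambda>x. z * f x) \<in> T \<and> \<not> ae_eq f (\<lambda>x. 0)"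

definition eigenvalue :: "'n::finite graph \<Rightarrow> complex \<Rightarrow> bool" where
  "eigenvalue T z \<longleftrightarrow> (\<exists>f. eigenfunction T z f)"

definition simple_eigenvalue :: "'n::finite graph \<Rightarrow> complex \<Rightarrow> bool" where
  "simple_eigenvalue T z \<longleftrightarrow> eigenvalue T z \<and>
     (\<forall>f g. eigenfunction T z f \<and> eigenfunction T z g \<longrightarrow> (\<exists>c. ae_eq g (\<lambda>x. c * f x)))"


subsection \<open>The anisotropic harmonic oscillator\<close>

definition schroedinger_on_schwartz :: "(real^'n \<Rightarrow> real) \<Rightarrow> 'n::finite graph" where
  "schroedinger_on_schwartz V = {(f, schroedinger_expr V f) |f. f \<in> schwartz}"

text \<open>
  Graphs in the range of the definite description are closed under almost-everywhere equality, so
  inclusion of graphs is the extension relation between operators. The description denotes when the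
  expression is essentially self-adjoint on the Schwartz space, as for the oscillator below.
\<close>

definition schroedinger_op :: "(real^'n \<Rightarrow> real) \<Rightarrow> 'n::finite graph" where
  "schroedinger_op V = (THE T. self_adjoint_op T \<and> schroedinger_on_schwartz V \<subseteq> T)"

definition oscillator_potential :: "real^'n \<Rightarrow> real^'n \<Rightarrow> real" where
  "oscillator_potential a x = (\<Sum>i\<in>UNIV. (a $ i)\<^sup>2 * (x $ i)\<^sup>2)"

definition oscillator :: "real^'n \<Rightarrow> 'n::finite graph" where
  "oscillator a = schroedinger_op (oscillator_potential a)"


subsection \<open>Nodal domains\<close>

text \<open>
  The zero set depends on the representative of an element of $L^2$; these notions are meant for
  the continuous representative of an eigenfunction.
\<close>

definition nodal_domains :: "(real^'n \<Rightarrow> real) \<Rightarrow> (real^'n) set set" where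
  "nodal_domains f = components {x. f x \<noteq> 0}"

definition nodal_count :: "(real^'n \<Rightarrow> real) \<Rightarrow> enat" where
  "nodal_count f =
     (if finite (nodal_domains f) then enat (card (nodal_domains f)) else \<infinity>)"

end

theory Submission
  imports Defs "HOL-Computational_Algebra.Polynomial" "HOL-Probability.Sinc_Integral"
    "HOL-Real_Asymp.Real_Asymp"
begin

text \<open>
  Separation of variables makes everything explicit. For a multi-index $k$ the product of the
  one-dimensional Hermite functions is an eigenfunction with eigenvalue $\sum_i a_i (2 k_i + 1)$.
  Rational independence makes these numbers pairwise distinct, so each eigenspace is spanned by a
  single product, and the statement becomes one about the nodal count and the rank of each product.

  Spectrum. The products are Schwartz functions, pairwise orthogonal because their eigenvalues
  differ, and their span is dense in $L^2$ (\<open>hermite_state_complete\<close>). Let $T$ be the operator that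
  multiplies the coefficients of a function by the corresponding eigenvalues, on its maximal
  domain. It is self-adjoint (\<open>self_adjoint_osc_graph\<close>), and integration by parts
  (\<open>laplacian_symmetric\<close>) shows that it extends the differential operator. Conversely a self-adjoint
  extension $S$ contains the eigenpairs, hence $S = S^* \subseteq T$, hence $T = T^* \subseteq S^* = S$
  (\<open>oscillator_eq_osc_graph\<close>). An eigenfunction of $T$ has a single nonzero coefficient, so it is a
  multiple of one product, almost everywhere and, by continuity, everywhere.

  Nodal count. The $m$-th Hermite polynomial has $m$ distinct real zeros
  (\<open>card_hermite_zeros\<close>). Hence the product with multi-index $k$ vanishes exactly on a grid of
  hyperplanes that cuts the space into $\prod_i (k_i + 1)$ boxes
  (\<open>card_components_grid_complement\<close>).

  Rank. The position of the eigenvalue of $k$ in the increasing enumeration is the number $N(L)$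
  of multi-indices $l$ with $\sum_i a_i l_i \le L$, where $L = \sum_i a_i k_i$. Counting lattice points in
  a simplex gives $L^n \le N(L)\, n! \prod_i a_i \le (L + \sum_i a_i)^n$
  (\<open>card_lattice_simplex_bounds\<close>).

  Limit superior. By the inequality of arithmetic and geometric means,
  $\prod_i a_i (k_i + 1) \le ((L + \sum_i a_i)/n)^n$, so $\prod_i (k_i + 1) / N(L)$ is at most
  $(n!/n^n)\,(1 + o(1))$. Equality is approached when the numbers $a_i k_i$ are nearly equal, for
  instance for $k_i = \lfloor t / a_i \rfloor$ with $t \to \infty$ (\<open>limsup_product_over_rank\<close>).
\<close>

section \<open>The space of square-integrable functions\<close>

lemma L2_borel: "f \<in> L2 \<Longrightarrow> f \<in> borel_measurable borel"
  by (simp add: L2_def)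

lemma L2_square_integrable: "f \<in> L2 \<Longrightarrow> integrable lborel (\<lambda>x. (norm (f x))\<^sup>2)"
  by (simp add: L2_def)

lemma L2_I:
  "f \<in> borel_measurable borel \<Longrightarrow> integrable lborel (\<lambda>x. (norm (f x))\<^sup>2) \<Longrightarrow> f \<in> L2"
  by (simp add: L2_def)

lemma L2_dominated:
  assumes "f \<in> borel_measurable borel" "g \<in> L2" "\<And>x. norm (f x) \<le> C * norm (g x)"
  shows "f \<in> L2"
proof (rule L2_I)
  have "integrable lborel (\<lambda>x. C\<^sup>2 * (norm (g x))\<^sup>2)"
    using L2_square_integrable[OF assms(2)] by simp
  moreover have "(norm (f x))\<^sup>2 \<le> C\<^sup>2 * (norm (g x))\<^sup>2" for x
    using power_mono[OF assms(3)[of x], of 2] by (simp add: power_mult_distrib)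
  ultimately show "integrable lborel (\<lambda>x. (norm (f x))\<^sup>2)"
    by (elim Bochner_Integration.integrable_bound) (use assms(1) in auto)
qed (use assms in auto)

lemma measurable_cnj [measurable]: "cnj \<in> borel_measurable borel"
  by (intro borel_measurable_continuous_onI continuous_on_cnj continuous_on_id)

lemma L2_lin [intro]:
  assumes "f \<in> L2" "g \<in> L2"
  shows "(\<lambda>x. c * f x + d * g x) \<in> L2"
proof (rule L2_I)
  note [measurable] = assms[THEN L2_borel]
  show "(\<lambda>x. c * f x + d * g x) \<in> borel_measurable borel" by measurable
  let ?b = "\<lambda>x. 2 * ((norm c)\<^sup>2 * (norm (f x))\<^sup>2) + 2 * ((norm d)\<^sup>2 * (norm (g x))\<^sup>2)"
  have "integrable lborel ?b"
    using assms[THEN L2_square_integrable] by simp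
  moreover have "norm ((norm (c * f x + d * g x))\<^sup>2) \<le> norm (?b x)" for x
  proof -
    have "(norm (c * f x + d * g x))\<^sup>2 \<le> (norm (c * f x) + norm (d * g x))\<^sup>2"
      by (intro power_mono norm_triangle_ineq) auto
    also have "\<dots> \<le> 2 * (norm (c * f x))\<^sup>2 + 2 * (norm (d * g x))\<^sup>2"
      using sum_squares_bound[of "norm (c * f x)" "norm (d * g x)"] by (simp add: power2_sum)
    finally show ?thesis by (simp add: norm_mult power_mult_distrib)
  qed
  ultimately show "integrable lborel (\<lambda>x. (norm (c * f x + d * g x))\<^sup>2)"
    by (elim Bochner_Integration.integrable_bound) auto
qed

lemma L2_zero [simp]: "(\<lambda>x. 0) \<in> L2"
  by (simp add: L2_def)

lemma L2_add [intro]: "f \<in> L2 \<Longrightarrow> g \<in> L2 \<Longrightarrow> (\<lambda>x. f x + g x) \<in> L2"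
  using L2_lin[of f g 1 1] by simp

lemma L2_diff [intro]: "f \<in> L2 \<Longrightarrow> g \<in> L2 \<Longrightarrow> (\<lambda>x. f x - g x) \<in> L2"
  using L2_lin[of f g 1 "-1"] by simp

lemma L2_cmult [intro]: "f \<in> L2 \<Longrightarrow> (\<lambda>x. c * f x) \<in> L2"
  using L2_lin[of f f c 0] by simp

lemma L2_sum [intro]:
  assumes "\<And>k. k \<in> F \<Longrightarrow> f k \<in> L2"
  shows "(\<lambda>x. \<Sum>k\<in>F. f k x) \<in> L2"
  using assms by (induction F rule: infinite_finite_induct) auto

lemma L2_inner_integrable:
  assumes "f \<in> L2" "g \<in> L2"
  shows "integrable lborel (\<lambda>x. f x * cnj (g x))"
proof -
  note [measurable] = assms[THEN L2_borel]
  have "integrable lborel (\<lambda>x. (norm (f x))\<^sup>2 + (norm (g x))\<^sup>2)"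
    using assms[THEN L2_square_integrable] by simp
  moreover have "norm (f x * cnj (g x)) \<le> norm ((norm (f x))\<^sup>2 + (norm (g x))\<^sup>2)" for x
    using sum_squares_bound[of "norm (f x)" "norm (g x)"]
      mult_nonneg_nonneg[OF norm_ge_zero norm_ge_zero, of "f x" "g x"]
    unfolding norm_mult complex_mod_cnj real_norm_def by linarith
  ultimately show ?thesis
    by (elim Bochner_Integration.integrable_bound) auto
qed

lemma L2_inner_lin_left:
  assumes "f \<in> L2" "g \<in> L2" "h \<in> L2"
  shows "L2_inner (\<lambda>x. c * f x + d * g x) h = c * L2_inner f h + d * L2_inner g h"
  using L2_inner_integrable[OF assms(1,3)] L2_inner_integrable[OF assms(2,3)]
  by (simp add: L2_inner_def algebra_simps)

lemma L2_inner_cnj: "L2_inner g f = cnj (L2_inner f g)"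
  unfolding L2_inner_def Bochner_Integration.integral_cnj[symmetric] by (simp add: mult.commute)

lemma L2_inner_cmult_left: "L2_inner (\<lambda>x. c * f x) h = c * L2_inner f h"
  by (simp add: L2_inner_def mult.assoc)

lemma L2_inner_diff_left:
  assumes "f \<in> L2" "g \<in> L2" "h \<in> L2"
  shows "L2_inner (\<lambda>x. f x - g x) h = L2_inner f h - L2_inner g h"
  using L2_inner_lin_left[OF assms, of 1 "-1"] by simp

lemma L2_inner_sum_left:
  assumes "finite F" "\<And>k. k \<in> F \<Longrightarrow> f k \<in> L2" "h \<in> L2"
  shows "L2_inner (\<lambda>x. \<Sum>k\<in>F. c k * f k x) h = (\<Sum>k\<in>F. c k * L2_inner (f k) h)"
  unfolding L2_inner_def sum_distrib_right
  by (subst Bochner_Integration.integral_sum)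
     (use assms in \<open>auto simp: mult.assoc intro!: integrable_mult_right L2_inner_integrable\<close>)

lemma L2_inner_ae:
  assumes "f \<in> L2" "f' \<in> L2" "g \<in> L2" "ae_eq f f'"
  shows "L2_inner f g = L2_inner f' g"
  unfolding L2_inner_def
proof (rule integral_cong_AE)
  note [measurable] = assms(1-3)[THEN L2_borel]
  show "(\<lambda>x. f x * cnj (g x)) \<in> borel_measurable lborel" 
       "(\<lambda>x. f' x * cnj (g x)) \<in> borel_measurable lborel" by measurable
  show "AE x in lborel. f x * cnj (g x) = f' x * cnj (g x)"
    using assms(4) unfolding ae_eq_def by eventually_elim simp
qed

lemma L2_norm_nonneg [simp]: "0 \<le> L2_norm f"
  by (simp add: L2_norm_def)

lemma L2_norm_square: "(L2_norm f)\<^sup>2 = (LINT x|lborel. (norm (f x))\<^sup>2)"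
  by (simp add: L2_norm_def)

lemma L2_inner_self: "L2_inner f f = complex_of_real ((L2_norm f)\<^sup>2)"
proof -
  have "(\<lambda>x. f x * cnj (f x)) = (\<lambda>x. complex_of_real ((norm (f x))\<^sup>2))"
    by (simp add: complex_norm_square[symmetric])
  then show ?thesis unfolding L2_inner_def L2_norm_square by (simp only: integral_complex_of_real)
qed

lemma L2_norm_zero_imp:
  assumes "f \<in> L2" "L2_norm f = 0"
  shows "ae_eq f (\<lambda>x. 0)"
proof -
  have "(LINT x|lborel. (norm (f x))\<^sup>2) = 0"
    using assms(2) L2_norm_square[of f] by simp
  then have "AE x in lborel. (norm (f x))\<^sup>2 = 0"
    using integral_nonneg_eq_0_iff_AE[OF L2_square_integrable[OF assms(1)]] by simp
  then show ?thesis by (simp add: ae_eq_def)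
qed

lemma L2_Cauchy_Schwarz:
  assumes "f \<in> L2" "g \<in> L2"
  shows "norm (L2_inner f g) \<le> L2_norm f * L2_norm g"
proof -
  note [measurable] = assms[THEN L2_borel]
  let ?I = "LINT x|lborel. norm (f x) * norm (g x)"
  have int: "integrable lborel (\<lambda>x. norm (f x) * norm (g x))"
    using integrable_norm[OF L2_inner_integrable[OF assms]] by (simp add: norm_mult)
  have sq: "(\<integral>\<^sup>+x. ennreal ((norm (h x))\<^sup>2) \<partial>lborel) = ennreal ((L2_norm h)\<^sup>2)" if "h \<in> L2" for h :: "real^'a::finite \<Rightarrow> complex"
    using nn_integral_eq_integral[OF L2_square_integrable[OF that]]
    by (simp add: L2_norm_square ennreal_power)
  have "(\<integral>\<^sup>+x. ennreal (norm (f x)) * ennreal (norm (g x)) \<partial>lborel)\<^sup>2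
      \<le> (\<integral>\<^sup>+x. (ennreal (norm (f x)))\<^sup>2 \<partial>lborel) * (\<integral>\<^sup>+x. (ennreal (norm (g x)))\<^sup>2 \<partial>lborel)"
    by (rule Cauchy_Schwarz_nn_integral) auto
  also have "(\<integral>\<^sup>+x. ennreal (norm (f x)) * ennreal (norm (g x)) \<partial>lborel) = ennreal ?I"
    using nn_integral_eq_integral[OF int] by (simp add: ennreal_mult)
  finally have "ennreal (?I\<^sup>2) \<le> ennreal ((L2_norm f * L2_norm g)\<^sup>2)"
    by (simp add: sq assms ennreal_power power_mult_distrib flip: ennreal_mult)
  then have "?I\<^sup>2 \<le> (L2_norm f * L2_norm g)\<^sup>2"
    by (simp add: ennreal_le_iff)
  then have "?I \<le> L2_norm f * L2_norm g"
    by (rule power2_le_imp_le) simp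
  moreover have "norm (L2_inner f g) \<le> ?I"
    unfolding L2_inner_def
    by (rule order_trans[OF integral_norm_bound]) (simp add: norm_mult)
  ultimately show ?thesis by linarith
qed

lemma L2_norm_cmult: "L2_norm (\<lambda>x. c * f x) = norm c * L2_norm f"
  by (simp add: L2_norm_def norm_mult power_mult_distrib real_sqrt_mult)

text \<open>
  The polarisation identity. It yields both the triangle inequality, through Cauchy-Schwarz, and
  Pythagoras' theorem for the partial sums of an orthogonal expansion.
\<close>

lemma L2_norm_add_square:
  assumes "f \<in> L2" "g \<in> L2"
  shows "(L2_norm (\<lambda>x. f x + g x))\<^sup>2 = (L2_norm f)\<^sup>2 + 2 * Re (L2_inner f g) + (L2_norm g)\<^sup>2"
proof -
  have "complex_of_real ((L2_norm (\<lambda>x. f x + g x))\<^sup>2)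
      = L2_inner f f + L2_inner f g + (L2_inner g f + L2_inner g g)"
    unfolding L2_inner_self[symmetric]
    unfolding L2_inner_def complex_cnj_add ring_distribs
    by (simp add: Bochner_Integration.integral_add L2_inner_integrable[OF assms(1) assms(1)]
        L2_inner_integrable[OF assms(1) assms(2)] L2_inner_integrable[OF assms(2) assms(1)]
        L2_inner_integrable[OF assms(2) assms(2)])
  then show ?thesis
    unfolding L2_inner_self using L2_inner_cnj[of g f] by (simp add: complex_eq_iff)
qed

lemma L2_norm_triangle:
  assumes "f \<in> L2" "g \<in> L2"
  shows "L2_norm (\<lambda>x. f x + g x) \<le> L2_norm f + L2_norm g"
proof (rule power2_le_imp_le)
  have "Re (L2_inner f g) \<le> L2_norm f * L2_norm g"
    using L2_Cauchy_Schwarz[OF assms] complex_Re_le_cmod order_trans by blast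
  then show "(L2_norm (\<lambda>x. f x + g x))\<^sup>2 \<le> (L2_norm f + L2_norm g)\<^sup>2"
    by (simp add: L2_norm_add_square[OF assms] power2_sum)
qed simp

definition L2_closure :: "(real^'n \<Rightarrow> complex) set \<Rightarrow> (real^'n \<Rightarrow> complex) set" where
  "L2_closure W = {f \<in> L2. \<forall>\<epsilon>>0. \<exists>u\<in>W. L2_norm (\<lambda>x. f x - u x) < \<epsilon>}"

lemma L2_closure_limit:
  assumes W: "W \<subseteq> L2" and f: "f \<in> L2"
    and appr: "\<And>\<epsilon>. \<epsilon> > 0 \<Longrightarrow> \<exists>u\<in>L2_closure W. L2_norm (\<lambda>x. f x - u x) < \<epsilon>"
  shows "f \<in> L2_closure W"
proof -
  have "\<exists>v\<in>W. L2_norm (\<lambda>x. f x - v x) < \<epsilon>" if pos: "\<epsilon> > 0" for \<epsilon>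
  proof -
    obtain u where u: "u \<in> L2_closure W" "L2_norm (\<lambda>x. f x - u x) < \<epsilon>/2"
      using appr[OF half_gt_zero[OF pos]] by (elim bexE)
    from u(1) half_gt_zero[OF pos] have "\<exists>v\<in>W. L2_norm (\<lambda>x. u x - v x) < \<epsilon>/2"
      unfolding L2_closure_def mem_Collect_eq by metis
    then obtain v where v: "v \<in> W" "L2_norm (\<lambda>x. u x - v x) < \<epsilon>/2"
      by (elim bexE)
    have "u \<in> L2" "v \<in> L2" using u(1) v(1) W by (auto simp: L2_closure_def)
    with f have "L2_norm (\<lambda>x. (f x - u x) + (u x - v x)) \<le>
        L2_norm (\<lambda>x. f x - u x) + L2_norm (\<lambda>x. u x - v x)"
      by (intro L2_norm_triangle L2_diff)
    with u v have "L2_norm (\<lambda>x. f x - v x) < \<epsilon>" by simp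
    then show ?thesis by (rule bexI[OF _ v(1)])
  qed
  with f show ?thesis by (simp add: L2_closure_def)
qed

lemma L2_closure_lin:
  assumes W: "W \<subseteq> L2" and lin: "\<And>u v c d. u \<in> W \<Longrightarrow> v \<in> W \<Longrightarrow> (\<lambda>x. c * u x + d * v x) \<in> W"
    and f: "f \<in> L2_closure W" and g: "g \<in> L2_closure W"
  shows "(\<lambda>x. c * f x + d * g x) \<in> L2_closure W"
proof -
  have L: "f \<in> L2" "g \<in> L2" using f g by (auto simp: L2_closure_def)
  have "\<exists>w\<in>W. L2_norm (\<lambda>x. (c * f x + d * g x) - w x) < \<epsilon>" if "\<epsilon> > 0" for \<epsilon>
  proof -
    define \<delta> where "\<delta> = \<epsilon> / (norm c + norm d + 1)"
    have \<delta>: "\<delta> > 0" using that by (simp add: \<delta>_def add_nonneg_pos)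
    obtain u where u: "u \<in> W" "L2_norm (\<lambda>x. f x - u x) < \<delta>"
      using f \<delta> by (auto simp: L2_closure_def)
    obtain v where v: "v \<in> W" "L2_norm (\<lambda>x. g x - v x) < \<delta>"
      using g \<delta> by (auto simp: L2_closure_def)
    have "L2_norm (\<lambda>x. c * (f x - u x) + d * (g x - v x))
        \<le> L2_norm (\<lambda>x. c * (f x - u x)) + L2_norm (\<lambda>x. d * (g x - v x))"
      using L u v W by (intro L2_norm_triangle L2_cmult L2_diff) auto
    also have "\<dots> \<le> norm c * \<delta> + norm d * \<delta>"
      unfolding L2_norm_cmult using u v by (intro add_mono mult_left_mono) auto
    also have "\<dots> < (norm c + norm d + 1) * \<delta>"
      using \<delta> by (simp add: algebra_simps)
    also have "\<dots> = \<epsilon>"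
    proof -
      have "norm c + norm d + 1 \<noteq> 0"
        using norm_ge_zero[of c] norm_ge_zero[of d] by linarith
      then show ?thesis by (simp add: \<delta>_def)
    qed
    finally have "L2_norm (\<lambda>x. (c * f x + d * g x) - (c * u x + d * v x)) < \<epsilon>"
      by (simp add: algebra_simps)
    then show ?thesis
      by (rule bexI[OF _ lin[OF u(1) v(1), of c d]])
  qed
  with L show ?thesis by (auto simp: L2_closure_def)
qed

text \<open>
  Closures in $L^2$ are entered only through dominated convergence: an explicit pointwise limit with
  a common square-integrable bound replaces any norm estimate.
\<close>

lemma L2_closure_dominated:
  fixes f w :: "real^'n \<Rightarrow> complex"
  assumes W: "W \<subseteq> L2"
    and u: "\<And>m::nat. u m \<in> L2_closure W"
    and lim: "\<And>x. (\<lambda>m. u m x) \<longlonglongrightarrow> f x"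
    and w: "w \<in> L2" and bound: "\<And>m x. norm (u m x) \<le> norm (w x)"
  shows "f \<in> L2_closure W"
proof -
  have uL: "u m \<in> L2" for m using u by (auto simp: L2_closure_def)
  note [measurable] = uL[THEN L2_borel] L2_borel[OF w]
  have fm [measurable]: "f \<in> borel_measurable borel"
    by (rule borel_measurable_LIMSEQ_metric[OF _ lim]) measurable
  have fb: "norm (f x) \<le> norm (w x)" for x
    using lim[of x] bound by (intro Lim_bounded[OF tendsto_norm]) auto
  have fL: "f \<in> L2"
    by (rule L2_dominated[OF fm w, of 1]) (simp add: fb)
  have "(\<lambda>m. LINT x|lborel. (norm (f x - u m x))\<^sup>2) \<longlonglongrightarrow> (LINT x|(lborel :: (real^'n) measure). (0::real))"
  proof (rule integral_dominated_convergence[where w = "\<lambda>x. 4 * (norm (w x))\<^sup>2"])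
    show "integrable lborel (\<lambda>x. 4 * (norm (w x))\<^sup>2)"
      using L2_square_integrable[OF w] by simp
    have "(\<lambda>m. (norm (f x - u m x))\<^sup>2) \<longlonglongrightarrow> (norm (f x - f x))\<^sup>2" for x
      by (intro tendsto_intros lim)
    then show "AE x in lborel. (\<lambda>m. (norm (f x - u m x))\<^sup>2) \<longlonglongrightarrow> 0" by simp
    have "(norm (f x - u m x))\<^sup>2 \<le> (2 * norm (w x))\<^sup>2" for m x
      using norm_triangle_ineq4[of "f x" "u m x"] fb[of x] bound[of m x]
      by (intro power_mono) auto
    then show "AE x in lborel. norm ((norm (f x - u m x))\<^sup>2) \<le> 4 * (norm (w x))\<^sup>2" for m
      by (simp add: power_mult_distrib)
  qed measurable
  then have "(\<lambda>m. sqrt (LINT x|lborel. (norm (f x - u m x))\<^sup>2)) \<longlonglongrightarrow> sqrt 0"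
    by (intro tendsto_real_sqrt) simp
  then have lim0: "(\<lambda>m. L2_norm (\<lambda>x. f x - u m x)) \<longlonglongrightarrow> 0"
    by (simp add: L2_norm_def)
  show ?thesis
  proof (rule L2_closure_limit[OF W fL])
    fix \<epsilon> :: real assume "\<epsilon> > 0"
    from eventually_happens'[OF sequentially_bot order_tendstoD(2)[OF lim0 this]]
    obtain m where "L2_norm (\<lambda>x. f x - u m x) < \<epsilon>" by (elim exE)
    then show "\<exists>v\<in>L2_closure W. L2_norm (\<lambda>x. f x - v x) < \<epsilon>"
      by (rule bexI[OF _ u])
  qed
qed

section \<open>Rapid decrease, integration by parts and Schwartz functions\<close>

lemma integrable_prod_inverse_1_plus_square:
  "integrable lborel (\<lambda>x::'a::euclidean_space. \<Prod>b\<in>Basis. inverse (1 + (x \<bullet> b)\<^sup>2))"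
proof (rule integrableI_bounded)
  have fin: "nn_integral lborel (\<lambda>t::real. ennreal (inverse (1 + t\<^sup>2))) < \<infinity>"
  proof -
    have "integrable lborel (\<lambda>t::real. inverse (1 + t\<^sup>2))"
      using integrable_inverse_1_plus_square by (simp add: set_integrable_def)
    then have "nn_integral lborel (\<lambda>t::real. ennreal (norm (inverse (1 + t\<^sup>2)))) < \<infinity>"
      unfolding integrable_iff_bounded by blast
    moreover have "norm (inverse (1 + t\<^sup>2)) = inverse (1 + t\<^sup>2)" for t :: real
      by (simp add: add_nonneg_nonneg)
    ultimately show ?thesis by simp
  qed
  have "nn_integral lborel (\<lambda>x::'a. ennreal (norm (\<Prod>b\<in>Basis. inverse (1 + (x \<bullet> b)\<^sup>2))))
      = nn_integral lborel (\<lambda>x::'a. \<Prod>b\<in>Basis. ennreal (inverse (1 + (x \<bullet> b)\<^sup>2)))"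
    by (simp add: abs_prod prod_ennreal add_nonneg_nonneg)
  also have "\<dots> = (\<Prod>b\<in>(Basis :: 'a set). nn_integral lborel (\<lambda>t::real. ennreal (inverse (1 + t\<^sup>2))))"
    by (rule nn_integral_lborel_prod) auto
  also have "\<dots> < \<infinity>"
    using fin by (simp add: power_less_top_ennreal)
  finally show "nn_integral lborel (\<lambda>x::'a. ennreal (norm (\<Prod>b\<in>Basis. inverse (1 + (x \<bullet> b)\<^sup>2)))) < \<infinity>" .
qed measurable

text \<open>
  The Cauchy density supplies integrability: $\prod_b (1 + x_b^2) \le (1 + |x|)^{2n}$, and the
  reciprocal of the left-hand side is integrable coordinate by coordinate.
\<close>

lemma integrable_inverse_power:
  "integrable lborel (\<lambda>x::'a::euclidean_space. inverse ((1 + norm x) ^ (2 * DIM('a))))"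
  using integrable_prod_inverse_1_plus_square
proof (rule Bochner_Integration.integrable_bound)
  have "inverse ((1 + norm x) ^ (2 * DIM('a))) \<le> (\<Prod>b\<in>Basis. inverse (1 + (x \<bullet> b)\<^sup>2))" for x :: 'a
  proof -
    have "(\<Prod>b\<in>Basis. 1 + (x \<bullet> b)\<^sup>2) \<le> (\<Prod>b\<in>(Basis :: 'a set). (1 + norm x)\<^sup>2)"
    proof (intro prod_mono conjI)
      fix b :: 'a assume "b \<in> Basis"
      then have "(x \<bullet> b)\<^sup>2 \<le> (norm x)\<^sup>2" using Basis_le_norm[of b x] by (simp add: abs_le_square_iff[symmetric])
      then show "1 + (x \<bullet> b)\<^sup>2 \<le> (1 + norm x)\<^sup>2" by (simp add: power2_sum add_increasing2)
    qed (simp add: add_nonneg_nonneg)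
    then have *: "(\<Prod>b\<in>Basis. 1 + (x \<bullet> b)\<^sup>2) \<le> (1 + norm x) ^ (2 * DIM('a))"
      by (simp add: power_mult)
    have "0 < (\<Prod>b\<in>Basis. 1 + (x \<bullet> b)\<^sup>2)"
      by (intro prod_pos) (simp add: add_pos_nonneg)
    from le_imp_inverse_le[OF * this] show ?thesis by (simp add: prod_inversef[symmetric] comp_def)
  qed
  moreover have "0 \<le> inverse ((1 + norm x) ^ (2 * DIM('a)))" for x :: 'a by simp
  ultimately show "AE x in lborel. norm (inverse ((1 + norm (x::'a)) ^ (2 * DIM('a))))
      \<le> norm (\<Prod>b\<in>Basis. inverse (1 + (x \<bullet> b)\<^sup>2))"
    by (intro always_eventually allI) (metis abs_of_nonneg order_trans real_norm_def)
qed measurable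

definition rapidly_decreasing :: "('a::real_normed_vector \<Rightarrow> 'b::real_normed_vector) \<Rightarrow> bool" where
  "rapidly_decreasing f \<longleftrightarrow> (\<forall>m::nat. \<exists>C. \<forall>x. norm x ^ m * norm (f x) \<le> C)"

text \<open>
  Away from the origin the powers of $|x|$ control everything, near it only boundedness does; since
  $(1 + r)^m \le 2^m (1 + r^m)$, one bound with $1 + |x|$ in place of $|x|$ covers both regions.
\<close>

lemma rapidly_decreasing_bound:
  assumes "rapidly_decreasing f"
  obtains C where "C \<ge> 0" "\<And>x. norm (f x) \<le> C * inverse ((1 + norm x) ^ m)"
proof -
  obtain C0 where C0: "\<And>x. norm (f x) \<le> C0"
    using assms unfolding rapidly_decreasing_def by (metis mult_1 power_0)
  obtain Cm where Cm: "\<And>x. norm x ^ m * norm (f x) \<le> Cm"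
    using assms unfolding rapidly_decreasing_def by metis
  have nonneg: "0 \<le> C0" "0 \<le> Cm"
    using order_trans[OF norm_ge_zero C0] order_trans[OF mult_nonneg_nonneg[OF zero_le_power[OF norm_ge_zero] norm_ge_zero] Cm] by auto
  have "norm (f x) \<le> (2 ^ m * (C0 + Cm)) * inverse ((1 + norm x) ^ m)" for x
  proof -
    have "(1 + norm x) ^ m \<le> (2 * max 1 (norm x)) ^ m" by (intro power_mono) auto
    also have "\<dots> = 2 ^ m * max 1 (norm x) ^ m" by (rule power_mult_distrib)
    also have "max 1 (norm x) ^ m \<le> 1 + norm x ^ m" by (auto simp: max_def)
    finally have "(1 + norm x) ^ m * norm (f x) \<le> (2 ^ m * (1 + norm x ^ m)) * norm (f x)"
      by (intro mult_right_mono) auto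
    also have "\<dots> \<le> 2 ^ m * (C0 + Cm)"
      unfolding mult.assoc using C0[of x] Cm[of x]
      by (intro mult_left_mono) (simp_all add: distrib_right)
    finally have "(1 + norm x) ^ m * norm (f x) \<le> 2 ^ m * (C0 + Cm)" .
    moreover have "(1 + norm x) ^ m > 0" by (simp add: add_pos_nonneg)
    ultimately show ?thesis by (simp add: field_simps)
  qed
  then show ?thesis using that[of "2 ^ m * (C0 + Cm)"] nonneg by auto
qed

lemma rapidly_decreasingI:
  assumes "\<And>m. \<exists>C. \<forall>x. (1 + norm x) ^ m * norm (f x) \<le> C"
  shows "rapidly_decreasing f"
  unfolding rapidly_decreasing_def
proof
  fix m
  obtain C where C: "\<And>x. (1 + norm x) ^ m * norm (f x) \<le> C" using assms by blast
  have "norm x ^ m * norm (f x) \<le> (1 + norm x) ^ m * norm (f x)" for x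
    by (intro mult_right_mono power_mono) auto
  then show "\<exists>C. \<forall>x. norm x ^ m * norm (f x) \<le> C" using C order_trans by blast
qed

lemma rapidly_decreasing_mult:
  fixes f g :: "'a::real_normed_vector \<Rightarrow> complex"
  assumes "rapidly_decreasing f" "\<And>x. norm (g x) \<le> K * (1 + norm x) ^ d"
  shows "rapidly_decreasing (\<lambda>x. f x * g x)"
proof (rule rapidly_decreasingI)
  fix m
  obtain C where C: "C \<ge> 0" "\<And>x. norm (f x) \<le> C * inverse ((1 + norm x) ^ (m + d))"
    using rapidly_decreasing_bound[OF assms(1)] by metis
  have "(1 + norm x) ^ m * norm (f x * g x) \<le> C * K" for x
  proof -
    have pos: "1 + norm x > 0" by (simp add: add_pos_nonneg)
    have "norm (f x * g x) \<le> (C * inverse ((1 + norm x) ^ (m + d))) * (K * (1 + norm x) ^ d)"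
      unfolding norm_mult using C assms(2) by (intro mult_mono) auto
    then have "(1 + norm x) ^ m * norm (f x * g x) \<le>
        (1 + norm x) ^ m * ((C * inverse ((1 + norm x) ^ (m + d))) * (K * (1 + norm x) ^ d))"
      using pos by (intro mult_left_mono) auto
    also have "\<dots> = C * K" using pos by (simp add: power_add field_simps)
    finally show ?thesis .
  qed
  then show "\<exists>C. \<forall>x. (1 + norm x) ^ m * norm (f x * g x) \<le> C" by blast
qed

lemma rapidly_decreasing_bounded:
  assumes "rapidly_decreasing f"
  obtains K where "\<And>x. norm (f x) \<le> K"
  using rapidly_decreasing_bound[OF assms, of 0] by auto

lemma rapidly_decreasing_mult_bounded:
  fixes f g :: "'a::real_normed_vector \<Rightarrow> complex"
  assumes "rapidly_decreasing f" "rapidly_decreasing g"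
  shows "rapidly_decreasing (\<lambda>x. f x * g x)"
proof -
  obtain K where "\<And>x. norm (g x) \<le> K" using rapidly_decreasing_bounded[OF assms(2)] by metis
  then show ?thesis using rapidly_decreasing_mult[OF assms(1), of g K 0] by simp
qed

lemma rapidly_decreasing_add:
  assumes "rapidly_decreasing f" "rapidly_decreasing g"
  shows "rapidly_decreasing (\<lambda>x. f x + g x)"
  unfolding rapidly_decreasing_def
proof
  fix m
  obtain C where C: "\<And>x. norm x ^ m * norm (f x) \<le> C" using assms(1) unfolding rapidly_decreasing_def by metis
  obtain D where D: "\<And>x. norm x ^ m * norm (g x) \<le> D" using assms(2) unfolding rapidly_decreasing_def by metis
  have "norm x ^ m * norm (f x + g x) \<le> C + D" for x
  proof -
    have "norm x ^ m * norm (f x + g x) \<le> norm x ^ m * (norm (f x) + norm (g x))"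
      by (intro mult_left_mono norm_triangle_ineq) auto
    then show ?thesis using C[of x] D[of x] by (simp add: algebra_simps)
  qed
  then show "\<exists>C. \<forall>x. norm x ^ m * norm (f x + g x) \<le> C" by blast
qed

lemma rapidly_decreasing_minus: "rapidly_decreasing f \<Longrightarrow> rapidly_decreasing (\<lambda>x. - f x)"
  by (simp add: rapidly_decreasing_def)

lemma rapidly_decreasing_diff:
  "rapidly_decreasing f \<Longrightarrow> rapidly_decreasing g \<Longrightarrow> rapidly_decreasing (\<lambda>x. f x - g x)"
  using rapidly_decreasing_add[of f "\<lambda>x. - g x"] rapidly_decreasing_minus[of g] by simp

lemma rapidly_decreasing_integrable:
  fixes f :: "'a::euclidean_space \<Rightarrow> 'b::{banach, second_countable_topology}"
  assumes "rapidly_decreasing f" and [measurable]: "f \<in> borel_measurable borel"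
  shows "integrable lborel f"
proof -
  obtain C where C: "\<And>x. norm (f x) \<le> C * inverse ((1 + norm x) ^ (2 * DIM('a)))"
    using rapidly_decreasing_bound[OF assms(1)] by metis
  have "integrable lborel (\<lambda>x::'a. C * inverse ((1 + norm x) ^ (2 * DIM('a))))"
    using integrable_inverse_power[where 'a = 'a] by simp
  then show ?thesis
    by (rule Bochner_Integration.integrable_bound) (use C in \<open>auto intro: order_trans[OF _ abs_ge_self]\<close>)
qed

lemma rapidly_decreasing_L2:
  assumes "rapidly_decreasing f" and [measurable]: "f \<in> borel_measurable borel"
  shows "f \<in> L2"
proof (rule L2_I)
  have "integrable lborel (\<lambda>x. f x * f x)"
    using assms by (intro rapidly_decreasing_integrable rapidly_decreasing_mult_bounded) auto
  from integrable_norm[OF this] show "integrable lborel (\<lambda>x. (norm (f x))\<^sup>2)"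
    by (simp add: norm_mult power2_eq_square)
qed fact

lemma partial_eq:
  "(f has_derivative f') (at x) \<Longrightarrow> partial i f x = f' (axis i 1)"
  using frechet_derivative_at[of f f' x] by (simp add: partial_def)

lemma has_derivative_partial_line:
  fixes f :: "real^'n \<Rightarrow> complex"
  assumes "f differentiable (at (x + t *\<^sub>R axis i 1))"
  shows "((\<lambda>s. f (x + s *\<^sub>R axis i 1)) has_vector_derivative partial i f (x + t *\<^sub>R axis i 1)) (at t)"
proof -
  let ?D = "frechet_derivative f (at (x + t *\<^sub>R axis i 1))"
  have f: "(f has_derivative ?D) (at (x + t *\<^sub>R axis i 1))"
    using assms by (simp add: frechet_derivative_works)
  have "((\<lambda>s. x + s *\<^sub>R axis i 1) has_derivative (\<lambda>s. s *\<^sub>R axis i 1)) (at t)"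
    by (auto intro!: derivative_eq_intros)
  from has_derivative_compose[OF this f]
  have "((\<lambda>s. f (x + s *\<^sub>R axis i 1)) has_derivative (\<lambda>s. ?D (s *\<^sub>R axis i 1))) (at t)" .
  moreover have "(\<lambda>s. ?D (s *\<^sub>R axis i 1)) = (\<lambda>s. s *\<^sub>R partial i f (x + t *\<^sub>R axis i 1))"
    using linear_scale[OF has_derivative_linear[OF f]] by (simp add: partial_def)
  ultimately show ?thesis by (simp add: has_vector_derivative_def)
qed

lemma integral_translate:
  fixes f :: "'a::euclidean_space \<Rightarrow> 'b::{banach, second_countable_topology}"
  assumes [measurable]: "f \<in> borel_measurable borel"
  shows "(LINT x|lborel. f (x + c)) = (LINT x|lborel. f x)"
    and "integrable lborel f \<Longrightarrow> integrable lborel (\<lambda>x. f (x + c))"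
proof -
  have "(LINT x|distr lborel borel ((+) c). f x) = (LINT x|lborel. f (c + x))"
    by (rule integral_distr) auto
  then show "(LINT x|lborel. f (x + c)) = (LINT x|lborel. f x)"
    by (simp add: lborel_distr_plus add.commute)
  assume "integrable lborel f"
  then have "integrable (distr lborel borel ((+) c)) f" by (simp add: lborel_distr_plus)
  then show "integrable lborel (\<lambda>x. f (x + c))"
    by (subst (asm) integrable_distr_eq) (auto simp: add.commute)
qed

text \<open>
  The integral of a partial derivative is the limit of the integrals of the difference quotients,
  and those vanish because Lebesgue measure is translation invariant. The mean value inequality
  bounds the quotients by values of the derivative at distance at most one, which rapid decrease
  dominates by a multiple of an integrable function. This avoids Fubini's theorem and needs no
  splitting of the space into a line and its complement.
\<close>

lemma integral_partial_eq_0: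
  fixes F :: "real^'n \<Rightarrow> complex"
  assumes diff: "\<And>x. F differentiable (at x)"
    and F: "rapidly_decreasing F" and dF: "rapidly_decreasing (partial i F)"
  shows "(LINT x|lborel. partial i F x) = 0"
proof -
  define e where "e = (axis i 1 :: real^'n)"
  have e: "norm e = 1" by (simp add: e_def)
  \<comment> \<open>difference quotients along the steps $1/(m+1)$\<close>
  define D where "D m x = of_nat (Suc m) * (F (x + inverse (real (Suc m)) *\<^sub>R e) - F x)" for m :: nat and x
  have contF: "continuous_on UNIV F"
    using diff by (intro continuous_at_imp_continuous_on) (auto intro: differentiable_imp_continuous_within)
  have [measurable]: "F \<in> borel_measurable borel" by (rule borel_measurable_continuous_onI[OF contF])
  have intF: "integrable lborel F" using F by (intro rapidly_decreasing_integrable) auto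
  have Dlim: "(\<lambda>m. D m x) \<longlonglongrightarrow> partial i F x" for x
  proof -
    define h where "h m = inverse (real (Suc m))" for m
    have "((\<lambda>s. F (x + s *\<^sub>R e)) has_derivative (\<lambda>s. s *\<^sub>R partial i F x)) (at 0)"
      using has_derivative_partial_line[of F x 0 i] diff by (simp add: e_def has_vector_derivative_def)
    then have "((\<lambda>s. norm (F (x + s *\<^sub>R e) - F x - s *\<^sub>R partial i F x) / norm s) \<longlongrightarrow> 0) (at 0)"
      by (simp add: has_derivative_at)
    moreover have "filterlim h (at 0) sequentially"
      unfolding filterlim_at h_def using LIMSEQ_inverse_real_of_nat by auto
    ultimately have "(\<lambda>m. norm (F (x + h m *\<^sub>R e) - F x - h m *\<^sub>R partial i F x) / norm (h m)) \<longlonglongrightarrow> 0"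
      by (rule filterlim_compose)
    moreover have "norm (F (x + h m *\<^sub>R e) - F x - h m *\<^sub>R partial i F x) / norm (h m) = norm (D m x - partial i F x)" for m
    proof -
      have "h m > 0" by (simp add: h_def)
      have "F (x + h m *\<^sub>R e) - F x - h m *\<^sub>R partial i F x = h m *\<^sub>R (D m x - partial i F x)"
        by (simp add: D_def h_def scaleR_conv_of_real field_simps del: of_nat_Suc)
      then show ?thesis using \<open>h m > 0\<close> by simp
    qed
    ultimately have "(\<lambda>m. norm (D m x - partial i F x)) \<longlonglongrightarrow> 0" by simp
    then show ?thesis by (simp add: tendsto_norm_zero_iff LIM_zero_iff)
  qed
  have [measurable]: "D m \<in> borel_measurable borel" for m unfolding D_def by measurable
  have [measurable]: "partial i F \<in> borel_measurable borel"
    by (rule borel_measurable_LIMSEQ_metric[OF _ Dlim]) measurable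
  obtain C where C0: "C \<ge> 0" and C: "\<And>x. norm (partial i F x) \<le> C * inverse ((1 + norm x) ^ (2 * DIM(real^'n)))"
    using rapidly_decreasing_bound[OF dF] by metis
  let ?w = "\<lambda>x::real^'n. (C * 2 ^ (2 * DIM(real^'n))) * inverse ((1 + norm x) ^ (2 * DIM(real^'n)))"
  have bound: "norm (D m x) \<le> ?w x" for m x
  proof -
    define h where "h = inverse (real (Suc m))"
    have h: "0 < h" "h \<le> 1" by (auto simp: h_def inverse_le_1_iff)
    let ?\<phi> = "\<lambda>s. F (x + s *\<^sub>R e)"
    have der: "(?\<phi> has_derivative (\<lambda>t. t *\<^sub>R partial i F (x + s *\<^sub>R e))) (at s)" for s
      using has_derivative_partial_line[of F x s i] diff by (simp add: e_def has_vector_derivative_def)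
    have "\<exists>s\<in>{0<..<h}. norm (?\<phi> h - ?\<phi> 0) \<le> norm ((h - 0) *\<^sub>R partial i F (x + s *\<^sub>R e))"
      using h by (intro mvt_general) (auto intro!: der continuous_at_imp_continuous_on has_derivative_continuous)
    then obtain s where s: "0 < s" "s < h" "norm (?\<phi> h - ?\<phi> 0) \<le> h * norm (partial i F (x + s *\<^sub>R e))"
      using h by auto
    have "norm (D m x) = norm (?\<phi> h - ?\<phi> 0) / h"
      unfolding D_def h_def norm_mult by (simp add: norm_of_nat divide_inverse mult.commute del: of_nat_Suc)
    also have "\<dots> \<le> norm (partial i F (x + s *\<^sub>R e))"
      using s(3) h by (simp add: field_simps)
    also have "\<dots> \<le> C * inverse ((1 + norm (x + s *\<^sub>R e)) ^ (2 * DIM(real^'n)))"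
      by (rule C)
    also have "\<dots> \<le> C * inverse (((1 + norm x) / 2) ^ (2 * DIM(real^'n)))"
    proof -
      have "norm x \<le> norm (x + s *\<^sub>R e) + norm (s *\<^sub>R e)"
        using norm_triangle_ineq4[of "x + s *\<^sub>R e" "s *\<^sub>R e"] by simp
      moreover have "norm (s *\<^sub>R e) \<le> 1" using s h e by simp
      moreover have "(1 + u) / 2 \<le> 1 + v" if "u \<le> v + w" "w \<le> 1" "0 \<le> v" for u v w :: real
        using that by simp
      ultimately have "(1 + norm x) / 2 \<le> 1 + norm (x + s *\<^sub>R e)"
        using norm_ge_zero by blast
      then show ?thesis using C0
        by (intro mult_left_mono le_imp_inverse_le power_mono zero_less_power) (auto simp: add_pos_nonneg)
    qed
    also have "\<dots> = ?w x"
      unfolding power_divide inverse_divide by (simp only: divide_inverse mult.assoc)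
    finally show ?thesis .
  qed
  have "(\<lambda>m. LINT x|lborel. D m x) \<longlonglongrightarrow> (LINT x|lborel. partial i F x)"
  proof (rule integral_dominated_convergence[where w = ?w])
    show "integrable lborel ?w" using integrable_inverse_power[where 'a = "real^'n"] by simp
  qed (use Dlim bound in auto)
  moreover have "(LINT x|lborel. D m x) = 0" for m
    unfolding D_def using integral_translate[of F] intF by simp
  ultimately show ?thesis by (simp add: LIMSEQ_const_iff)
qed

lemma schwartz_differentiable: "f \<in> schwartz \<Longrightarrow> f differentiable (at x)"
  unfolding schwartz_def partials_def by (force dest: spec[of _ "[]"])

lemma schwartz_rapidly_decreasing: "f \<in> schwartz \<Longrightarrow> rapidly_decreasing f"
  unfolding schwartz_def partials_def rapidly_decreasing_def by (force dest: spec[of _ "[]"])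

text \<open>
  Iterated derivatives are indexed by lists, and appending an index to the list means
  differentiating once more at the innermost position.
\<close>

lemma schwartz_partial: "f \<in> schwartz \<Longrightarrow> partial i f \<in> schwartz"
  unfolding schwartz_def partials_def mem_Collect_eq
proof
  fix js assume "\<forall>js. (\<forall>x. foldr partial js f differentiable at x) \<and>
     (\<forall>m::nat. \<exists>C. \<forall>x. norm x ^ m * norm (foldr partial js f x) \<le> C)"
  from spec[OF this, of "js @ [i]"]
  show "(\<forall>x. foldr partial js (partial i f) differentiable at x) \<and>
     (\<forall>m::nat. \<exists>C. \<forall>x. norm x ^ m * norm (foldr partial js (partial i f) x) \<le> C)" by simp
qed

lemma schwartz_borel: "f \<in> schwartz \<Longrightarrow> f \<in> borel_measurable borel"
  by (intro borel_measurable_continuous_onI continuous_at_imp_continuous_on)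
     (auto intro: differentiable_imp_continuous_within schwartz_differentiable)

lemma schwartz_L2: "f \<in> schwartz \<Longrightarrow> f \<in> L2"
  by (intro rapidly_decreasing_L2 schwartz_rapidly_decreasing schwartz_borel)

lemma schwartz_mult_integrable:
  "f \<in> schwartz \<Longrightarrow> g \<in> schwartz \<Longrightarrow> integrable lborel (\<lambda>x. f x * g x)"
  by (intro rapidly_decreasing_integrable rapidly_decreasing_mult_bounded schwartz_rapidly_decreasing
      borel_measurable_times schwartz_borel)

lemma partial_mult:
  assumes "f differentiable (at x)" "g differentiable (at x)"
  shows "partial i (\<lambda>x. f x * g x) x = partial i f x * g x + f x * partial i g x"
proof -
  have "((\<lambda>x. f x * g x) has_derivative
      (\<lambda>h. f x * frechet_derivative g (at x) h + frechet_derivative f (at x) h * g x)) (at x)"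
    using assms by (intro has_derivative_mult) (simp_all add: frechet_derivative_works)
  from partial_eq[OF this] show ?thesis by (simp add: partial_def)
qed

lemma partial_diff:
  assumes "f differentiable (at x)" "g differentiable (at x)"
  shows "partial i (\<lambda>x. f x - g x) x = partial i f x - partial i g x"
proof -
  have "((\<lambda>x. f x - g x) has_derivative
      (\<lambda>h. frechet_derivative f (at x) h - frechet_derivative g (at x) h)) (at x)"
    using assms by (intro has_derivative_diff) (simp_all add: frechet_derivative_works)
  from partial_eq[OF this] show ?thesis by (simp add: partial_def)
qed

text \<open>
  Green's identity: the difference of the two integrands is the partial derivative of
  $(\partial_i f)\, g - f\, \partial_i g$.
\<close>

lemma second_partial_symmetric:
  assumes f: "f \<in> schwartz" and g: "g \<in> schwartz"
  shows "(LINT x|lborel. partial i (partial i f) x * g x) = (LINT x|lborel. f x * partial i (partial i g) x)"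
proof -
  note S = f g schwartz_partial[OF f, of i] schwartz_partial[OF g, of i]
    schwartz_partial[OF schwartz_partial[OF f, of i], of i] schwartz_partial[OF schwartz_partial[OF g, of i], of i]
  note d = S[THEN schwartz_differentiable] and r = S[THEN schwartz_rapidly_decreasing]
  define F where "F = (\<lambda>x. partial i f x * g x - f x * partial i g x)"
  have dF: "partial i F x = partial i (partial i f) x * g x - f x * partial i (partial i g) x" for x
    unfolding F_def by (simp add: partial_diff partial_mult differentiable_mult d)
  have "(LINT x|lborel. partial i F x) = 0"
  proof (rule integral_partial_eq_0)
    show "F differentiable at x" for x
      unfolding F_def by (intro differentiable_diff differentiable_mult d)
    show "rapidly_decreasing F"
      unfolding F_def by (intro rapidly_decreasing_diff rapidly_decreasing_mult_bounded r)
    show "rapidly_decreasing (partial i F)"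
      unfolding dF[abs_def] by (intro rapidly_decreasing_diff rapidly_decreasing_mult_bounded r)
  qed
  then show ?thesis
    unfolding dF using S by (simp add: schwartz_mult_integrable)
qed

lemma laplacian_symmetric:
  assumes f: "f \<in> schwartz" and g: "g \<in> schwartz"
  shows "(LINT x|lborel. laplacian f x * g x) = (LINT x|lborel. f x * laplacian g x)"
  unfolding laplacian_def sum_distrib_left sum_distrib_right
  using f g by (simp add: schwartz_mult_integrable schwartz_partial second_partial_symmetric)

section \<open>Hermite polynomials and Hermite functions\<close>

text \<open>
  The physicists' normalisation, with leading coefficient $2^m$. The recursion is chosen because it
  says that $H_{m+1} e^{-x^2}$ is minus the derivative of $H_m e^{-x^2}$, which drives the count of
  zeros below.
\<close>

fun hermite :: "nat \<Rightarrow> real poly" where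
  "hermite 0 = 1"
| "hermite (Suc m) = [:0, 2:] * hermite m - pderiv (hermite m)"

lemma pderiv_hermite: "pderiv (hermite (Suc m)) = smult (2 * real (Suc m)) (hermite m)"
proof (induction m)
  case 0
  show ?case by (simp add: pderiv_pCons pderiv_diff one_pCons)
next
  case (Suc m)
  let ?c = "2 * real (Suc m)"
  have "pderiv (hermite (Suc (Suc m))) = 
     smult 2 (hermite (Suc m)) + [:0, 2:] * pderiv (hermite (Suc m)) - pderiv (pderiv (hermite (Suc m)))"
    by (subst hermite.simps(2)) (simp add: pderiv_diff pderiv_mult pderiv_pCons pderiv_smult del: hermite.simps)
  also have "\<dots> = smult 2 (hermite (Suc m)) + smult ?c ([:0, 2:] * hermite m - pderiv (hermite m))"
    unfolding Suc by (simp add: pderiv_smult smult_diff_right del: hermite.simps)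
  also have "\<dots> = smult (2 + ?c) (hermite (Suc m))"
    by (simp only: hermite.simps smult_add_left)
  finally show ?case by (simp add: algebra_simps)
qed

lemma hermite_ode:
  "poly (pderiv (pderiv (hermite m))) x = 2 * x * poly (pderiv (hermite m)) x - 2 * real m * poly (hermite m) x"
proof (cases m)
  case 0 then show ?thesis by simp
next
  case (Suc k)
  have "poly (hermite (Suc k)) x = 2 * x * poly (hermite k) x - poly (pderiv (hermite k)) x"
    by simp
  then have *: "poly (pderiv (hermite k)) x = 2 * x * poly (hermite k) x - poly (hermite (Suc k)) x"
    by linarith
  have "poly (pderiv (pderiv (hermite m))) x = 2 * real (Suc k) * poly (pderiv (hermite k)) x"
    unfolding Suc pderiv_hermite by (simp add: pderiv_smult)
  also have "\<dots> = 2 * x * poly (pderiv (hermite m)) x - 2 * real m * poly (hermite m) x"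
    unfolding Suc pderiv_hermite * by (simp add: algebra_simps del: hermite.simps)
  finally show ?thesis .
qed

lemma hermite_neq_0: "hermite m \<noteq> 0"
proof (induction m)
  case (Suc m)
  then have "pderiv (hermite (Suc m)) \<noteq> 0"
    unfolding pderiv_hermite by simp
  then show ?case by auto
qed simp

lemma degree_hermite_le: "degree (hermite m) \<le> m"
proof (induction m)
  case (Suc m)
  have "degree ([:0, 2:] * hermite m) \<le> Suc m"
    using degree_mult_le[of "[:0, 2:]" "hermite m"] Suc by simp
  moreover have "degree (pderiv (hermite m)) \<le> Suc m"
    using Suc by (simp add: degree_pderiv)
  ultimately show ?case by (auto intro: degree_diff_le)
qed simp

text \<open>
  Rolle's theorem on a half-line with vanishing limit at infinity. Either $g$ vanishes again at
  $z + 1$, and the ordinary theorem applies, or $g^2$ is eventually smaller than its value at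
  $z + 1$ and so attains an interior maximum, where $2 g g' = 0$ with $g \neq 0$.
\<close>

lemma Rolle_at_top:
  fixes g :: "real \<Rightarrow> real"
  assumes der: "\<And>x. (g has_real_derivative g' x) (at x)" and z: "g z = 0"
    and lim: "(g \<longlongrightarrow> 0) at_top"
  shows "\<exists>w>z. g' w = 0"
proof (cases "g (z + 1) = 0")
  case True
  have "\<exists>w. z < w \<and> w < z + 1 \<and> (g has_real_derivative 0) (at w)"
    using z True der
    by (intro Rolle) (auto intro: DERIV_continuous_on DERIV_subset simp: real_differentiable_def)
  then show ?thesis using DERIV_unique[OF der] by blast
next
  case False
  have "eventually (\<lambda>Y. \<bar>g Y\<bar> < \<bar>g (z + 1)\<bar>) at_top"
    using tendsto_rabs[OF lim] False by (intro order_tendstoD) auto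
  then have "eventually (\<lambda>Y. \<bar>g Y\<bar> < \<bar>g (z + 1)\<bar> \<and> Y > z + 1) at_top"
    using eventually_gt_at_top by eventually_elim auto
  then obtain Y where Y: "\<bar>g Y\<bar> < \<bar>g (z + 1)\<bar>" "Y > z + 1"
    using eventually_happens'[OF trivial_limit_at_top_linorder] by blast
  have cont: "continuous_on {z..Y} (\<lambda>x. (g x)\<^sup>2)"
    by (intro continuous_intros) (meson DERIV_continuous_on der has_field_derivative_at_within)
  then obtain w where w: "w \<in> {z..Y}" "\<And>y. y \<in> {z..Y} \<Longrightarrow> (g y)\<^sup>2 \<le> (g w)\<^sup>2"
    using continuous_attains_sup[OF compact_Icc _ cont] Y by auto
  have big: "(g (z + 1))\<^sup>2 \<le> (g w)\<^sup>2" using w(2) Y by auto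
  have "(g Y)\<^sup>2 < (g (z + 1))\<^sup>2" using power_strict_mono[OF Y(1), of 2] by simp
  then have ne: "w \<noteq> Y" "w \<noteq> z" "g w \<noteq> 0" using big z False by auto
  have "((\<lambda>x. (g x)\<^sup>2) has_real_derivative 2 * g w * g' w) (at w)"
    by (auto intro!: derivative_eq_intros der)
  moreover have "\<forall>y. \<bar>w - y\<bar> < min (w - z) (Y - w) \<longrightarrow> (g y)\<^sup>2 \<le> (g w)\<^sup>2"
    by (auto intro!: w(2))
  moreover have "0 < min (w - z) (Y - w)" using w(1) ne by auto
  ultimately have "2 * g w * g' w = 0" by (meson DERIV_local_max)
  then show ?thesis using ne w(1) by (intro exI[of _ w]) auto
qed

text \<open>
  Reflection reduces the other half-line to \<open>Rolle_at_top\<close>.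
\<close>

lemma Rolle_at_bot:
  fixes g :: "real \<Rightarrow> real"
  assumes der: "\<And>x. (g has_real_derivative g' x) (at x)" and z: "g z = 0"
    and lim: "(g \<longlongrightarrow> 0) at_bot"
  shows "\<exists>w<z. g' w = 0"
proof -
  have "\<exists>w>-z. - g' (- w) = 0"
  proof (rule Rolle_at_top)
    show "((\<lambda>x. g (- x)) has_real_derivative - g' (- x)) (at x)" for x
      using DERIV_chain2[OF der, of uminus "-1" x UNIV] by (simp add: DERIV_minus[OF DERIV_ident])
    show "((\<lambda>x. g (- x)) \<longlongrightarrow> 0) at_top"
      using lim by (simp add: filterlim_at_bot_mirror)
  qed (use z in auto)
  then show ?thesis by (metis minus_less_iff neg_equal_0_iff_equal)
qed

lemma power_times_Gaussian_tendsto_0: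
  "((\<lambda>x::real. x ^ k * exp (- x\<^sup>2)) \<longlongrightarrow> 0) at_top"
proof -
  have "((\<lambda>x::real. x ^ k / exp x * exp (x - x\<^sup>2)) \<longlongrightarrow> 0 * 0) at_top"
  proof (rule tendsto_mult[OF tendsto_power_div_exp_0])
    have "filterlim (\<lambda>x::real. x - x\<^sup>2) at_bot at_top" by real_asymp
    then show "((\<lambda>x::real. exp (x - x\<^sup>2)) \<longlongrightarrow> 0) at_top"
      by (rule filterlim_compose[OF exp_at_bot])
  qed
  then show ?thesis by (simp add: exp_diff exp_minus field_simps)
qed

lemma poly_times_Gaussian_tendsto_0:
  fixes p :: "real poly"
  shows "((\<lambda>x. poly p x * exp (- x\<^sup>2)) \<longlongrightarrow> 0) at_top" (is ?top)
    and "((\<lambda>x. poly p x * exp (- x\<^sup>2)) \<longlongrightarrow> 0) at_bot" (is ?bot)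
proof -
  have top: "((\<lambda>x. poly q x * exp (- x\<^sup>2)) \<longlongrightarrow> 0) at_top" for q :: "real poly"
    unfolding poly_altdef sum_distrib_right mult.assoc
    by (intro tendsto_null_sum tendsto_mult_right_zero power_times_Gaussian_tendsto_0)
  then show ?top .
  show ?bot
    using top[of "pcompose p [:0, -1:]"] by (simp add: filterlim_at_bot_mirror poly_pcompose)
qed

lemma hermite_Gaussian_deriv:
  "((\<lambda>x. poly (hermite m) x * exp (- x\<^sup>2)) has_real_derivative
      - (poly (hermite (Suc m)) x * exp (- x\<^sup>2))) (at x)"
  by (auto intro!: derivative_eq_intros simp: algebra_simps)

text \<open>
  Rolle's theorem applied to $H_m e^{-x^2}$, which also tends to zero at both ends: between its $m$
  zeros and beyond the first and the last one, the derivative $- H_{m+1} e^{-x^2}$ has $m + 1$ zeros.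
\<close>

lemma hermite_ordered_zeros:
  "\<exists>z :: nat \<Rightarrow> real. (\<forall>i<m. poly (hermite m) (z i) = 0) \<and> (\<forall>i j. i < j \<and> j < m \<longrightarrow> z i < z j)"
proof (induction m)
  case (Suc m)
  then obtain z :: "nat \<Rightarrow> real" where z: "\<And>i. i < m \<Longrightarrow> poly (hermite m) (z i) = 0"
    and mono: "\<And>i j. i < j \<Longrightarrow> j < m \<Longrightarrow> z i < z j" by blast
  show ?case
  proof (cases "m = 0")
    case True
    \<comment> \<open>without a zero to start from, $H_1 = 2 x$ is treated directly\<close>
    then show ?thesis by (intro exI[of _ "\<lambda>_. 0"]) (auto simp: one_pCons)
  next
    case False
    define g where "g = (\<lambda>x. poly (hermite m) x * exp (- x\<^sup>2))"
    define g' where "g' = (\<lambda>x. - (poly (hermite (Suc m)) x * exp (- x\<^sup>2)))"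
    have der: "(g has_real_derivative g' x) (at x)" for x
      unfolding g_def g'_def by (rule hermite_Gaussian_deriv)
    have gz: "g (z i) = 0" if "i < m" for i using z[OF that] by (simp add: g_def)
    have "\<exists>w. g' w = 0 \<and> (i > 0 \<longrightarrow> z (i - 1) < w) \<and> (i < m \<longrightarrow> w < z i)" if "i \<le> m" for i
    proof -
      consider "i = 0" | "i = m" | "0 < i" "i < m" using \<open>i \<le> m\<close> by fastforce
      then show ?thesis
      proof cases
        case 1
        have "\<exists>w<z 0. g' w = 0"
          by (rule Rolle_at_bot[OF der gz])
             (use False in \<open>auto simp: g_def poly_times_Gaussian_tendsto_0(2)\<close>)
        with 1 show ?thesis by auto
      next
        case 2
        have "\<exists>w>z (m - 1). g' w = 0"
          by (rule Rolle_at_top[OF der gz])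
             (use False in \<open>auto simp: g_def poly_times_Gaussian_tendsto_0(1)\<close>)
        with 2 show ?thesis by auto
      next
        case 3
        have "z (i - 1) < z i" using mono[of "i - 1" i] 3 by simp
        moreover have "g (z (i - 1)) = g (z i)" using gz[of i] gz[of "i - 1"] 3 by simp
        ultimately have "\<exists>w. z (i - 1) < w \<and> w < z i \<and> (g has_real_derivative 0) (at w)"
          using der
          by (intro Rolle) (auto intro: DERIV_continuous_on DERIV_subset simp: real_differentiable_def)
        then show ?thesis using DERIV_unique[OF der] by blast
      qed
    qed
    then obtain w where w: "\<And>i. i \<le> m \<Longrightarrow> g' (w i) = 0"
      and lo: "\<And>i. i \<le> m \<Longrightarrow> i > 0 \<Longrightarrow> z (i - 1) < w i" and hi: "\<And>i. i < m \<Longrightarrow> w i < z i"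
      by (metis less_imp_le)
    have "w i < w j" if "i < j" "j < Suc m" for i j
    proof -
      have "w i < z i" using hi that by simp
      also have "z i \<le> z (j - 1)" using mono[of i "j - 1"] that by (cases "i = j - 1") (auto intro: less_imp_le)
      also have "\<dots> < w j" using lo[of j] that by simp
      finally show ?thesis .
    qed
    moreover have "poly (hermite (Suc m)) (w i) = 0" if "i < Suc m" for i
      using w[of i] that by (simp add: g'_def del: hermite.simps)
    ultimately show ?thesis by blast
  qed
qed simp

lemma card_hermite_zeros: "finite {x. poly (hermite m) x = 0}" "card {x. poly (hermite m) x = 0} = m"
proof -
  show fin: "finite {x. poly (hermite m) x = 0}"
    using poly_roots_finite[OF hermite_neq_0] .
  obtain z :: "nat \<Rightarrow> real" where z: "\<And>i. i < m \<Longrightarrow> poly (hermite m) (z i) = 0"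
    and mono: "\<And>i j. i < j \<Longrightarrow> j < m \<Longrightarrow> z i < z j" using hermite_ordered_zeros[of m] by blast
  have "inj_on z {..<m}"
    by (rule inj_onI) (metis lessThan_iff less_irrefl linorder_less_linear mono)
  then have "m = card (z ` {..<m})" by (simp add: card_image)
  also have "\<dots> \<le> card {x. poly (hermite m) x = 0}"
    using fin z by (intro card_mono) auto
  finally have "m \<le> card {x. poly (hermite m) x = 0}" .
  moreover have "card {x. poly (hermite m) x = 0} \<le> m"
    using card_poly_roots_bound[OF hermite_neq_0, of m] degree_hermite_le[of m] by simp
  ultimately show "card {x. poly (hermite m) x = 0} = m" by simp
qed

definition hermite_fun :: "real \<Rightarrow> nat \<Rightarrow> real \<Rightarrow> real" where
  "hermite_fun b m t = poly (hermite m) (sqrt b * t) * exp (- (b * t\<^sup>2 / 2))"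

text \<open>
  The derivative of \<open>hermite_fun\<close>, kept as a function of its own so that the second derivative can be
  computed from it.
\<close>

definition hermite_fun_deriv :: "real \<Rightarrow> nat \<Rightarrow> real \<Rightarrow> real" where
  "hermite_fun_deriv b m t = sqrt b * (poly (pderiv (hermite m)) (sqrt b * t)
      - sqrt b * t * poly (hermite m) (sqrt b * t)) * exp (- (b * t\<^sup>2 / 2))"

lemma DERIV_hermite_fun:
  assumes "b > 0"
  shows "(hermite_fun b m has_real_derivative hermite_fun_deriv b m t) (at t)"
proof -
  have "sqrt b * sqrt b = b" using assms by simp
  then show ?thesis
    unfolding hermite_fun_def[abs_def] hermite_fun_deriv_def
    by (auto intro!: derivative_eq_intros DERIV_chain2[OF poly_DERIV] simp: algebra_simps)
qed

text \<open>
  The one-dimensional oscillator equation, obtained from the Hermite equation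
  $H_m'' = 2 y H_m' - 2 m H_m$ by the substitution $y = \sqrt{b}\, t$.
\<close>

lemma DERIV_hermite_fun_deriv:
  assumes "b > 0"
  shows "(hermite_fun_deriv b m has_real_derivative
           (b\<^sup>2 * t\<^sup>2 - b * (2 * real m + 1)) * hermite_fun b m t) (at t)"
proof -
  have s: "sqrt b * sqrt b = b" using assms by simp
  define y where "y = sqrt b * t"
  define P where "P = poly (hermite m) y"
  define P1 where "P1 = poly (pderiv (hermite m)) y"
  define P2 where "P2 = poly (pderiv (pderiv (hermite m))) y"
  define E where "E = exp (- (b * t\<^sup>2 / 2))"
  have ode: "P2 = 2 * y * P1 - 2 * real m * P"
    unfolding P_def P1_def P2_def by (rule hermite_ode)
  have bt: "b * t = sqrt b * y" using s by (simp add: y_def flip: mult.assoc)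
  have "(hermite_fun_deriv b m has_real_derivative
     sqrt b * (P2 * sqrt b - (sqrt b * P + y * (P1 * sqrt b))) * E + sqrt b * (P1 - y * P) * (- (b * t) * E)) (at t)"
    unfolding hermite_fun_deriv_def[abs_def] P_def P1_def P2_def E_def y_def
    by (auto intro!: derivative_eq_intros DERIV_chain2[OF poly_DERIV] simp: algebra_simps)
  moreover have "sqrt b * (P2 * sqrt b - (sqrt b * P + y * (P1 * sqrt b))) * E + sqrt b * (P1 - y * P) * (- (b * t) * E)
     = (sqrt b * sqrt b) * (P2 - P - y * P1 - y * (P1 - y * P)) * E"
    unfolding bt by (simp add: algebra_simps)
  moreover have "\<dots> = b * (y\<^sup>2 - (2 * real m + 1)) * P * E"
    unfolding s ode by (simp add: algebra_simps power2_eq_square)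
  moreover have "b * (y\<^sup>2 - (2 * real m + 1)) * P * E = (b\<^sup>2 * t\<^sup>2 - b * (2 * real m + 1)) * hermite_fun b m t"
    using assms by (simp add: hermite_fun_def P_def E_def y_def power_mult_distrib algebra_simps power2_eq_square)
  ultimately show ?thesis by simp
qed

text \<open>
  The three-term recurrence. For $m = 0$ the truncated index $m - 1$ is harmless, since its
  coefficient is zero.
\<close>

lemma hermite_fun_times_arg:
  assumes "b > 0"
  shows "t * hermite_fun b m t =
     (1 / (2 * sqrt b)) * hermite_fun b (Suc m) t + (real m / sqrt b) * hermite_fun b (m - 1) t"
proof -
  define y where "y = sqrt b * t"
  have t: "t = y / sqrt b" using assms by (simp add: y_def)
  have "poly (pderiv (hermite m)) y = 2 * real m * poly (hermite (m - 1)) y"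
    by (cases m) (simp_all add: pderiv_hermite del: hermite.simps(2))
  then have "y * poly (hermite m) y = poly (hermite (Suc m)) y / 2 + real m * poly (hermite (m - 1)) y"
    by (simp add: field_simps)
  then have "t * poly (hermite m) y = (1 / (2 * sqrt b)) * poly (hermite (Suc m)) y + (real m / sqrt b) * poly (hermite (m - 1)) y"
    unfolding t using assms by (simp add: field_simps del: hermite.simps)
  then show ?thesis
    unfolding hermite_fun_def y_def[symmetric]
    by (metis (no_types, opaque_lifting) distrib_right mult.assoc)
qed

lemma card_hermite_fun_zeros:
  assumes "b > 0"
  shows "finite {t. hermite_fun b m t = 0}" "card {t. hermite_fun b m t = 0} = m"
proof -
  have inj: "inj_on (\<lambda>y. y / sqrt b) A" for A using assms by (auto simp: inj_on_def)
  have eq: "{t. hermite_fun b m t = 0} = (\<lambda>y. y / sqrt b) ` {y. poly (hermite m) y = 0}"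
  proof (intro set_eqI iffI)
    fix t assume "t \<in> {t. hermite_fun b m t = 0}"
    then show "t \<in> (\<lambda>y. y / sqrt b) ` {y. poly (hermite m) y = 0}"
      using assms by (intro image_eqI[of _ _ "sqrt b * t"]) (auto simp: hermite_fun_def)
  qed (use assms in \<open>auto simp: hermite_fun_def\<close>)
  show "finite {t. hermite_fun b m t = 0}" "card {t. hermite_fun b m t = 0} = m"
    unfolding eq by (simp_all add: card_hermite_zeros card_image[OF inj])
qed

section \<open>Hermite states as Schwartz eigenfunctions\<close>

lemma real_polynomial_function_has_derivative:
  fixes p :: "'a::real_normed_vector \<Rightarrow> real"
  assumes "real_polynomial_function p"
  shows "\<exists>p'. (\<forall>x. (p has_derivative p' x) (at x)) \<and> (\<forall>v. real_polynomial_function (\<lambda>x. p' x v))"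
  using assms
proof induction
  case (linear f)
  then show ?case
    by (intro exI[of _ "\<lambda>_. f"]) (auto intro: bounded_linear_imp_has_derivative)
next
  case (const c)
  then show ?case by (intro exI[of _ "\<lambda>_ _. 0"]) auto
next
  case (add f g)
  then obtain f' g' where "\<forall>x. (f has_derivative f' x) (at x)" "\<forall>v. real_polynomial_function (\<lambda>x. f' x v)"
    "\<forall>x. (g has_derivative g' x) (at x)" "\<forall>v. real_polynomial_function (\<lambda>x. g' x v)" by blast
  then show ?case
    by (intro exI[of _ "\<lambda>x h. f' x h + g' x h"]) (auto intro!: has_derivative_add)
next
  case (mult f g)
  then obtain f' g' where "\<forall>x. (f has_derivative f' x) (at x)" "\<forall>v. real_polynomial_function (\<lambda>x. f' x v)"
    "\<forall>x. (g has_derivative g' x) (at x)" "\<forall>v. real_polynomial_function (\<lambda>x. g' x v)" by blast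
  then show ?case
    by (intro exI[of _ "\<lambda>x h. f x * g' x h + f' x h * g x"])
       (simp add: has_derivative_mult mult.hyps real_polynomial_function.intros(3,4))
qed

text \<open>
  Polynomial growth is what a Gaussian factor has to beat in order to give rapid decrease.
\<close>

lemma real_polynomial_function_growth:
  fixes p :: "'a::real_normed_vector \<Rightarrow> real"
  assumes "real_polynomial_function p"
  shows "\<exists>K d. K \<ge> 0 \<and> (\<forall>x. \<bar>p x\<bar> \<le> K * (1 + norm x) ^ d)"
  using assms
proof induction
  case (linear f)
  then obtain K where K: "\<And>x. norm (f x) \<le> norm x * K" "K \<ge> 0"
    using bounded_linear.nonneg_bounded by blast
  have "\<bar>f x\<bar> \<le> K * (1 + norm x) ^ 1" for x
    using K(1)[of x] K(2) by (simp add: algebra_simps)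
  with K show ?case by blast
next
  case (const c)
  then show ?case by (intro exI[of _ "\<bar>c\<bar>"] exI[of _ 0]) auto
next
  case (add f g)
  then obtain K d L e where K: "K \<ge> 0" "\<And>x. \<bar>f x\<bar> \<le> K * (1 + norm x) ^ d"
    and L: "L \<ge> 0" "\<And>x. \<bar>g x\<bar> \<le> L * (1 + norm x) ^ e" by blast
  have "\<bar>f x + g x\<bar> \<le> (K + L) * (1 + norm x) ^ (d + e)" for x
  proof -
    have "\<bar>f x + g x\<bar> \<le> K * (1 + norm x) ^ d + L * (1 + norm x) ^ e"
      using abs_triangle_ineq[of "f x" "g x"] K(2)[of x] L(2)[of x] by linarith
    also have "\<dots> \<le> K * (1 + norm x) ^ (d + e) + L * (1 + norm x) ^ (d + e)"
      using K(1) L(1) by (intro add_mono mult_left_mono power_increasing) auto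
    finally show ?thesis by (simp add: algebra_simps)
  qed
  with K L show ?case by (intro exI[of _ "K + L"] exI[of _ "d + e"]) auto
next
  case (mult f g)
  then obtain K d L e where K: "K \<ge> 0" "\<And>x. \<bar>f x\<bar> \<le> K * (1 + norm x) ^ d"
    and L: "L \<ge> 0" "\<And>x. \<bar>g x\<bar> \<le> L * (1 + norm x) ^ e" by blast
  have "\<bar>f x * g x\<bar> \<le> (K * L) * (1 + norm x) ^ (d + e)" for x
  proof -
    have "\<bar>f x * g x\<bar> \<le> (K * (1 + norm x) ^ d) * (L * (1 + norm x) ^ e)"
      unfolding abs_mult using K L by (intro mult_mono) auto
    then show ?thesis by (simp add: power_add algebra_simps)
  qed
  with K L show ?case by (intro exI[of _ "K * L"] exI[of _ "d + e"]) auto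
qed

lemma real_polynomial_function_component: "real_polynomial_function (\<lambda>x::real^'n. x $ i)"
  by (intro real_polynomial_function.intros(1) bounded_linear_vec_nth)

lemma real_polynomial_function_poly:
  assumes "real_polynomial_function h"
  shows "real_polynomial_function (\<lambda>x. poly p (h x))"
  using assms by (induction p) (simp_all add: real_polynomial_function.intros(2-4))

text \<open>
  Polynomial times Gaussian. These functions are closed under differentiation, so that a single
  growth estimate proves them to be Schwartz functions.
\<close>

definition poly_gauss :: "real^'n \<Rightarrow> (real^'n \<Rightarrow> real) \<Rightarrow> real^'n \<Rightarrow> complex" where
  "poly_gauss b p x = complex_of_real (p x * exp (- (\<Sum>i\<in>UNIV. b $ i * (x $ i)\<^sup>2) / 2))"

lemma poly_gauss_derivative:
  fixes b :: "real^'n"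
  assumes p: "real_polynomial_function p"
  shows "poly_gauss b p differentiable (at x)"
    and "\<exists>q. real_polynomial_function q \<and> partial i (poly_gauss b p) = poly_gauss b q"
proof -
  obtain p' where der: "\<And>x. (p has_derivative p' x) (at x)" and pol: "\<And>v. real_polynomial_function (\<lambda>x. p' x v)"
    using real_polynomial_function_has_derivative[OF p] by blast
  let ?E = "\<lambda>x::real^'n. exp (- (\<Sum>i\<in>UNIV. b $ i * (x $ i)\<^sup>2) / 2)"
  have dE: "(?E has_derivative (\<lambda>h. ?E x * - (\<Sum>i\<in>UNIV. b $ i * (x $ i) * h $ i))) (at x)" for x
  proof -
    have "((\<lambda>x. \<Sum>i\<in>UNIV. b $ i * (x $ i)\<^sup>2) has_derivative
        (\<lambda>h. \<Sum>i\<in>UNIV. b $ i * (2 * x $ i * h $ i))) (at x)"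
      by (auto intro!: derivative_eq_intros has_derivative_sum bounded_linear_imp_has_derivative[OF bounded_linear_vec_nth])
    from has_derivative_mult_right[OF this, of "-1/2"]
    have "((\<lambda>x. - (\<Sum>i\<in>UNIV. b $ i * (x $ i)\<^sup>2) / 2) has_derivative
        (\<lambda>h. - (\<Sum>i\<in>UNIV. b $ i * (2 * x $ i * h $ i)) / 2)) (at x)"
      by simp
    from has_derivative_exp[OF this] have "(?E has_derivative
        (\<lambda>h. ?E x * (- (\<Sum>i\<in>UNIV. b $ i * (2 * x $ i * h $ i)) / 2))) (at x)"
      by (simp add: mult.commute)
    moreover have "- (\<Sum>i\<in>UNIV. b $ i * (2 * x $ i * h $ i)) / 2 = - (\<Sum>i\<in>UNIV. b $ i * (x $ i) * h $ i)" for h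
      by (simp add: sum_distrib_left[symmetric] sum_divide_distrib mult.assoc)
    ultimately show ?thesis by simp
  qed
  have D: "(poly_gauss b p has_derivative
     (\<lambda>h. complex_of_real (p x * (?E x * - (\<Sum>i\<in>UNIV. b $ i * (x $ i) * h $ i)) + p' x h * ?E x))) (at x)" for x
    unfolding poly_gauss_def[abs_def] by (intro has_derivative_of_real has_derivative_mult der dE)
  then show "poly_gauss b p differentiable (at x)" by (auto simp: differentiable_def)
  have "partial i (poly_gauss b p) = poly_gauss b (\<lambda>x. p' x (axis i 1) - (b $ i * x $ i) * p x)"
  proof
    fix x
    have "(\<Sum>j\<in>UNIV. b $ j * x $ j * (axis i 1 :: real^'n) $ j) = b $ i * x $ i"
      by (simp add: axis_def if_distrib cong: if_cong)
    then show "partial i (poly_gauss b p) x = poly_gauss b (\<lambda>x. p' x (axis i 1) - (b $ i * x $ i) * p x) x"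
      unfolding partial_eq[OF D] by (simp add: poly_gauss_def algebra_simps)
  qed
  moreover have "real_polynomial_function (\<lambda>x. p' x (axis i 1) - (b $ i * x $ i) * p x)"
    by (intro real_polynomial_function_diff real_polynomial_function.intros(4) real_polynomial_function.intros(2)
        real_polynomial_function_component pol p)
  ultimately show "\<exists>q. real_polynomial_function q \<and> partial i (poly_gauss b p) = poly_gauss b q" by blast
qed

text \<open>
  Completing the square. It turns a Gaussian bound into an exponential one, against which powers
  are compared.
\<close>

lemma linear_le_quadratic:
  fixes r c :: real
  assumes "c > 0"
  shows "1 + r \<le> c * r\<^sup>2 / 2 + (1 + 1 / (2 * c))"
proof -
  have "0 \<le> (c * r - 1)\<^sup>2 / (2 * c)" using assms by simp
  also have "\<dots> = c * r\<^sup>2 / 2 - r + 1 / (2 * c)"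
    using assms by (simp add: power2_eq_square field_simps)
  finally show ?thesis by simp
qed

text \<open>
  The quadratic form dominates $c |x|^2$ for the smallest coefficient $c$, so the Gaussian is at most a
  constant times $e^{-(1 + |x|)}$, and $t^N e^{-t} \le N^N$.
\<close>

lemma poly_gauss_rapidly_decreasing:
  fixes b :: "real^'n"
  assumes b: "\<forall>i. b $ i > 0" and p: "real_polynomial_function p"
  shows "rapidly_decreasing (poly_gauss b p)"
proof (rule rapidly_decreasingI)
  fix m
  obtain K d where K: "K \<ge> 0" "\<And>x. \<bar>p x\<bar> \<le> K * (1 + norm x) ^ d"
    using real_polynomial_function_growth[OF p] by blast
  \<comment> \<open>the smallest coefficient gives a bound by $|x|$ alone\<close>
  define c where "c = Min (range (\<lambda>i. b $ i))"
  have c: "c > 0" "\<And>i. c \<le> b $ i" using b by (auto simp: c_def)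
  define M where "M = 1 + 1 / (2 * c)"
  have E: "exp (- (\<Sum>i\<in>UNIV. b $ i * (x $ i)\<^sup>2) / 2) \<le> exp M * exp (- (1 + norm x))" for x
  proof -
    have "c * (norm x)\<^sup>2 = (\<Sum>i\<in>UNIV. c * (x $ i)\<^sup>2)"
      by (simp add: norm_vec_def L2_set_def sum_nonneg sum_distrib_left)
    also have "\<dots> \<le> (\<Sum>i\<in>UNIV. b $ i * (x $ i)\<^sup>2)"
      using c by (intro sum_mono mult_right_mono) auto
    finally have "- (\<Sum>i\<in>UNIV. b $ i * (x $ i)\<^sup>2) / 2 \<le> M + (- (1 + norm x))"
      using linear_le_quadratic[OF c(1), of "norm x"] by (simp add: M_def)
    then show ?thesis by (simp only: exp_add[symmetric] exp_le_cancel_iff)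
  qed
  have "(1 + norm x) ^ m * norm (poly_gauss b p x) \<le> K * (exp M * real (m + d) ^ (m + d))" for x
  proof -
    define t where "t = 1 + norm x"
    have t: "t > 0" by (simp add: t_def add_pos_nonneg)
    have T: "t ^ (m + d) * exp (- t) \<le> real (m + d) ^ (m + d)"
    proof (cases "m + d = 0")
      case False
      have "(t / real (m + d)) ^ (m + d) \<le> (1 + t / real (m + d)) ^ (m + d)"
        using t by (intro power_mono) auto
      also have "\<dots> \<le> exp t"
        using exp_ge_one_plus_x_over_n_power_n[of "m + d" t] t False by simp
      finally show ?thesis
        using False by (simp add: exp_minus power_divide field_simps)
    qed (use t in simp)
    have "norm (poly_gauss b p x) \<le> (K * t ^ d) * (exp M * exp (- t))"
      unfolding poly_gauss_def norm_of_real abs_mult t_def using K E[of x] by (intro mult_mono) auto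
    then have "t ^ m * norm (poly_gauss b p x) \<le> t ^ m * ((K * t ^ d) * (exp M * exp (- t)))"
      using t by (intro mult_left_mono) auto
    also have "\<dots> = (K * exp M) * (t ^ (m + d) * exp (- t))"
      by (simp add: power_add algebra_simps)
    also have "\<dots> \<le> (K * exp M) * real (m + d) ^ (m + d)"
      using K T by (intro mult_left_mono) auto
    finally show ?thesis by (simp add: t_def mult.assoc)
  qed
  then show "\<exists>C. \<forall>x. (1 + norm x) ^ m * norm (poly_gauss b p x) \<le> C" by blast
qed

lemma partials_poly_gauss:
  assumes "real_polynomial_function p"
  shows "\<exists>q. real_polynomial_function q \<and> partials js (poly_gauss b p) = poly_gauss b q"
proof (induction js)
  case Nil
  then show ?case using assms by (auto simp: partials_def)
next
  case (Cons j js)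
  then show ?case using poly_gauss_derivative(2) by (fastforce simp: partials_def)
qed

lemma poly_gauss_schwartz:
  assumes "\<forall>i. b $ i > 0" "real_polynomial_function p"
  shows "poly_gauss b p \<in> schwartz"
  unfolding schwartz_def mem_Collect_eq
proof
  fix js
  obtain q where q: "real_polynomial_function q" "partials js (poly_gauss b p) = poly_gauss b q"
    using partials_poly_gauss[OF assms(2)] by blast
  show "(\<forall>x. partials js (poly_gauss b p) differentiable at x) \<and>
        (\<forall>m::nat. \<exists>C. \<forall>x. norm x ^ m * norm (partials js (poly_gauss b p) x) \<le> C)"
    unfolding q(2) using poly_gauss_derivative(1)[OF q(1)] poly_gauss_rapidly_decreasing[OF assms(1) q(1)]
    by (auto simp: rapidly_decreasing_def)
qed

text \<open>
  The real-valued eigenfunction; its complexification \<open>hermite_state\<close> below is the element of the $L^2$ space of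
  complex functions.
\<close>

definition hermite_product :: "real^'n \<Rightarrow> ('n \<Rightarrow> nat) \<Rightarrow> real^'n \<Rightarrow> real" where
  "hermite_product a k x = (\<Prod>i\<in>UNIV. hermite_fun (a $ i) (k i) (x $ i))"

definition hermite_state :: "real^'n \<Rightarrow> ('n \<Rightarrow> nat) \<Rightarrow> real^'n \<Rightarrow> complex" where
  "hermite_state a k x = complex_of_real (hermite_product a k x)"

lemma hermite_state_eq_poly_gauss:
  "hermite_state a k = poly_gauss a (\<lambda>x. \<Prod>i\<in>UNIV. poly (hermite (k i)) (sqrt (a $ i) * x $ i))"
  by (rule ext) (simp add: hermite_state_def poly_gauss_def hermite_product_def hermite_fun_def prod.distrib
      exp_sum[symmetric] sum_negf sum_divide_distrib)

lemma hermite_state_schwartz: "\<forall>i. a $ i > 0 \<Longrightarrow> hermite_state a k \<in> schwartz"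
  unfolding hermite_state_eq_poly_gauss
  by (intro poly_gauss_schwartz real_polynomial_function_prod real_polynomial_function_poly
      real_polynomial_function.intros(4) real_polynomial_function.intros(2) real_polynomial_function_component) auto

text \<open>
  A partial derivative only sees the restriction to a line. On such a line a product function is a
  function of one variable times a constant.
\<close>

lemma partial_of_component:
  fixes f :: "real^'n \<Rightarrow> complex"
  assumes diff: "f differentiable (at x)"
    and f: "\<And>t. f (x + t *\<^sub>R axis i 1) = complex_of_real (u (x $ i + t)) * c"
    and u: "(u has_real_derivative u') (at (x $ i))"
  shows "partial i f x = complex_of_real u' * c"
proof -
  have "((\<lambda>t. f (x + t *\<^sub>R axis i 1)) has_vector_derivative partial i f x) (at 0)"
    using has_derivative_partial_line[of f x 0 i] diff by simp
  moreover have "((\<lambda>t. complex_of_real (u (x $ i + t)) * c) has_vector_derivative complex_of_real u' * c) (at 0)"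
  proof -
    have "((\<lambda>t. u (x $ i + t)) has_real_derivative u' * 1) (at 0)"
      by (rule DERIV_chain2[where g = "\<lambda>t. x $ i + t"]) (use u in \<open>auto intro!: derivative_eq_intros\<close>)
    then show ?thesis
      by (intro has_vector_derivative_mult_left has_vector_derivative_of_real) simp
  qed
  ultimately show ?thesis unfolding f by (rule vector_derivative_unique_at)
qed

lemma prod_split_component:
  fixes g :: "'n::finite \<Rightarrow> real \<Rightarrow> real" and x :: "real^'n"
  shows "(\<Prod>j\<in>UNIV. g j ((x + t *\<^sub>R axis i 1) $ j)) = g i (x $ i + t) * (\<Prod>j\<in>UNIV - {i}. g j (x $ j))"
proof -
  have "(\<Prod>j\<in>UNIV. g j ((x + t *\<^sub>R axis i 1) $ j)) =
      g i ((x + t *\<^sub>R axis i 1) $ i) * (\<Prod>j\<in>UNIV - {i}. g j ((x + t *\<^sub>R axis i 1) $ j))"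
    by (rule prod.remove) auto
  also have "(\<Prod>j\<in>UNIV - {i}. g j ((x + t *\<^sub>R axis i 1) $ j)) = (\<Prod>j\<in>UNIV - {i}. g j (x $ j))"
    by (intro prod.cong) (auto simp: axis_def)
  finally show ?thesis by (simp add: axis_def)
qed

lemma second_partial_hermite_state:
  fixes a :: "real^'n"
  assumes a: "\<forall>i. a $ i > 0"
  shows "partial i (partial i (hermite_state a k)) x =
    complex_of_real ((a $ i)\<^sup>2 * (x $ i)\<^sup>2 - a $ i * (2 * real (k i) + 1)) * hermite_state a k x"
proof -
  have S: "hermite_state a k \<in> schwartz" using hermite_state_schwartz[OF a] .
  have ai: "a $ i > 0" using a by simp
  define c where "c x = complex_of_real (\<Prod>j\<in>UNIV - {i}. hermite_fun (a $ j) (k j) (x $ j))" for x :: "real^'n"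
  have hermite_state: "hermite_state a k (x + t *\<^sub>R axis i 1) = complex_of_real (hermite_fun (a $ i) (k i) (x $ i + t)) * c x" for x t
    unfolding hermite_state_def hermite_product_def c_def
    using prod_split_component[of "\<lambda>j. hermite_fun (a $ j) (k j)" x t i] by simp
  have cc: "c (x + t *\<^sub>R axis i 1) = c x" for x t
    unfolding c_def by (auto simp: axis_def intro!: prod.cong)
  have p1: "partial i (hermite_state a k) x = complex_of_real (hermite_fun_deriv (a $ i) (k i) (x $ i)) * c x" for x
    by (rule partial_of_component[OF schwartz_differentiable[OF S] hermite_state DERIV_hermite_fun[OF ai]])
  have "partial i (partial i (hermite_state a k)) x =
     complex_of_real (((a $ i)\<^sup>2 * (x $ i)\<^sup>2 - a $ i * (2 * real (k i) + 1)) * hermite_fun (a $ i) (k i) (x $ i)) * c x"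
  proof (rule partial_of_component[OF schwartz_differentiable[OF schwartz_partial[OF S]] _ DERIV_hermite_fun_deriv[OF ai]])
    fix t show "partial i (hermite_state a k) (x + t *\<^sub>R axis i 1) =
        complex_of_real (hermite_fun_deriv (a $ i) (k i) (x $ i + t)) * c x"
      unfolding p1 cc by (simp add: axis_def)
  qed
  then show ?thesis using hermite_state[of x 0] by simp
qed

text \<open>
  The eigenvalue of the Hermite state with multi-index $k$.
\<close>

definition osc_value :: "real^'n \<Rightarrow> ('n \<Rightarrow> nat) \<Rightarrow> real" where
  "osc_value a k = (\<Sum>i\<in>UNIV. a $ i * (2 * real (k i) + 1))"

lemma schroedinger_hermite_state:
  fixes a :: "real^'n"
  assumes a: "\<forall>i. a $ i > 0"
  shows "schroedinger_expr (oscillator_potential a) (hermite_state a k) = (\<lambda>x. complex_of_real (osc_value a k) * hermite_state a k x)"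
proof
  fix x
  show "schroedinger_expr (oscillator_potential a) (hermite_state a k) x = complex_of_real (osc_value a k) * hermite_state a k x"
    unfolding schroedinger_expr_def laplacian_def second_partial_hermite_state[OF a] sum_distrib_right[symmetric]
      of_real_sum[symmetric] sum_subtractf oscillator_potential_def osc_value_def
    by (simp only: of_real_diff left_diff_distrib) simp
qed

lemma oscillator_potential_schwartz:
  fixes a :: "real^'n"
  assumes f: "f \<in> schwartz"
  shows "(\<lambda>x. complex_of_real (oscillator_potential a x) * f x) \<in> L2"
    and "g \<in> schwartz \<Longrightarrow> integrable lborel (\<lambda>x. complex_of_real (oscillator_potential a x) * f x * g x)"
proof -
  have pol: "real_polynomial_function (oscillator_potential a)"
    unfolding oscillator_potential_def[abs_def] power2_eq_square
    by (intro real_polynomial_function_sum real_polynomial_function.intros(4)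
        real_polynomial_function.intros(2) real_polynomial_function_component) auto
  obtain K d where K: "\<And>x. \<bar>oscillator_potential a x\<bar> \<le> K * (1 + norm x) ^ d"
    using real_polynomial_function_growth[OF pol] by blast
  have [measurable]: "oscillator_potential a \<in> borel_measurable borel" "f \<in> borel_measurable borel"
    unfolding oscillator_potential_def[abs_def] using schwartz_borel[OF f] by measurable
  have r: "rapidly_decreasing (\<lambda>x. complex_of_real (oscillator_potential a x) * f x)"
    using rapidly_decreasing_mult[OF schwartz_rapidly_decreasing[OF f], of "\<lambda>x. complex_of_real (oscillator_potential a x)" K d] K
    by (simp add: mult.commute)
  then show "(\<lambda>x. complex_of_real (oscillator_potential a x) * f x) \<in> L2"
    by (intro rapidly_decreasing_L2) measurable
  assume g: "g \<in> schwartz"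
  have [measurable]: "g \<in> borel_measurable borel" by (rule schwartz_borel[OF g])
  show "integrable lborel (\<lambda>x. complex_of_real (oscillator_potential a x) * f x * g x)"
    by (intro rapidly_decreasing_integrable rapidly_decreasing_mult_bounded r schwartz_rapidly_decreasing g) measurable
qed

lemma laplacian_schwartz:
  assumes "f \<in> schwartz"
  shows "laplacian f \<in> L2" "g \<in> schwartz \<Longrightarrow> integrable lborel (\<lambda>x. laplacian f x * g x)"
proof -
  show "laplacian f \<in> L2"
    unfolding laplacian_def by (intro L2_sum schwartz_L2 schwartz_partial assms)
  show "integrable lborel (\<lambda>x. laplacian f x * g x)" if "g \<in> schwartz"
    unfolding laplacian_def sum_distrib_right
    by (intro Bochner_Integration.integrable_sum schwartz_mult_integrable schwartz_partial assms that)
qed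

lemma schroedinger_expr_L2:
  assumes "f \<in> schwartz"
  shows "schroedinger_expr (oscillator_potential a) f \<in> L2"
  unfolding schroedinger_expr_def
  using L2_lin[OF laplacian_schwartz(1)[OF assms] oscillator_potential_schwartz(1)[OF assms, of a], of "-1" 1]
  by simp

text \<open>
  Symmetry of the differential expression, tested against its eigenfunctions. With $f$ itself an
  eigenfunction it gives orthogonality; for general $f$ it says that the operator acts diagonally on
  coefficients.
\<close>

lemma schroedinger_inner_hermite_state:
  fixes a :: "real^'n"
  assumes a: "\<forall>i. a $ i > 0" and f: "f \<in> schwartz"
  shows "L2_inner (schroedinger_expr (oscillator_potential a) f) (hermite_state a k) =
     complex_of_real (osc_value a k) * L2_inner f (hermite_state a k)"
proof -
  let ?V = "\<lambda>x. complex_of_real (oscillator_potential a x)"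
  note S = hermite_state_schwartz[OF a, of k]
  have real: "cnj (hermite_state a k x) = hermite_state a k x" for x by (simp add: hermite_state_def)
  have "L2_inner (schroedinger_expr (oscillator_potential a) f) (hermite_state a k)
      = (LINT x|lborel. - (laplacian f x * hermite_state a k x) + ?V x * f x * hermite_state a k x)"
    by (simp add: L2_inner_def schroedinger_expr_def real algebra_simps)
  also have "\<dots> = - (LINT x|lborel. laplacian f x * hermite_state a k x) + (LINT x|lborel. ?V x * f x * hermite_state a k x)"
    using laplacian_schwartz(2)[OF f S] oscillator_potential_schwartz(2)[OF f S, of a] by simp
  also have "\<dots> = - (LINT x|lborel. laplacian (hermite_state a k) x * f x) + (LINT x|lborel. ?V x * hermite_state a k x * f x)"
    unfolding laplacian_symmetric[OF f S] by (simp add: mult_ac)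
  also have "\<dots> = (LINT x|lborel. schroedinger_expr (oscillator_potential a) (hermite_state a k) x * f x)"
    using laplacian_schwartz(2)[OF S f] oscillator_potential_schwartz(2)[OF S f, of a]
    by (simp add: schroedinger_expr_def algebra_simps)
  also have "\<dots> = complex_of_real (osc_value a k) * L2_inner f (hermite_state a k)"
  proof -
    have "(\<lambda>x. complex_of_real (osc_value a k) * hermite_state a k x * f x)
        = (\<lambda>x. complex_of_real (osc_value a k) * (f x * hermite_state a k x))"
      by (simp add: fun_eq_iff mult_ac)
    then show ?thesis unfolding schroedinger_hermite_state[OF a] L2_inner_def real by simp
  qed
  finally show ?thesis .
qed

section \<open>Completeness of the Hermite states\<close>

definition hermite_state_span :: "real^'n \<Rightarrow> (real^'n \<Rightarrow> complex) set" where
  "hermite_state_span a = {u. \<exists>F c. finite F \<and> u = (\<lambda>x. \<Sum>k\<in>F. c k * hermite_state a k x)}"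

lemma hermite_state_span_lin:
  assumes "u \<in> hermite_state_span a" "v \<in> hermite_state_span a"
  shows "(\<lambda>x. c * u x + d * v x) \<in> hermite_state_span a"
proof -
  obtain F p where F: "finite F" "u = (\<lambda>x. \<Sum>k\<in>F. p k * hermite_state a k x)"
    using assms(1) by (auto simp: hermite_state_span_def)
  obtain G q where G: "finite G" "v = (\<lambda>x. \<Sum>k\<in>G. q k * hermite_state a k x)"
    using assms(2) by (auto simp: hermite_state_span_def)
  define r where "r k = c * (if k \<in> F then p k else 0) + d * (if k \<in> G then q k else 0)" for k
  have "c * u x + d * v x = (\<Sum>k\<in>F \<union> G. r k * hermite_state a k x)" for x
  proof -
    have 1: "u x = (\<Sum>k\<in>F \<union> G. (if k \<in> F then p k else 0) * hermite_state a k x)"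
      unfolding F(2) using F(1) G(1) by (intro sum.mono_neutral_cong_left) auto
    have 2: "v x = (\<Sum>k\<in>F \<union> G. (if k \<in> G then q k else 0) * hermite_state a k x)"
      unfolding G(2) using F(1) G(1) by (intro sum.mono_neutral_cong_left) auto
    show ?thesis unfolding 1 2 r_def
      by (simp only: sum_distrib_left sum.distrib[symmetric] distrib_right mult.assoc)
  qed
  then show ?thesis using F(1) G(1)
    unfolding hermite_state_span_def by (intro CollectI exI[of _ "F \<union> G"] exI[of _ r]) auto
qed

lemma hermite_state_in_span: "hermite_state a k \<in> hermite_state_span a"
  unfolding hermite_state_span_def by (intro CollectI exI[of _ "{k}"] exI[of _ "\<lambda>_. 1"]) auto

lemma hermite_state_span_zero: "(\<lambda>x. 0) \<in> hermite_state_span a"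
  using hermite_state_span_lin[OF hermite_state_in_span hermite_state_in_span, where c = 0 and d = 0] by simp

lemma hermite_state_span_sum:
  assumes "\<And>k. k \<in> F \<Longrightarrow> u k \<in> hermite_state_span a"
  shows "(\<lambda>x. \<Sum>k\<in>F. c k * u k x) \<in> hermite_state_span a"
  using assms
proof (induction F rule: infinite_finite_induct)
  case (insert k F)
  then show ?case using hermite_state_span_lin[of "u k" a "\<lambda>x. \<Sum>k\<in>F. c k * u k x" "c k" 1] by simp
qed (auto simp: hermite_state_span_zero)

text \<open>
  The three-term recurrence in the variable $x_j$ shifts the $j$-th index of a state up or down by
  one.
\<close>

lemma hermite_state_span_times_component:
  fixes a :: "real^'n"
  assumes a: "\<forall>i. a $ i > 0" and u: "u \<in> hermite_state_span a"
  shows "(\<lambda>x. complex_of_real (x $ j) * u x) \<in> hermite_state_span a"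
proof -
  have hermite_state: "(\<lambda>x. complex_of_real (x $ j) * hermite_state a k x) \<in> hermite_state_span a" for k
  proof -
    define A where "A = 1 / (2 * sqrt (a $ j))"
    \<comment> \<open>the coefficients of the three-term recurrence in the $j$-th variable\<close>
    define B where "B = real (k j) / sqrt (a $ j)"
    have upd: "hermite_product a (k(j := n)) x =
        hermite_fun (a $ j) n (x $ j) * (\<Prod>i\<in>UNIV - {j}. hermite_fun (a $ i) (k i) (x $ i))" for n x
      unfolding hermite_product_def by (subst prod.remove[of _ j]) (auto intro!: prod.cong)
    have "x $ j * hermite_product a k x =
       A * hermite_product a (k(j := Suc (k j))) x + B * hermite_product a (k(j := k j - 1)) x" for x
    proof -
      have "x $ j * hermite_product a k x = x $ j * hermite_product a (k(j := k j)) x" by simp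
      also have "\<dots> = A * hermite_product a (k(j := Suc (k j))) x + B * hermite_product a (k(j := k j - 1)) x"
        unfolding upd mult.assoc[symmetric] distrib_right[symmetric] A_def B_def
        using hermite_fun_times_arg[of "a $ j" "x $ j" "k j"] a by simp
      finally show ?thesis .
    qed
    then have "(\<lambda>x. complex_of_real (x $ j) * hermite_state a k x) =
       (\<lambda>x. complex_of_real A * hermite_state a (k(j := Suc (k j))) x + complex_of_real B * hermite_state a (k(j := k j - 1)) x)"
      unfolding hermite_state_def by (simp flip: of_real_mult of_real_add)
    then show ?thesis by (simp only: hermite_state_span_lin hermite_state_in_span)
  qed
  obtain F c where "finite F" "u = (\<lambda>x. \<Sum>k\<in>F. c k * hermite_state a k x)"
    using u by (auto simp: hermite_state_span_def)
  then have "(\<lambda>x. complex_of_real (x $ j) * u x) = (\<lambda>x. \<Sum>k\<in>F. c k * (complex_of_real (x $ j) * hermite_state a k x))"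
    by (simp add: sum_distrib_left mult_ac)
  then show ?thesis using hermite_state_span_sum[of F "\<lambda>k x. complex_of_real (x $ j) * hermite_state a k x", OF hermite_state] by simp
qed

lemma hermite_state_span_times_polynomial:
  fixes a :: "real^'n"
  assumes a: "\<forall>i. a $ i > 0" and "real_polynomial_function p" and "u \<in> hermite_state_span a"
  shows "(\<lambda>x. complex_of_real (p x) * u x) \<in> hermite_state_span a"
  using assms(2,3)
proof (induction arbitrary: u)
  case (linear f)
  have f: "f x = (\<Sum>i\<in>UNIV. f (axis i 1) * x $ i)" for x
  proof -
    have "f x = f (\<Sum>i\<in>UNIV. x $ i *\<^sub>R axis i 1)"
      using basis_expansion[of x] by (simp add: scalar_mult_eq_scaleR)
    also have "\<dots> = (\<Sum>i\<in>UNIV. f (axis i 1) * x $ i)"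
      using linear(1) by (simp add: linear_sum bounded_linear.linear linear_scale mult.commute)
    finally show ?thesis .
  qed
  have "complex_of_real (f x) * u x =
      (\<Sum>i\<in>UNIV. complex_of_real (f (axis i 1)) * (complex_of_real (x $ i) * u x))" for x
    by (subst f) (simp add: sum_distrib_right mult.assoc)
  then show ?case
    using hermite_state_span_sum[of UNIV "\<lambda>i x. complex_of_real (x $ i) * u x" a "\<lambda>i. complex_of_real (f (axis i 1))",
        OF hermite_state_span_times_component[OF a linear(2)]] by simp
next
  case (const c)
  then show ?case using hermite_state_span_lin[of u a u "complex_of_real c" 0] by simp
next
  case (add f g)
  from hermite_state_span_lin[OF add.IH(1)[OF add.prems] add.IH(2)[OF add.prems], of 1 1]
  show ?case by (simp add: distrib_right)
next
  case (mult f g)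
  from mult.IH(1)[OF mult.IH(2)[OF mult.prems]] show ?case by (simp add: mult.assoc)
qed

text \<open>
  The ground state is the pure Gaussian, and the span is stable under multiplication by
  polynomials.
\<close>

lemma poly_gauss_in_span:
  assumes "\<forall>i. a $ i > 0" "real_polynomial_function p"
  shows "poly_gauss a p \<in> hermite_state_span a"
proof -
  have "poly_gauss a p = (\<lambda>x. complex_of_real (p x) * hermite_state a (\<lambda>_. 0) x)"
    unfolding hermite_state_eq_poly_gauss poly_gauss_def[abs_def] by simp
  then show ?thesis using hermite_state_span_times_polynomial[OF assms hermite_state_in_span] by simp
qed

lemma hermite_state_L2: "\<forall>i. a $ i > 0 \<Longrightarrow> hermite_state a k \<in> L2"
  by (intro schwartz_L2 hermite_state_schwartz)

lemma hermite_state_span_L2: "\<forall>i. a $ i > 0 \<Longrightarrow> hermite_state_span a \<subseteq> L2"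
  unfolding hermite_state_span_def by (auto intro!: L2_sum L2_cmult hermite_state_L2)

lemma hermite_state_closure_lin:
  assumes "\<forall>i. a $ i > 0" "f \<in> L2_closure (hermite_state_span a)" "g \<in> L2_closure (hermite_state_span a)"
  shows "(\<lambda>x. c * f x + d * g x) \<in> L2_closure (hermite_state_span a)"
  using assms by (intro L2_closure_lin hermite_state_span_L2 hermite_state_span_lin)

lemma hermite_state_span_subset_closure:
  assumes "\<forall>i. a $ i > 0" "u \<in> hermite_state_span a"
  shows "u \<in> L2_closure (hermite_state_span a)"
proof -
  have "L2_norm (\<lambda>x. u x - u x) = 0" by (simp add: L2_norm_def)
  then have "\<exists>v\<in>hermite_state_span a. L2_norm (\<lambda>x. u x - v x) < \<epsilon>" if "\<epsilon> > 0" for \<epsilon>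
    using that by (intro bexI[OF _ assms(2)]) simp
  then show ?thesis
    unfolding L2_closure_def using subsetD[OF hermite_state_span_L2[OF assms(1)] assms(2)] by simp
qed

lemma hermite_state_closure_sum:
  assumes a: "\<forall>i. a $ i > 0" and "\<And>k. k \<in> F \<Longrightarrow> u k \<in> L2_closure (hermite_state_span a)"
  shows "(\<lambda>x. \<Sum>k\<in>F. c k * u k x) \<in> L2_closure (hermite_state_span a)"
  using assms(2)
proof (induction F rule: infinite_finite_induct)
  case (insert k F)
  then show ?case
    using hermite_state_closure_lin[OF a, of "u k" "\<lambda>x. \<Sum>k\<in>F. c k * u k x" "c k" 1] by simp
qed (auto simp: hermite_state_span_zero a intro!: hermite_state_span_subset_closure)

text \<open>
  Functions $\phi$ such that $\phi\, p\, e^{-Q/2}$ can be approximated by Hermite states for every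
  polynomial $p$, where $Q(x) = \sum_i a_i x_i^2$. Quantifying over all $p$ makes the class stable under
  the operations needed below: a Taylor polynomial of a further factor can be absorbed into $p$.
\<close>

definition multiplier :: "real^'n \<Rightarrow> (real^'n \<Rightarrow> real) \<Rightarrow> bool" where
  "multiplier a \<phi> \<longleftrightarrow> (\<exists>K. \<forall>x. \<bar>\<phi> x\<bar> \<le> K) \<and>
     (\<forall>p. real_polynomial_function p \<longrightarrow> (\<lambda>x. complex_of_real (\<phi> x) * poly_gauss a p x) \<in> L2_closure (hermite_state_span a))"

lemma multiplierD:
  "multiplier a \<phi> \<Longrightarrow> real_polynomial_function p \<Longrightarrow>
    (\<lambda>x. complex_of_real (\<phi> x) * poly_gauss a p x) \<in> L2_closure (hermite_state_span a)"
  by (simp add: multiplier_def)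

lemma multiplier_one: "\<forall>i. a $ i > 0 \<Longrightarrow> multiplier a (\<lambda>_. 1)"
  unfolding multiplier_def
  by (intro conjI exI[of _ 1] allI impI) (simp_all add: hermite_state_span_subset_closure poly_gauss_in_span)

lemma multiplier_lin:
  assumes a: "\<forall>i. a $ i > 0" and "multiplier a \<phi>" "multiplier a \<theta>"
  shows "multiplier a (\<lambda>x. c * \<phi> x + d * \<theta> x)"
  unfolding multiplier_def
proof (intro conjI allI impI)
  obtain K L where "\<And>x. \<bar>\<phi> x\<bar> \<le> K" "\<And>x. \<bar>\<theta> x\<bar> \<le> L" using assms unfolding multiplier_def by blast
  then have "\<bar>c * \<phi> x + d * \<theta> x\<bar> \<le> \<bar>c\<bar> * K + \<bar>d\<bar> * L" for x
    by (intro order_trans[OF abs_triangle_ineq]) (auto simp: abs_mult intro!: add_mono mult_left_mono)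
  then show "\<exists>K. \<forall>x. \<bar>c * \<phi> x + d * \<theta> x\<bar> \<le> K" by blast
  fix p :: "real^'a \<Rightarrow> real" assume "real_polynomial_function p"
  then have "(\<lambda>x. complex_of_real (\<phi> x) * poly_gauss a p x) \<in> L2_closure (hermite_state_span a)"
    "(\<lambda>x. complex_of_real (\<theta> x) * poly_gauss a p x) \<in> L2_closure (hermite_state_span a)"
    using assms unfolding multiplier_def by blast+
  from hermite_state_closure_lin[OF a this, of "complex_of_real c" "complex_of_real d"]
  show "(\<lambda>x. complex_of_real (c * \<phi> x + d * \<theta> x) * poly_gauss a p x) \<in> L2_closure (hermite_state_span a)"
    by (simp add: algebra_simps)
qed

lemma poly_gauss_L2: "\<forall>i. a $ i > 0 \<Longrightarrow> real_polynomial_function p \<Longrightarrow> poly_gauss a p \<in> L2"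
  by (intro schwartz_L2 poly_gauss_schwartz)

text \<open>
  Bounded pointwise limits stay in the class by dominated convergence. Together with linearity this
  makes it amenable to a monotone class argument.
\<close>

lemma multiplier_limit:
  assumes a: "\<forall>i. a $ i > 0" and \<phi>: "\<And>m::nat. multiplier a (\<phi> m)"
    and bound: "\<And>m x. \<bar>\<phi> m x\<bar> \<le> K" and lim: "\<And>x. (\<lambda>m. \<phi> m x) \<longlonglongrightarrow> \<theta> x"
  shows "multiplier a \<theta>"
  unfolding multiplier_def
proof (intro conjI allI impI)
  have "\<bar>\<theta> x\<bar> \<le> K" for x
    by (rule Lim_bounded[OF tendsto_rabs[OF lim]]) (use bound in auto)
  then show "\<exists>K. \<forall>x. \<bar>\<theta> x\<bar> \<le> K" by blast
  fix p :: "real^'a \<Rightarrow> real" assume p: "real_polynomial_function p"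
  show "(\<lambda>x. complex_of_real (\<theta> x) * poly_gauss a p x) \<in> L2_closure (hermite_state_span a)"
  proof (rule L2_closure_dominated[OF hermite_state_span_L2[OF a], where w = "\<lambda>x. complex_of_real K * poly_gauss a p x"])
    show "(\<lambda>x. complex_of_real (\<phi> m x) * poly_gauss a p x) \<in> L2_closure (hermite_state_span a)" for m
      using \<phi> p unfolding multiplier_def by blast
    show "(\<lambda>m. complex_of_real (\<phi> m x) * poly_gauss a p x) \<longlonglongrightarrow> complex_of_real (\<theta> x) * poly_gauss a p x" for x
      by (intro tendsto_intros lim)
    show "(\<lambda>x. complex_of_real K * poly_gauss a p x) \<in> L2"
      by (intro L2_cmult poly_gauss_L2 a p)
    show "norm (complex_of_real (\<phi> m x) * poly_gauss a p x) \<le> norm (complex_of_real K * poly_gauss a p x)" for m x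
      unfolding norm_mult norm_of_real using bound[of m x] by (intro mult_right_mono) auto
  qed
qed

lemma abs_sin_Taylor_le: "\<bar>\<Sum>n<m. sin_coeff n * y ^ n\<bar> \<le> exp \<bar>y\<bar>"
proof -
  have "\<bar>\<Sum>n<m. sin_coeff n * y ^ n\<bar> \<le> (\<Sum>n<m. \<bar>y\<bar> ^ n /\<^sub>R fact n)"
    by (rule order_trans[OF sum_abs])
       (auto intro!: sum_mono simp: abs_mult power_abs sin_coeff_def divide_inverse abs_inverse)
  also have "\<dots> \<le> exp \<bar>y\<bar>"
    unfolding exp_def by (intro sum_le_suminf summable_exp_generic) auto
  finally show ?thesis .
qed

text \<open>
  A linear exponent costs only half of the Gaussian decay.
\<close>

lemma linear_le_quarter_square:
  fixes b B t :: real
  assumes "b > 0"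
  shows "B * t \<le> b * t\<^sup>2 / 4 + B\<^sup>2 / b"
proof -
  have "0 \<le> (b * t / 2 - B)\<^sup>2 / b" using assms by simp
  also have "\<dots> = b * t\<^sup>2 / 4 - B * t + B\<^sup>2 / b"
    using assms by (simp add: power2_eq_square field_simps)
  finally show ?thesis by simp
qed

text \<open>
  The dominating function for Taylor partial sums of the sine: an exponential factor is absorbed by
  passing from $e^{-Q/2}$ to the wider Gaussian $e^{-Q/4}$.
\<close>

lemma exp_times_poly_gauss_le:
  fixes a :: "real^'n"
  assumes a: "\<forall>i. a $ i > 0"
  shows "\<exists>M. \<forall>x. exp \<bar>\<beta> * (x $ j - c)\<bar> * norm (poly_gauss a p x) \<le> M * norm (poly_gauss ((1/2) *\<^sub>R a) p x)"
proof -
  define B where "B = \<bar>\<beta>\<bar>"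
  define M where "M = B * \<bar>c\<bar> + B\<^sup>2 / (a $ j)"
  have "exp \<bar>\<beta> * (x $ j - c)\<bar> * norm (poly_gauss a p x) \<le> exp M * norm (poly_gauss ((1/2) *\<^sub>R a) p x)" for x
  proof -
    define Q where "Q = (\<Sum>i\<in>UNIV. a $ i * (x $ i)\<^sup>2)"
    have "a $ j * (x $ j)\<^sup>2 \<le> Q"
      unfolding Q_def using a by (intro member_le_sum) (simp_all add: less_imp_le)
    moreover have "B * \<bar>x $ j\<bar> \<le> a $ j * (x $ j)\<^sup>2 / 4 + B\<^sup>2 / (a $ j)"
      using linear_le_quarter_square[of "a $ j" B "\<bar>x $ j\<bar>"] a by simp
    moreover have "\<bar>\<beta> * (x $ j - c)\<bar> \<le> B * \<bar>x $ j\<bar> + B * \<bar>c\<bar>"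
      unfolding B_def abs_mult distrib_left[symmetric] by (intro mult_left_mono) auto
    ultimately have "\<bar>\<beta> * (x $ j - c)\<bar> + (- Q / 2) \<le> M + (- Q / 4)" by (simp add: M_def)
    then have "exp \<bar>\<beta> * (x $ j - c)\<bar> * exp (- Q / 2) \<le> exp M * exp (- Q / 4)"
      by (simp only: exp_add[symmetric] exp_le_cancel_iff)
    then have "\<bar>p x\<bar> * (exp \<bar>\<beta> * (x $ j - c)\<bar> * exp (- Q / 2)) \<le> \<bar>p x\<bar> * (exp M * exp (- Q / 4))"
      by (rule mult_left_mono) simp
    moreover have "- (\<Sum>i\<in>UNIV. ((1/2) *\<^sub>R a) $ i * (x $ i)\<^sup>2) / 2 = - Q / 4"
    proof -
      have "(\<Sum>i\<in>UNIV. ((1/2) *\<^sub>R a) $ i * (x $ i)\<^sup>2) = Q / 2"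
        by (simp add: Q_def sum_divide_distrib)
      then show ?thesis by simp
    qed
    ultimately show ?thesis
      unfolding poly_gauss_def norm_of_real abs_mult Q_def[symmetric] abs_exp_cancel by (simp only: mult_ac)
  qed
  then show ?thesis by blast
qed

text \<open>
  The Taylor polynomials of the sine converge after multiplication by the Gaussian, with the common
  bound $e^{|y|}$. Bounded trigonometric factors thus come from polynomials, although the polynomials
  themselves are unbounded.
\<close>

lemma multiplier_sin:
  fixes a :: "real^'n"
  assumes a: "\<forall>i. a $ i > 0" and \<phi>: "multiplier a \<phi>"
  shows "multiplier a (\<lambda>x. \<phi> x * sin (\<beta> * (x $ j - c)))"
  unfolding multiplier_def
proof (intro conjI allI impI)
  obtain K where K: "\<And>x. \<bar>\<phi> x\<bar> \<le> K" using \<phi> unfolding multiplier_def by blast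
  have K0: "K \<ge> 0" using K abs_ge_zero order_trans by blast
  have "\<bar>\<phi> x * sin (\<beta> * (x $ j - c))\<bar> \<le> K * 1" for x
    unfolding abs_mult using K K0 by (intro mult_mono) auto
  then show "\<exists>K. \<forall>x. \<bar>\<phi> x * sin (\<beta> * (x $ j - c))\<bar> \<le> K" by blast
  fix p :: "real^'n \<Rightarrow> real" assume p: "real_polynomial_function p"
  obtain M where M: "\<And>x. exp \<bar>\<beta> * (x $ j - c)\<bar> * norm (poly_gauss a p x) \<le> M * norm (poly_gauss ((1/2) *\<^sub>R a) p x)"
    using exp_times_poly_gauss_le[OF a] by blast
  define S where "S m x = (\<Sum>n<m. sin_coeff n * (\<beta> * (x $ j - c)) ^ n)" for m :: nat and x :: "real^'n"
  have S: "real_polynomial_function (S m)" for m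
    unfolding S_def[abs_def]
    by (intro real_polynomial_function_sum real_polynomial_function_power real_polynomial_function_diff
        real_polynomial_function.intros(2,4) real_polynomial_function_component) auto
  show "(\<lambda>x. complex_of_real (\<phi> x * sin (\<beta> * (x $ j - c))) * poly_gauss a p x) \<in> L2_closure (hermite_state_span a)"
  proof (rule L2_closure_dominated[OF hermite_state_span_L2[OF a], where w = "\<lambda>x. complex_of_real (K * M) * poly_gauss ((1/2) *\<^sub>R a) p x"])
    fix m
    have "(\<lambda>x. complex_of_real (\<phi> x) * poly_gauss a (\<lambda>x. S m x * p x) x) \<in> L2_closure (hermite_state_span a)"
      using \<phi> real_polynomial_function.intros(4)[OF S p] unfolding multiplier_def by blast
    then show "(\<lambda>x. complex_of_real (\<phi> x * S m x) * poly_gauss a p x) \<in> L2_closure (hermite_state_span a)"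
      by (simp add: poly_gauss_def mult_ac)
  next
    fix x
    have "(\<lambda>m. S m x) \<longlonglongrightarrow> sin (\<beta> * (x $ j - c))"
      using sin_converges[of "\<beta> * (x $ j - c)"] by (simp add: S_def sums_def)
    then show "(\<lambda>m. complex_of_real (\<phi> x * S m x) * poly_gauss a p x)
        \<longlonglongrightarrow> complex_of_real (\<phi> x * sin (\<beta> * (x $ j - c))) * poly_gauss a p x"
      by (intro tendsto_intros)
  next
    show "(\<lambda>x. complex_of_real (K * M) * poly_gauss ((1/2) *\<^sub>R a) p x) \<in> L2"
      using a by (intro L2_cmult poly_gauss_L2 p) simp
  next
    fix m x
    have "norm (complex_of_real (\<phi> x * S m x) * poly_gauss a p x) = \<bar>\<phi> x\<bar> * (\<bar>S m x\<bar> * norm (poly_gauss a p x))"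
      by (simp add: norm_mult)
    also have "\<dots> \<le> K * (exp \<bar>\<beta> * (x $ j - c)\<bar> * norm (poly_gauss a p x))"
      using K K0 abs_sin_Taylor_le[of "\<beta> * (x $ j - c)" m] unfolding S_def
      by (intro mult_mono) auto
    also have "\<dots> \<le> K * (M * norm (poly_gauss ((1/2) *\<^sub>R a) p x))"
      using M K0 by (rule mult_left_mono)
    also have "\<dots> \<le> norm (complex_of_real (K * M) * poly_gauss ((1/2) *\<^sub>R a) p x)"
      unfolding norm_mult norm_of_real mult.assoc[symmetric] by (intro mult_right_mono abs_ge_self norm_ge_zero)
    finally show "norm (complex_of_real (\<phi> x * S m x) * poly_gauss a p x)
        \<le> norm (complex_of_real (K * M) * poly_gauss ((1/2) *\<^sub>R a) p x)" .
  qed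
qed

text \<open>
  Multiplication by a sine may be iterated, since the statement holds for every multiplier.
\<close>

lemma multiplier_polynomial_sin:
  fixes a :: "real^'n" and q :: "real \<Rightarrow> real"
  assumes a: "\<forall>i. a $ i > 0" and "real_polynomial_function q" and "multiplier a \<phi>"
  shows "multiplier a (\<lambda>x. \<phi> x * q (sin (\<beta> * (x $ j - c))))"
  using assms(2,3)
proof (induction arbitrary: \<phi>)
  case (linear f)
  then have f: "f t = f 1 * t" for t
    using linear_scale[OF bounded_linear.linear, of f t 1] by (simp add: mult.commute)
  have "multiplier a (\<lambda>x. f 1 * (\<phi> x * sin (\<beta> * (x $ j - c))) + 0 * \<phi> x)"
    by (intro multiplier_lin multiplier_sin a linear)
  then show ?case by (subst f) (simp add: mult_ac)
next
  case (const d)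
  have "multiplier a (\<lambda>x. d * \<phi> x + 0 * \<phi> x)" by (intro multiplier_lin a const)
  then show ?case by (simp add: mult_ac)
next
  case (add f g)
  from multiplier_lin[OF a add.IH(1)[OF add.prems] add.IH(2)[OF add.prems], of 1 1]
  show ?case by (simp add: algebra_simps)
next
  case (mult f g)
  from mult.IH(2)[OF mult.IH(1)[OF mult.prems]] show ?case by (simp add: mult_ac)
qed

text \<open>
  The sine takes values in a compact interval, where continuous functions are uniform limits of
  polynomials.
\<close>

lemma multiplier_continuous_sin:
  fixes a :: "real^'n" and F :: "real \<Rightarrow> real"
  assumes a: "\<forall>i. a $ i > 0" and \<phi>: "multiplier a \<phi>" and F: "continuous_on {-1..1} F"
  shows "multiplier a (\<lambda>x. \<phi> x * F (sin (\<beta> * (x $ j - c))))"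
proof -
  obtain K where K: "\<And>x. \<bar>\<phi> x\<bar> \<le> K" using \<phi> unfolding multiplier_def by blast
  have K0: "K \<ge> 0" using K abs_ge_zero order_trans by blast
  have "\<exists>q. real_polynomial_function q \<and> (\<forall>t\<in>{-1..1}. \<bar>F t - q t\<bar> < inverse (real (Suc m)))" for m
  proof -
    have "0 < inverse (real (Suc m))" by simp
    then show ?thesis
      by (rule Stone_Weierstrass_real_polynomial_function[OF compact_Icc F]) blast
  qed
  then obtain q where q: "\<And>m. real_polynomial_function (q m)"
    "\<And>m t. t \<in> {-1..1} \<Longrightarrow> \<bar>F t - q m t\<bar> < inverse (real (Suc m))" by metis
  have "compact (F ` {-1..1})" by (intro compact_continuous_image F compact_Icc)
  from compact_imp_bounded[OF this] obtain B where "\<forall>y\<in>F ` {-1..1}. norm y \<le> B"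
    unfolding bounded_iff by blast
  then have B: "\<bar>F t\<bar> \<le> B" if "t \<in> {-1..1}" for t using that by simp
  show ?thesis
  proof (rule multiplier_limit[OF a])
    show "multiplier a (\<lambda>x. \<phi> x * q m (sin (\<beta> * (x $ j - c))))" for m
      by (intro multiplier_polynomial_sin a q \<phi>)
    show "\<bar>\<phi> x * q m (sin (\<beta> * (x $ j - c)))\<bar> \<le> K * (B + 1)" for m x
    proof -
      let ?t = "sin (\<beta> * (x $ j - c))"
      have t: "?t \<in> {-1..1}" by simp
      have "inverse (real (Suc m)) \<le> 1" by (simp add: inverse_le_1_iff)
      then have "\<bar>q m ?t\<bar> \<le> B + 1" using q(2)[OF t, of m] B[OF t] by linarith
      then show ?thesis unfolding abs_mult using K K0 by (intro mult_mono) auto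
    qed
    show "(\<lambda>m. \<phi> x * q m (sin (\<beta> * (x $ j - c)))) \<longlonglongrightarrow> \<phi> x * F (sin (\<beta> * (x $ j - c)))" for x
    proof (intro tendsto_mult tendsto_const)
      let ?t = "sin (\<beta> * (x $ j - c))"
      have t: "?t \<in> {-1..1}" by simp
      have "(\<lambda>m. q m ?t - F ?t) \<longlonglongrightarrow> 0"
        by (rule Lim_null_comparison[OF _ LIMSEQ_inverse_real_of_nat])
           (use q(2)[OF t] in \<open>auto simp: abs_minus_commute intro!: always_eventually less_imp_le\<close>)
      then show "(\<lambda>m. q m ?t) \<longlonglongrightarrow> F ?t" by (simp add: LIM_zero_iff)
    qed
  qed
qed

text \<open>
  The indicator of a half-line as a limit of continuous functions of a sine: with frequency
  $1/(m+1)$ the sine is eventually of the sign of $y$, and of size $|y|/(m+1)$, so the factor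
  $(m+1)^2$ drives it out of the interval $[0, 1]$ unless $y = 0$.
\<close>

lemma clamp_sin_limit:
  fixes y :: real
  shows "(\<lambda>m. max 0 (min 1 ((real (Suc m))\<^sup>2 * sin (inverse (real (Suc m)) * y)))) \<longlonglongrightarrow> (if y > 0 then 1 else 0)"
proof -
  consider "y > 0" | "y < 0" | "y = 0" by linarith
  then show ?thesis
  proof cases
    case 1
    have "filterlim (\<lambda>m. (real (Suc m))\<^sup>2 * sin (inverse (real (Suc m)) * y)) at_top sequentially"
      using 1 by real_asymp
    then have "eventually (\<lambda>m. (real (Suc m))\<^sup>2 * sin (inverse (real (Suc m)) * y) \<ge> 1) sequentially"
      by (simp add: filterlim_at_top)
    then have "eventually (\<lambda>m. max 0 (min 1 ((real (Suc m))\<^sup>2 * sin (inverse (real (Suc m)) * y))) = 1) sequentially"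
      by eventually_elim simp
    then show ?thesis using 1 by (simp add: tendsto_eventually)
  next
    case 2
    have "filterlim (\<lambda>m. (real (Suc m))\<^sup>2 * sin (inverse (real (Suc m)) * y)) at_bot sequentially"
      using 2 by real_asymp
    then have "eventually (\<lambda>m. (real (Suc m))\<^sup>2 * sin (inverse (real (Suc m)) * y) \<le> 0) sequentially"
      by (simp add: filterlim_at_bot)
    then have "eventually (\<lambda>m. max 0 (min 1 ((real (Suc m))\<^sup>2 * sin (inverse (real (Suc m)) * y))) = 0) sequentially"
      by eventually_elim simp
    then show ?thesis using 2 by (simp add: tendsto_eventually)
  qed simp
qed

lemma multiplier_halfspace:
  fixes a :: "real^'n"
  assumes a: "\<forall>i. a $ i > 0" and \<phi>: "multiplier a \<phi>"
  shows "multiplier a (\<lambda>x. \<phi> x * (if x $ j > c then 1 else 0))"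
proof -
  obtain K where K: "\<And>x. \<bar>\<phi> x\<bar> \<le> K" using \<phi> unfolding multiplier_def by blast
  have K0: "K \<ge> 0" using K abs_ge_zero order_trans by blast
  \<comment> \<open>a steep ramp, clamped to the unit interval so that the approximants stay bounded\<close>
  define F where "F m t = max 0 (min 1 ((real (Suc m))\<^sup>2 * t))" for m :: nat and t :: real
  show ?thesis
  proof (rule multiplier_limit[OF a])
    show "multiplier a (\<lambda>x. \<phi> x * F m (sin (inverse (real (Suc m)) * (x $ j - c))))" for m
      unfolding F_def by (intro multiplier_continuous_sin a \<phi> continuous_intros)
    show "\<bar>\<phi> x * F m (sin (inverse (real (Suc m)) * (x $ j - c)))\<bar> \<le> K * 1" for m x
      unfolding abs_mult using K K0 by (intro mult_mono) (auto simp: F_def)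
    show "(\<lambda>m. \<phi> x * F m (sin (inverse (real (Suc m)) * (x $ j - c)))) \<longlonglongrightarrow> \<phi> x * (if x $ j > c then 1 else 0)" for x
      unfolding F_def using clamp_sin_limit[of "x $ j - c"] by (intro tendsto_mult tendsto_const) simp
  qed
qed

lemma multiplier_orthant:
  fixes a :: "real^'n"
  assumes a: "\<forall>i. a $ i > 0"
  shows "multiplier a (indicator {x. \<forall>j. c j < x $ j})"
proof -
  have "multiplier a (\<lambda>x. \<Prod>j\<in>J. if x $ j > c j then 1 else 0)" if "finite J" for J
    using that
  proof induction
    case empty
    then show ?case using multiplier_one[OF a] by simp
  next
    case (insert j J)
    from multiplier_halfspace[OF a insert.IH, where j = j and c = "c j"] insert.hyps show ?case
      by (simp add: mult.commute)
  qed
  from this[OF finite_class.finite_UNIV]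
  have "multiplier a (\<lambda>x. \<Prod>j\<in>UNIV. if x $ j > c j then 1 else 0)" .
  moreover have "(\<Prod>j\<in>UNIV. if x $ j > c j then 1 else 0) = (indicator {x. \<forall>j. c j < x $ j} x :: real)" for x
    by (cases "\<forall>j. c j < x $ j") (auto simp: indicator_def)
  ultimately show ?thesis by simp
qed

text \<open>
  Dynkin's theorem for the intersection-stable family of open orthants, which generates the Borel
  sets.
\<close>

lemma multiplier_borel:
  fixes a :: "real^'n"
  assumes a: "\<forall>i. a $ i > 0" and A: "A \<in> sets (borel :: (real^'n) measure)"
  shows "multiplier a (indicator A)"
proof -
  let ?G = "range (\<lambda>c::real^'n. {x. \<forall>j. c $ j < x $ j})"
  have eq: "eucl_less c x \<longleftrightarrow> (\<forall>j. c $ j < x $ j)" for c x :: "real^'n"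
    by (auto simp: eucl_less_def Basis_vec_def inner_axis)
  have int: "Int_stable ?G"
  proof (rule Int_stableI)
    fix S T assume "S \<in> ?G" "T \<in> ?G"
    then obtain c d :: "real^'n" where "S = {x. \<forall>j. c $ j < x $ j}" "T = {x. \<forall>j. d $ j < x $ j}" by auto
    then have "S \<inter> T = {x. \<forall>j. (\<chi> j. max (c $ j) (d $ j)) $ j < x $ j}" by auto
    then show "S \<inter> T \<in> ?G" by (rule range_eqI)
  qed
  have sub: "?G \<subseteq> Pow UNIV" by simp
  have gen: "A \<in> sigma_sets UNIV ?G"
    using A unfolding borel_eq_greaterThan eq by (simp add: sets_measure_of)
  from int sub gen show ?thesis
  proof (induction rule: sigma_sets_induct_disjoint)
    case (basic A)
    then show ?case using multiplier_orthant[OF a] by auto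
  next
    case empty
    from multiplier_lin[OF a multiplier_one[OF a] multiplier_one[OF a], of 0 0]
    show ?case by simp
  next
    case (compl A)
    from multiplier_lin[OF a multiplier_one[OF a] compl(2), of 1 "-1"]
    show ?case by (simp add: indicator_diff[abs_def] indicator_def)
  next
    case (union A)
    have part: "multiplier a (indicator (\<Union>i<m. A i))" for m
    proof (induction m)
      case (Suc m)
      have "(\<Union>i<m. A i) \<inter> A m = {}"
        using union(1) by (auto dest: disjoint_family_onD[of A UNIV _ m])
      then have "indicator (\<Union>i<Suc m. A i) x = 1 * indicator (\<Union>i<m. A i) x + 1 * (indicator (A m) x :: real)" for x
        unfolding lessThan_Suc UN_insert by (subst Un_commute, subst indicator_add[symmetric]) simp_all
      then show ?case using multiplier_lin[OF a Suc union(3)[of m], of 1 1] by presburger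
    qed (use multiplier_lin[OF a multiplier_one[OF a] multiplier_one[OF a], of 0 0] in simp)
    show ?case
    proof (rule multiplier_limit[OF a part])
      show "\<bar>indicator (\<Union>i<m. A i) x\<bar> \<le> (1::real)" for m x by (simp add: indicator_def)
      show "(\<lambda>m. indicator (\<Union>i<m. A i) x :: real) \<longlonglongrightarrow> indicator (\<Union>i. A i) x" for x
        by (rule LIMSEQ_indicator_UN)
    qed
  qed
qed

text \<open>
  Completeness. Write $f = (f e^{Q/2}) e^{-Q/2}$ and approximate the first factor pointwise by simple
  functions of at most twice its modulus; each of them is a combination of indicators of Borel sets,
  which are multipliers, and $2 |f|$ dominates.
\<close>

theorem hermite_state_complete:
  fixes a :: "real^'n"
  assumes a: "\<forall>i. a $ i > 0" and f: "f \<in> L2"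
  shows "f \<in> L2_closure (hermite_state_span a)"
proof -
  let ?g = "poly_gauss a (\<lambda>_. 1)"
  have g: "?g \<in> L2" by (intro poly_gauss_L2 a real_polynomial_function.intros(2))
  have g0: "?g x \<noteq> 0" for x by (simp add: poly_gauss_def)
  have [measurable]: "f \<in> borel_measurable borel" "?g \<in> borel_measurable borel" using f g by (auto intro: L2_borel)
  have "(\<lambda>x. f x / ?g x) \<in> borel_measurable borel" by measurable
  then obtain s where s: "\<And>m. simple_function borel (s m)"
    "\<And>x. (\<lambda>m. s m x) \<longlonglongrightarrow> f x / ?g x" "\<And>m x. dist (s m x) 0 \<le> 2 * dist (f x / ?g x) 0"
    using borel_measurable_implies_sequence_metric[of "\<lambda>x. f x / ?g x" borel 0] by auto
  show ?thesis
  proof (rule L2_closure_dominated[OF hermite_state_span_L2[OF a], where w = "\<lambda>x. 2 * f x"])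
    fix m
    have fin: "finite (range (s m))" using simple_functionD(1)[OF s(1)[of m]] by simp
    have eq: "s m x * ?g x = (\<Sum>y\<in>range (s m). y * (complex_of_real (indicator (s m -` {y}) x) * ?g x))" for x
    proof -
      have "(\<Sum>y\<in>range (s m). y * (complex_of_real (indicator (s m -` {y}) x) * ?g x))
         = (\<Sum>y\<in>range (s m). if y = s m x then y * ?g x else 0)"
        by (intro sum.cong) (auto simp: indicator_def)
      then show ?thesis using fin by simp
    qed
    have "s m -` {y} \<in> sets borel" for y
      using simple_functionD(2)[OF s(1)[of m], of "{y}"] by simp
    then have "multiplier a (indicator (s m -` {y}))" for y
      by (intro multiplier_borel[OF a])
    then have "(\<lambda>x. complex_of_real (indicator (s m -` {y}) x) * ?g x) \<in> L2_closure (hermite_state_span a)" for y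
      by (intro multiplierD real_polynomial_function.intros(2))
    then show "(\<lambda>x. s m x * ?g x) \<in> L2_closure (hermite_state_span a)"
      unfolding eq by (intro hermite_state_closure_sum a)
  next
    fix x
    have "(\<lambda>m. s m x * ?g x) \<longlonglongrightarrow> f x / ?g x * ?g x"
      by (intro tendsto_intros s(2))
    then show "(\<lambda>m. s m x * ?g x) \<longlonglongrightarrow> f x" using g0 by simp
  next
    show "(\<lambda>x. 2 * f x) \<in> L2" by (rule L2_cmult[OF f])
  next
    fix m x
    have "norm (s m x * ?g x) \<le> 2 * norm (f x / ?g x) * norm (?g x)"
      unfolding norm_mult[of "s m x"] using s(3)[of m x] by (intro mult_right_mono) auto
    then show "norm (s m x * ?g x) \<le> norm (2 * f x)" using g0[of x] by (simp add: norm_divide norm_mult)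
  qed
qed

section \<open>The self-adjoint extension and its spectrum\<close>

text \<open>
  A nonempty open set is not a null set. This pins down the pointwise values of the continuous
  representative of an eigenfunction.
\<close>

lemma continuous_ae_eq_imp_eq:
  fixes f g :: "real^'n \<Rightarrow> complex"
  assumes "continuous_on UNIV f" "continuous_on UNIV g" "ae_eq f g"
  shows "f = g"
proof -
  have eq: "{x. f x \<noteq> g x} = (\<lambda>x. f x - g x) -` (- {0})" by auto
  have op: "open {x. f x \<noteq> g x}"
    unfolding eq using assms by (intro open_vimage continuous_on_diff) auto
  have "{x. f x \<noteq> g x} \<in> null_sets lborel"
    using assms(3) op by (subst (asm) ae_eq_def) (simp add: AE_iff_null)
  then have "negligible {x. f x \<noteq> g x}"
    by (simp add: negligible_iff_null_sets null_sets_completionI)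
  with op open_not_negligible have "{x. f x \<noteq> g x} = {}" by blast
  then show ?thesis by auto
qed

lemma hermite_product_nonzero:
  fixes a :: "real^'n"
  assumes a: "\<forall>i. a $ i > 0"
  shows "\<exists>x. hermite_product a k x \<noteq> 0"
proof -
  have "\<exists>t. hermite_fun (a $ i) (k i) t \<noteq> 0" for i
    using ex_new_if_finite[OF infinite_UNIV_char_0 card_hermite_fun_zeros(1)[of "a $ i" "k i"]] a by auto
  then obtain t where "\<And>i. hermite_fun (a $ i) (k i) (t i) \<noteq> 0" by metis
  then have "hermite_product a k (\<chi> i. t i) \<noteq> 0" by (simp add: hermite_product_def)
  then show ?thesis by blast
qed

lemma continuous_hermite_state:
  assumes "\<forall>i. a $ i > 0"
  shows "continuous_on UNIV (hermite_state a k)"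
  by (intro continuous_at_imp_continuous_on ballI differentiable_imp_continuous_within
      schwartz_differentiable hermite_state_schwartz assms)

lemma L2_norm_hermite_state_pos:
  assumes a: "\<forall>i. a $ i > 0"
  shows "L2_norm (hermite_state a k) > 0"
proof (rule ccontr)
  assume "\<not> L2_norm (hermite_state a k) > 0"
  then have "L2_norm (hermite_state a k) = 0" using L2_norm_nonneg[of "hermite_state a k"] by linarith
  then have "ae_eq (hermite_state a k) (\<lambda>x. 0)" by (rule L2_norm_zero_imp[OF hermite_state_L2[OF a]])
  then have "hermite_state a k = (\<lambda>x. 0)"
    by (intro continuous_ae_eq_imp_eq continuous_hermite_state a continuous_on_const)
  then show False using hermite_product_nonzero[OF a, of k] by (metis of_real_eq_0_iff hermite_state_def)
qed

lemma osc_value_inj: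
  assumes "rationally_independent a" "osc_value a k = osc_value a l"
  shows "k = l"
proof -
  define d where "d i = 2 * (int (k i) - int (l i))" for i
  have "(\<Sum>i\<in>UNIV. a $ i * of_int (d i)) = osc_value a k - osc_value a l"
    unfolding osc_value_def sum_subtractf[symmetric] d_def by (intro sum.cong) (auto simp: algebra_simps)
  then have "\<forall>i. d i = 0"
    using assms unfolding rationally_independent_def by simp
  then show ?thesis by (auto simp: d_def)
qed

locale oscillator_setting =
  fixes a :: "real^'n"
  assumes pos: "\<forall>i. a $ i > 0" and indep: "rationally_independent a"
begin

text \<open>
  Eigenfunctions of a symmetric operator for different eigenvalues.
\<close>

lemma hermite_state_orthogonal:
  assumes "k \<noteq> l"
  shows "L2_inner (hermite_state a k) (hermite_state a l) = 0"
proof -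
  have "complex_of_real (osc_value a k) * L2_inner (hermite_state a k) (hermite_state a l)
      = complex_of_real (osc_value a l) * L2_inner (hermite_state a k) (hermite_state a l)"
    using schroedinger_inner_hermite_state[OF pos hermite_state_schwartz[OF pos], of k l]
    unfolding schroedinger_hermite_state[OF pos] L2_inner_cmult_left .
  moreover have "osc_value a k \<noteq> osc_value a l" using osc_value_inj[OF indep] assms by blast
  ultimately show ?thesis by simp
qed

text \<open>
  The states are orthogonal but not normalised, hence the division.
\<close>

definition hermite_coeff :: "(real^'n \<Rightarrow> complex) \<Rightarrow> ('n \<Rightarrow> nat) \<Rightarrow> complex" where
  "hermite_coeff f k = L2_inner f (hermite_state a k) / complex_of_real ((L2_norm (hermite_state a k))\<^sup>2)"

definition partial_sum :: "('n \<Rightarrow> nat) set \<Rightarrow> (real^'n \<Rightarrow> complex) \<Rightarrow> real^'n \<Rightarrow> complex" where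
  "partial_sum G f = (\<lambda>x. \<Sum>k\<in>G. hermite_coeff f k * hermite_state a k x)"

lemma partial_sum_L2: "partial_sum G f \<in> L2"
  unfolding partial_sum_def by (intro L2_sum L2_cmult hermite_state_L2 pos)

lemma inner_partial_sum:
  assumes "finite G" "h \<in> L2"
  shows "L2_inner h (\<lambda>x. \<Sum>k\<in>G. d k * hermite_state a k x) = (\<Sum>k\<in>G. cnj (d k) * L2_inner h (hermite_state a k))"
proof -
  have "L2_inner (\<lambda>x. \<Sum>k\<in>G. d k * hermite_state a k x) h = (\<Sum>k\<in>G. d k * L2_inner (hermite_state a k) h)"
    using assms by (intro L2_inner_sum_left hermite_state_L2 pos)
  then have "cnj (L2_inner (\<lambda>x. \<Sum>k\<in>G. d k * hermite_state a k x) h) = (\<Sum>k\<in>G. cnj (d k) * cnj (L2_inner (hermite_state a k) h))"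
    by simp
  then show ?thesis by (simp only: L2_inner_cnj[symmetric])
qed

lemma residual_orthogonal:
  assumes "finite G" "f \<in> L2" "l \<in> G"
  shows "L2_inner (\<lambda>x. f x - partial_sum G f x) (hermite_state a l) = 0"
proof -
  have "L2_inner (partial_sum G f) (hermite_state a l) = (\<Sum>k\<in>G. hermite_coeff f k * L2_inner (hermite_state a k) (hermite_state a l))"
    unfolding partial_sum_def using assms by (intro L2_inner_sum_left hermite_state_L2 pos)
  also have "\<dots> = (\<Sum>k\<in>G. if k = l then L2_inner f (hermite_state a l) else 0)"
    using L2_norm_hermite_state_pos[OF pos, of l]
    by (intro sum.cong) (auto simp: hermite_state_orthogonal hermite_coeff_def L2_inner_self)
  also have "\<dots> = L2_inner f (hermite_state a l)" using assms by simp
  finally show ?thesis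
    using L2_inner_diff_left[OF assms(2) partial_sum_L2 hermite_state_L2[OF pos]] by simp
qed

text \<open>
  Best approximation: the residual is orthogonal to the span of the chosen states, so Pythagoras'
  theorem compares any competitor with the partial sum.
\<close>

lemma partial_sum_best:
  assumes G: "finite G" and f: "f \<in> L2"
  shows "L2_norm (\<lambda>x. f x - partial_sum G f x) \<le> L2_norm (\<lambda>x. f x - (\<Sum>k\<in>G. c k * hermite_state a k x))"
proof (rule power2_le_imp_le)
  define r where "r = (\<lambda>x. f x - partial_sum G f x)"
  \<comment> \<open>the competitor differs from the partial sum by an element of the span\<close>
  define d where "d = (\<lambda>x. \<Sum>k\<in>G. (hermite_coeff f k - c k) * hermite_state a k x)"
  have r: "r \<in> L2" unfolding r_def by (intro L2_diff f partial_sum_L2)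
  have d: "d \<in> L2" unfolding d_def by (intro L2_sum L2_cmult hermite_state_L2 pos)
  have "L2_inner r d = 0"
    unfolding d_def inner_partial_sum[OF G r] using residual_orthogonal[OF G f] by (simp add: r_def)
  then have "(L2_norm (\<lambda>x. r x + d x))\<^sup>2 = (L2_norm r)\<^sup>2 + (L2_norm d)\<^sup>2"
    by (simp add: L2_norm_add_square[OF r d])
  moreover have "(\<lambda>x. r x + d x) = (\<lambda>x. f x - (\<Sum>k\<in>G. c k * hermite_state a k x))"
    unfolding r_def d_def partial_sum_def by (simp add: left_diff_distrib sum_subtractf)
  ultimately show "(L2_norm (\<lambda>x. f x - partial_sum G f x))\<^sup>2 \<le> (L2_norm (\<lambda>x. f x - (\<Sum>k\<in>G. c k * hermite_state a k x)))\<^sup>2"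
    unfolding r_def by simp
qed simp

text \<open>
  Convergence along the directed set of finite index sets. The uniformity in larger sets allows
  the expansions of two functions to be truncated at the same index set.
\<close>

lemma partial_sums_converge:
  assumes f: "f \<in> L2" and eps: "\<epsilon> > 0"
  shows "\<exists>F. finite F \<and> (\<forall>G. finite G \<and> F \<subseteq> G \<longrightarrow> L2_norm (\<lambda>x. f x - partial_sum G f x) < \<epsilon>)"
proof -
  have "\<exists>u\<in>hermite_state_span a. L2_norm (\<lambda>x. f x - u x) < \<epsilon>"
    using hermite_state_complete[OF pos f] eps by (simp add: L2_closure_def)
  then obtain u where u: "u \<in> hermite_state_span a" "L2_norm (\<lambda>x. f x - u x) < \<epsilon>" by (elim bexE)
  then obtain F c where F: "finite F" "u = (\<lambda>x. \<Sum>k\<in>F. c k * hermite_state a k x)"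
    by (auto simp: hermite_state_span_def)
  have "L2_norm (\<lambda>x. f x - partial_sum G f x) < \<epsilon>" if G: "finite G" "F \<subseteq> G" for G
  proof -
    have "(\<Sum>k\<in>G. (if k \<in> F then c k else 0) * hermite_state a k x) = u x" for x
      unfolding F(2) using G by (intro sum.mono_neutral_cong_right) auto
    then show ?thesis
      using partial_sum_best[OF G(1) f, of "\<lambda>k. if k \<in> F then c k else 0"] u(2) by simp
  qed
  with F(1) show ?thesis by blast
qed

lemma coefficients_zero_imp:
  assumes f: "f \<in> L2" and zero: "\<And>k. L2_inner f (hermite_state a k) = 0"
  shows "ae_eq f (\<lambda>x. 0)"
proof -
  have "L2_norm f < \<epsilon>" if pos: "\<epsilon> > 0" for \<epsilon>
  proof -
    obtain F where F: "finite F" "\<forall>G. finite G \<and> F \<subseteq> G \<longrightarrow> L2_norm (\<lambda>x. f x - partial_sum G f x) < \<epsilon>"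
      using partial_sums_converge[OF f pos] by (elim exE conjE)
    from F(2)[rule_format, of F] F(1) have "L2_norm (\<lambda>x. f x - partial_sum F f x) < \<epsilon>" by simp
    then show ?thesis by (simp add: partial_sum_def hermite_coeff_def zero)
  qed
  from this[of "L2_norm f"] have "L2_norm f = 0" using L2_norm_nonneg[of f] by linarith
  then show ?thesis by (rule L2_norm_zero_imp[OF f])
qed

text \<open>
  The diagonal operator on its maximal domain, defined through coefficients.
\<close>

definition osc_graph :: "'n graph" where
  "osc_graph = {(f, g). f \<in> L2 \<and> g \<in> L2 \<and>
     (\<forall>k. L2_inner g (hermite_state a k) = complex_of_real (osc_value a k) * L2_inner f (hermite_state a k))}"

text \<open>
  On partial sums the identity holds term by term, because the eigenvalues are real and may be moved
  from one factor to the other. Truncating both expansions at a common finite index set and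
  letting the error tend to zero gives the general case.
\<close>

lemma osc_graph_symmetric:
  assumes fg: "(f, g) \<in> osc_graph" and uv: "(u, v) \<in> osc_graph"
  shows "L2_inner v f = L2_inner u g"
proof -
  have L: "f \<in> L2" "g \<in> L2" "u \<in> L2" "v \<in> L2"
    and cg: "\<And>k. L2_inner g (hermite_state a k) = complex_of_real (osc_value a k) * L2_inner f (hermite_state a k)"
    and cv: "\<And>k. L2_inner v (hermite_state a k) = complex_of_real (osc_value a k) * L2_inner u (hermite_state a k)"
    using fg uv by (auto simp: osc_graph_def)
  have bound: "norm (L2_inner v f - L2_inner u g) \<le> (L2_norm v + L2_norm u) * \<epsilon>" if eps: "\<epsilon> > 0" for \<epsilon>
  proof -
    obtain F1 where F1: "finite F1" "\<forall>G. finite G \<and> F1 \<subseteq> G \<longrightarrow> L2_norm (\<lambda>x. f x - partial_sum G f x) < \<epsilon>"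
      using partial_sums_converge[OF L(1) eps] by (elim exE conjE)
    obtain F2 where F2: "finite F2" "\<forall>G. finite G \<and> F2 \<subseteq> G \<longrightarrow> L2_norm (\<lambda>x. g x - partial_sum G g x) < \<epsilon>"
      using partial_sums_converge[OF L(2) eps] by (elim exE conjE)
    define G where "G = F1 \<union> F2"
    have G: "finite G" using F1(1) F2(1) by (simp add: G_def)
    have f: "L2_norm (\<lambda>x. f x - partial_sum G f x) < \<epsilon>" using F1(2) G by (simp add: G_def)
    have g: "L2_norm (\<lambda>x. g x - partial_sum G g x) < \<epsilon>" using F2(2) G by (simp add: G_def)
    have "L2_inner v (partial_sum G f) = L2_inner u (partial_sum G g)"
      unfolding partial_sum_def inner_partial_sum[OF G L(4)] inner_partial_sum[OF G L(3)]
      by (intro sum.cong) (simp_all add: hermite_coeff_def cg cv)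
    moreover have "L2_inner v f = L2_inner v (\<lambda>x. f x - partial_sum G f x) + L2_inner v (partial_sum G f)"
      using L2_inner_diff_left[OF L(1) partial_sum_L2 L(4), THEN arg_cong[where f = cnj]]
      by (simp add: L2_inner_cnj[symmetric])
    moreover have "L2_inner u g = L2_inner u (\<lambda>x. g x - partial_sum G g x) + L2_inner u (partial_sum G g)"
      using L2_inner_diff_left[OF L(2) partial_sum_L2 L(3), THEN arg_cong[where f = cnj]]
      by (simp add: L2_inner_cnj[symmetric])
    ultimately have "L2_inner v f - L2_inner u g =
        L2_inner v (\<lambda>x. f x - partial_sum G f x) - L2_inner u (\<lambda>x. g x - partial_sum G g x)" by simp
    also have "norm \<dots> \<le> norm (L2_inner v (\<lambda>x. f x - partial_sum G f x)) + norm (L2_inner u (\<lambda>x. g x - partial_sum G g x))"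
      by (rule norm_triangle_ineq4)
    also have "\<dots> \<le> L2_norm v * L2_norm (\<lambda>x. f x - partial_sum G f x) + L2_norm u * L2_norm (\<lambda>x. g x - partial_sum G g x)"
      by (intro add_mono L2_Cauchy_Schwarz L2_diff L partial_sum_L2)
    also have "\<dots> \<le> L2_norm v * \<epsilon> + L2_norm u * \<epsilon>"
      using f g by (intro add_mono mult_left_mono) auto
    finally show ?thesis by (simp add: distrib_right)
  qed
  have "norm (L2_inner v f - L2_inner u g) \<le> 0"
  proof (rule field_le_epsilon)
    fix e :: real assume e: "e > 0"
    define s where "s = L2_norm v + L2_norm u"
    have s: "s \<ge> 0" by (simp add: s_def)
    have "e / (s + 1) > 0" using e s by simp
    then have "norm (L2_inner v f - L2_inner u g) \<le> s * (e / (s + 1))"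
      unfolding s_def by (rule bound)
    also have "\<dots> \<le> e" using e s by (simp add: field_simps)
    finally show "norm (L2_inner v f - L2_inner u g) \<le> 0 + e" by simp
  qed
  then show ?thesis by simp
qed

lemma hermite_state_in_osc_graph: "(hermite_state a k, \<lambda>x. complex_of_real (osc_value a k) * hermite_state a k x) \<in> osc_graph"
  unfolding osc_graph_def
  using schroedinger_inner_hermite_state[OF pos hermite_state_schwartz[OF pos], of k] hermite_state_L2[OF pos]
  by (auto simp: schroedinger_hermite_state[OF pos])

text \<open>
  Only single-valuedness has content: two images of the same function have equal coefficients, so
  completeness identifies them almost everywhere.
\<close>

lemma linear_operator_osc_graph: "linear_operator osc_graph"
  unfolding linear_operator_def
proof (intro conjI allI impI; (elim conjE)?)
  show "osc_graph \<subseteq> L2 \<times> L2" by (auto simp: osc_graph_def)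
next
  fix f g f' g' assume fg: "(f, g) \<in> osc_graph" and L': "f' \<in> L2" "g' \<in> L2"
    and ae: "ae_eq f f'" "ae_eq g g'"
  have L: "f \<in> L2" "g \<in> L2" using fg by (auto simp: osc_graph_def)
  have "L2_inner f (hermite_state a k) = L2_inner f' (hermite_state a k)" "L2_inner g (hermite_state a k) = L2_inner g' (hermite_state a k)" for k
    using L2_inner_ae[OF L(1) L'(1) hermite_state_L2[OF pos] ae(1)] L2_inner_ae[OF L(2) L'(2) hermite_state_L2[OF pos] ae(2)]
    by simp_all
  with fg L' show "(f', g') \<in> osc_graph" by (simp add: osc_graph_def)
next
  fix f g f' g' assume 1: "(f, g) \<in> osc_graph" "(f', g') \<in> osc_graph" and ae: "ae_eq f f'"
  then have L: "f \<in> L2" "g \<in> L2" "f' \<in> L2" "g' \<in> L2" by (auto simp: osc_graph_def)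
  have "ae_eq (\<lambda>x. g x - g' x) (\<lambda>x. 0)"
  proof (rule coefficients_zero_imp)
    show "(\<lambda>x. g x - g' x) \<in> L2" using L by auto
    fix k
    have "L2_inner f (hermite_state a k) = L2_inner f' (hermite_state a k)"
      by (rule L2_inner_ae[OF L(1) L(3) hermite_state_L2[OF pos] ae])
    then have "L2_inner g (hermite_state a k) = L2_inner g' (hermite_state a k)" using 1 by (simp add: osc_graph_def)
    then show "L2_inner (\<lambda>x. g x - g' x) (hermite_state a k) = 0"
      by (simp add: L2_inner_diff_left[OF L(2) L(4) hermite_state_L2[OF pos]])
  qed
  then show "ae_eq g g'" by (simp add: ae_eq_def)
next
  fix f g f' g' c d assume 1: "(f, g) \<in> osc_graph" "(f', g') \<in> osc_graph"
  then have L: "f \<in> L2" "g \<in> L2" "f' \<in> L2" "g' \<in> L2" by (auto simp: osc_graph_def)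
  show "(\<lambda>x. c * f x + d * f' x, \<lambda>x. c * g x + d * g' x) \<in> osc_graph"
    using 1 L unfolding osc_graph_def
    by (auto simp: L2_inner_lin_left[OF L(1,3) hermite_state_L2[OF pos]] L2_inner_lin_left[OF L(2,4) hermite_state_L2[OF pos]]
        algebra_simps)
qed

lemma osc_graph_sum:
  "((\<lambda>x. \<Sum>k\<in>F. c k * hermite_state a k x), (\<lambda>x. \<Sum>k\<in>F. c k * (complex_of_real (osc_value a k) * hermite_state a k x))) \<in> osc_graph"
proof (induction F rule: infinite_finite_induct)
  case (insert k F)
  have lin: "(\<lambda>x. \<alpha> * f x + \<beta> * f' x, \<lambda>x. \<alpha> * g x + \<beta> * g' x) \<in> osc_graph"
    if "(f, g) \<in> osc_graph" "(f', g') \<in> osc_graph" for f g f' g' \<alpha> \<beta>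
    using linear_operator_osc_graph that unfolding linear_operator_def by blast
  from lin[OF hermite_state_in_osc_graph[of k] insert.IH, where \<alpha> = "c k" and \<beta> = 1] insert.hyps
  show ?case by simp
qed (simp_all add: osc_graph_def L2_inner_def)

lemma densely_defined_osc_graph: "densely_defined osc_graph"
  unfolding densely_defined_def
proof (intro ballI allI impI)
  fix f :: "real^'n \<Rightarrow> complex" and \<epsilon> :: real assume f: "f \<in> L2" and eps: "\<epsilon> > 0"
  have "\<exists>u\<in>hermite_state_span a. L2_norm (\<lambda>x. f x - u x) < \<epsilon>"
    using hermite_state_complete[OF pos f] eps by (simp add: L2_closure_def)
  then obtain u where u: "u \<in> hermite_state_span a" "L2_norm (\<lambda>x. f x - u x) < \<epsilon>" by (elim bexE)
  then obtain F c where F: "u = (\<lambda>x. \<Sum>k\<in>F. c k * hermite_state a k x)"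
    by (auto simp: hermite_state_span_def)
  have "u \<in> Domain osc_graph" unfolding F by (rule DomainI[OF osc_graph_sum])
  with u(2) show "\<exists>u\<in>Domain osc_graph. L2_norm (\<lambda>x. f x - u x) < \<epsilon>" by (intro bexI[of _ u])
qed

text \<open>
  Testing the defining identity of the adjoint on the eigenpairs alone already forces the diagonal
  action. It is used for the diagonal operator itself and for an unknown self-adjoint
  extension.
\<close>

lemma adjoint_subset_osc_graph:
  assumes T: "\<And>k. (hermite_state a k, \<lambda>x. complex_of_real (osc_value a k) * hermite_state a k x) \<in> T"
  shows "adjoint_op T \<subseteq> osc_graph"
proof (clarify)
  fix f g assume "(f, g) \<in> adjoint_op T"
  then have L: "f \<in> L2" "g \<in> L2" and adj: "\<forall>(u, v)\<in>T. L2_inner v f = L2_inner u g"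
    by (auto simp: adjoint_op_def)
  have "L2_inner g (hermite_state a k) = complex_of_real (osc_value a k) * L2_inner f (hermite_state a k)" for k
  proof -
    have "complex_of_real (osc_value a k) * L2_inner (hermite_state a k) f = L2_inner (hermite_state a k) g"
      using bspec[OF adj T[of k]] by (simp add: L2_inner_cmult_left)
    from arg_cong[OF this, of cnj] show ?thesis
      by (simp add: L2_inner_cnj[symmetric])
  qed
  with L show "(f, g) \<in> osc_graph" by (simp add: osc_graph_def)
qed

lemma self_adjoint_osc_graph: "self_adjoint_op osc_graph"
proof -
  have "osc_graph \<subseteq> adjoint_op osc_graph"
  proof clarify
    fix f g assume fg: "(f, g) \<in> osc_graph"
    then have "f \<in> L2" "g \<in> L2" by (auto simp: osc_graph_def)
    then show "(f, g) \<in> adjoint_op osc_graph"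
      unfolding adjoint_op_def using osc_graph_symmetric[OF fg] by blast
  qed
  with adjoint_subset_osc_graph[OF hermite_state_in_osc_graph] have "adjoint_op osc_graph = osc_graph" by blast
  then show ?thesis
    using linear_operator_osc_graph densely_defined_osc_graph by (simp add: self_adjoint_op_def)
qed

lemma schwartz_subset_osc_graph: "schroedinger_on_schwartz (oscillator_potential a) \<subseteq> osc_graph"
  unfolding schroedinger_on_schwartz_def osc_graph_def
  by (auto simp: schwartz_L2 schroedinger_expr_L2 schroedinger_inner_hermite_state[OF pos])

lemma adjoint_antimono: "S \<subseteq> T \<Longrightarrow> adjoint_op T \<subseteq> adjoint_op S"
  unfolding adjoint_op_def by blast

text \<open>
  A self-adjoint operator has no proper self-adjoint extension, as adjoints reverse inclusions. Any
  self-adjoint extension of the differential operator contains the eigenpairs, hence is contained in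
  the diagonal operator and therefore equal to it.
\<close>

lemma oscillator_eq_osc_graph: "oscillator a = osc_graph"
  unfolding oscillator_def schroedinger_op_def
proof (rule the_equality)
  show "self_adjoint_op osc_graph \<and> schroedinger_on_schwartz (oscillator_potential a) \<subseteq> osc_graph"
    using self_adjoint_osc_graph schwartz_subset_osc_graph by blast
next
  fix T :: "'n graph"
  assume T: "self_adjoint_op T \<and> schroedinger_on_schwartz (oscillator_potential a) \<subseteq> T"
  have "(hermite_state a k, \<lambda>x. complex_of_real (osc_value a k) * hermite_state a k x) \<in> T" for k
    using T hermite_state_schwartz[OF pos, of k] unfolding schroedinger_on_schwartz_def schroedinger_hermite_state[OF pos, symmetric] by blast
  from adjoint_subset_osc_graph[OF this] have "T \<subseteq> osc_graph"
    using T by (simp add: self_adjoint_op_def)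
  moreover from adjoint_antimono[OF this] have "osc_graph \<subseteq> T"
    using T self_adjoint_osc_graph by (simp add: self_adjoint_op_def)
  ultimately show "T = osc_graph" by blast
qed

text \<open>
  Comparing coefficients: $z c_k = \lambda_k c_k$ for all $k$, and the $\lambda_k$ are distinct, so
  exactly one $c_k$ is nonzero.
\<close>

lemma eigenfunction_oscillator:
  assumes "eigenfunction (oscillator a) z f"
  shows "\<exists>k c. z = complex_of_real (osc_value a k) \<and> c \<noteq> 0 \<and> ae_eq f (\<lambda>x. c * hermite_state a k x)"
proof -
  have fz: "(f, \<lambda>x. z * f x) \<in> osc_graph" and nz: "\<not> ae_eq f (\<lambda>x. 0)"
    using assms by (auto simp: eigenfunction_def oscillator_eq_osc_graph)
  then have f: "f \<in> L2" and c: "\<And>k. z * L2_inner f (hermite_state a k) = complex_of_real (osc_value a k) * L2_inner f (hermite_state a k)"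
    by (auto simp: osc_graph_def L2_inner_cmult_left)
  obtain k where k: "L2_inner f (hermite_state a k) \<noteq> 0" using coefficients_zero_imp[OF f] nz by blast
  then have z: "z = complex_of_real (osc_value a k)" using c[of k] by simp
  have other: "L2_inner f (hermite_state a l) = 0" if "l \<noteq> k" for l
    using c[of l] osc_value_inj[OF indep, of k l] that by (auto simp: z)
  have "ae_eq (\<lambda>x. f x - hermite_coeff f k * hermite_state a k x) (\<lambda>x. 0)"
  proof (rule coefficients_zero_imp)
    show "(\<lambda>x. f x - hermite_coeff f k * hermite_state a k x) \<in> L2" by (intro L2_diff L2_cmult f hermite_state_L2 pos)
    fix l
    show "L2_inner (\<lambda>x. f x - hermite_coeff f k * hermite_state a k x) (hermite_state a l) = 0"
      unfolding L2_inner_diff_left[OF f L2_cmult[OF hermite_state_L2[OF pos]] hermite_state_L2[OF pos]] L2_inner_cmult_left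
      using other[of l] hermite_state_orthogonal[of k l] L2_norm_hermite_state_pos[OF pos, of k]
      by (cases "l = k") (auto simp: hermite_coeff_def L2_inner_self)
  qed
  then have "ae_eq f (\<lambda>x. hermite_coeff f k * hermite_state a k x)" by (simp add: ae_eq_def)
  moreover have "hermite_coeff f k \<noteq> 0" using k L2_norm_hermite_state_pos[OF pos, of k] by (simp add: hermite_coeff_def)
  ultimately show ?thesis using z by blast
qed

lemma eigenfunction_hermite_state: "eigenfunction (oscillator a) (complex_of_real (osc_value a k)) (hermite_state a k)"
proof -
  have "\<not> ae_eq (hermite_state a k) (\<lambda>x. 0)"
  proof
    assume "ae_eq (hermite_state a k) (\<lambda>x. 0)"
    then have "L2_inner (hermite_state a k) (hermite_state a k) = L2_inner (\<lambda>x. 0) (hermite_state a k)"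
      by (intro L2_inner_ae hermite_state_L2 pos L2_zero)
    then show False using L2_norm_hermite_state_pos[OF pos, of k] by (simp add: L2_inner_self L2_inner_def)
  qed
  then show ?thesis using hermite_state_in_osc_graph by (simp add: eigenfunction_def oscillator_eq_osc_graph)
qed

lemma eigenvalue_oscillator: "{z. eigenvalue (oscillator a) z} = range (\<lambda>k. complex_of_real (osc_value a k))"
  using eigenfunction_oscillator eigenfunction_hermite_state unfolding eigenvalue_def by blast

lemma simple_eigenvalue_oscillator:
  assumes "eigenvalue (oscillator a) z"
  shows "simple_eigenvalue (oscillator a) z"
  unfolding simple_eigenvalue_def
proof (intro conjI allI impI assms, elim conjE)
  fix f g assume fz: "eigenfunction (oscillator a) z f" and gz: "eigenfunction (oscillator a) z g"
  obtain k c where k: "z = complex_of_real (osc_value a k)" "c \<noteq> 0" "ae_eq f (\<lambda>x. c * hermite_state a k x)"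
    using eigenfunction_oscillator[OF fz] by blast
  obtain l d where l: "z = complex_of_real (osc_value a l)" "ae_eq g (\<lambda>x. d * hermite_state a l x)"
    using eigenfunction_oscillator[OF gz] by blast
  have "k = l" using osc_value_inj[OF indep] k(1) l(1) by simp
  with k l have "ae_eq g (\<lambda>x. (d / c) * f x)"
    unfolding ae_eq_def by (auto elim!: eventually_elim2)
  then show "\<exists>c. ae_eq g (\<lambda>x. c * f x)" by blast
qed

end

section \<open>Nodal domains of a product\<close>

text \<open>
  Components are recognised by an invariant that is constant along connected sets and whose fibres
  are connected.
\<close>

lemma components_eq_fibres:
  fixes \<phi> :: "'a::topological_space \<Rightarrow> 'b"
  assumes const: "\<And>x y. connected_component S x y \<Longrightarrow> \<phi> x = \<phi> y"
    and conn: "\<And>x y. x \<in> S \<Longrightarrow> y \<in> S \<Longrightarrow> \<phi> x = \<phi> y \<Longrightarrow> connected_component S x y"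
  shows "bij_betw (\<lambda>c. {x \<in> S. \<phi> x = c}) (\<phi> ` S) (components S)"
proof -
  have comp: "connected_component_set S x = {y \<in> S. \<phi> y = \<phi> x}" if x: "x \<in> S" for x
  proof (rule set_eqI, unfold mem_Collect_eq, rule iffI)
    fix y assume y: "connected_component S x y"
    show "y \<in> S \<and> \<phi> y = \<phi> x"
      using connected_component_in[OF y] const[OF y, symmetric] by (intro conjI) (elim conjE)
  next
    fix y assume y: "y \<in> S \<and> \<phi> y = \<phi> x"
    show "connected_component S x y"
      by (rule conn[OF x conjunct1[OF y] conjunct2[OF y, symmetric]])
  qed
  show ?thesis
    unfolding bij_betw_def
  proof
    show "inj_on (\<lambda>c. {x \<in> S. \<phi> x = c}) (\<phi> ` S)"
    proof (rule inj_onI)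
      fix c d assume c: "c \<in> \<phi> ` S" and eq: "{x \<in> S. \<phi> x = c} = {x \<in> S. \<phi> x = d}"
      from c obtain u where u: "c = \<phi> u" "u \<in> S" by (rule imageE)
      then have "u \<in> {x \<in> S. \<phi> x = d}" unfolding eq[symmetric] by simp
      then show "c = d" using u by simp
    qed
    show "(\<lambda>c. {x \<in> S. \<phi> x = c}) ` \<phi> ` S = components S"
      unfolding components_def image_image
      by (rule image_cong[OF refl]) (rule comp[symmetric])
  qed
qed

text \<open>
  The real line minus $m$ points falls into $m + 1$ intervals, told apart by how many of the points
  lie below.
\<close>

lemma count_below_surj:
  fixes A :: "real set"
  assumes "finite A"
  shows "(\<lambda>x. card {z \<in> A. z < x}) ` (- A) = {..card A}"
proof
  show "(\<lambda>x. card {z \<in> A. z < x}) ` (- A) \<subseteq> {..card A}"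
    using assms by (auto intro!: card_mono)
  have ex: "\<exists>x. x \<notin> A \<and> card {z \<in> A. z < x} = c" if "c \<le> card A" for c
    using assms that
  proof (induction A arbitrary: c rule: finite_linorder_max_induct)
    case empty
    then show ?case by simp
  next
    case (insert b A)
    have lt: "z < b" if "z \<in> A" for z using insert.hyps(2) that by simp
    show ?case
    proof (cases "c \<le> card A")
      case True
      then obtain x where x: "x \<notin> A" "card {z \<in> A. z < x} = c" using insert.IH by blast
      show ?thesis
      proof (cases "x < b")
        case True
        then have "{z \<in> insert b A. z < x} = {z \<in> A. z < x}" by auto
        with x True show ?thesis by (intro exI[of _ x]) auto
      next
        case False
        define M where "M = Max (insert (b - 1) A)"
        have M: "\<And>z. z \<in> A \<Longrightarrow> z \<le> M" "M < b"
          using insert.hyps by (simp_all add: M_def)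
        \<comment> \<open>the point moves into the gap between $A$ and $b$, keeping all of $A$ below it\<close>
        define y where "y = (M + b) / 2"
        have y: "M < y" "y < b" using M by (simp_all add: y_def field_simps)
        have "{z \<in> A. z < x} = A" using False by (auto dest: lt)
        moreover have "{z \<in> insert b A. z < y} = A" using y by (auto dest: M(1))
        moreover have "y \<notin> insert b A" using y by (auto dest: M(1))
        ultimately show ?thesis using x by (intro exI[of _ y]) simp
      qed
    next
      case False
      have "{z \<in> insert b A. z < b + 1} = insert b A" by (auto dest: lt)
      moreover have "b \<notin> A" "b + 1 \<notin> insert b A" by (auto dest: lt)
      moreover have "c = Suc (card A)" using False insert.prems insert.hyps \<open>b \<notin> A\<close> by auto
      ultimately show ?thesis using insert.hyps by (intro exI[of _ "b + 1"]) auto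
    qed
  qed
  show "{..card A} \<subseteq> (\<lambda>x. card {z \<in> A. z < x}) ` (- A)"
  proof (intro subsetI)
    fix c assume "c \<in> {..card A}"
    then obtain x where "x \<notin> A" "card {z \<in> A. z < x} = c"
      using ex by auto
    then show "c \<in> (\<lambda>x. card {z \<in> A. z < x}) ` (- A)" by (intro image_eqI[of _ _ x]) auto
  qed
qed

lemma not_mem_if_equal_counts_below:
  fixes A :: "real set"
  assumes "finite A" "card {z \<in> A. z < s} = card {z \<in> A. z < t}" "s \<le> u" "u < t"
  shows "u \<notin> A"
proof
  assume u: "u \<in> A"
  have "{z \<in> A. z < s} \<subseteq> {z \<in> A. z < t}" using assms(3,4) by auto
  then have "{z \<in> A. z < s} = {z \<in> A. z < t}"
    using assms(1,2) by (intro card_subset_eq) simp_all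
  moreover have "u \<in> {z \<in> A. z < t}" using u assms(4) by simp
  ultimately have "u \<in> {z \<in> A. z < s}" by (simp only:)
  then show False using assms(3) by simp
qed

text \<open>
  The invariant of a point is the number of grid values below each of its coordinates. It cannot
  change along a connected set, whose coordinate projections are intervals that avoid the grid
  values; and two points with equal invariant are joined by a segment that crosses no hyperplane.
\<close>

lemma card_components_grid_complement:
  fixes Z :: "'n::finite \<Rightarrow> real set"
  assumes fin: "\<And>i. finite (Z i)"
  defines "S \<equiv> {x :: real^'n. \<forall>i. x $ i \<notin> Z i}"
  shows "finite (components S)" "card (components S) = (\<Prod>i\<in>UNIV. card (Z i) + 1)"
proof -
  define \<phi> :: "real^'n \<Rightarrow> 'n \<Rightarrow> nat" where "\<phi> x = (\<lambda>i. card {z \<in> Z i. z < x $ i})" for x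
  have bij: "bij_betw (\<lambda>c. {x \<in> S. \<phi> x = c}) (\<phi> ` S) (components S)"
  proof (rule components_eq_fibres)
    fix x y assume "connected_component S x y"
    then obtain T where T: "connected T" "T \<subseteq> S" "x \<in> T" "y \<in> T"
      unfolding connected_component_def by blast
    have mono: "{z \<in> Z i. z < v $ i} \<subseteq> {z \<in> Z i. z < w $ i}" if "v \<in> T" "w \<in> T" for v w i
    proof
      fix z assume z: "z \<in> {z \<in> Z i. z < v $ i}"
      have "connected ((\<lambda>v. v $ i) ` T)"
        by (intro connected_continuous_image T continuous_intros)
      then have "z \<in> (\<lambda>v. v $ i) ` T" if "w $ i \<le> z"
        using connectedD_interval[of "(\<lambda>v. v $ i) ` T" "w $ i" "v $ i" z] that z \<open>v \<in> T\<close> \<open>w \<in> T\<close>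
        by auto
      with z T(2) have "\<not> w $ i \<le> z" by (auto simp: S_def)
      with z show "z \<in> {z \<in> Z i. z < w $ i}" by simp
    qed
    then have "{z \<in> Z i. z < x $ i} = {z \<in> Z i. z < y $ i}" for i
      using T by (intro equalityI mono)
    then show "\<phi> x = \<phi> y" by (simp add: \<phi>_def)
  next
    fix x y assume x: "x \<in> S" and y: "y \<in> S" and eq: "\<phi> x = \<phi> y"
    have "closed_segment x y \<subseteq> S"
    proof
      fix w assume w: "w \<in> closed_segment x y"
      have "w $ i \<notin> Z i" for i
      proof
        assume wZ: "w $ i \<in> Z i"
        have "w $ i \<in> closed_segment (x $ i) (y $ i)"
          using w by (auto simp: closed_segment_def)
        then have bet: "x $ i \<le> w $ i \<and> w $ i \<le> y $ i \<or> y $ i \<le> w $ i \<and> w $ i \<le> x $ i"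
          by (auto simp: closed_segment_eq_real_ivl split: if_splits)
        have ne: "w $ i \<noteq> x $ i" "w $ i \<noteq> y $ i" using wZ x y by (auto simp: S_def)
        have c: "card {z \<in> Z i. z < x $ i} = card {z \<in> Z i. z < y $ i}"
          using eq by (simp add: \<phi>_def fun_eq_iff)
        show False
          using bet ne wZ c not_mem_if_equal_counts_below[OF fin, of i "x $ i" "y $ i" "w $ i"]
            not_mem_if_equal_counts_below[OF fin, of i "y $ i" "x $ i" "w $ i"] by force
      qed
      then show "w \<in> S" by (simp add: S_def)
    qed
    then show "connected_component S x y"
      unfolding connected_component_def by (intro exI[of _ "closed_segment x y"]) auto
  qed
  have img: "\<phi> ` S = PiE UNIV (\<lambda>i. {..card (Z i)})"
  proof (intro equalityI subsetI)
    fix c assume "c \<in> \<phi> ` S"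
    then show "c \<in> PiE UNIV (\<lambda>i. {..card (Z i)})"
      by (auto simp: \<phi>_def PiE_UNIV_domain intro!: card_mono fin)
  next
    fix c assume c: "c \<in> PiE UNIV (\<lambda>i. {..card (Z i)})"
    have "\<exists>t. t \<notin> Z i \<and> card {z \<in> Z i. z < t} = c i" for i
    proof -
      have "c i \<in> (\<lambda>x. card {z \<in> Z i. z < x}) ` (- Z i)"
        using c unfolding count_below_surj[OF fin] by (auto simp: PiE_UNIV_domain)
      then obtain x where "c i = card {z \<in> Z i. z < x}" "x \<in> - Z i" by (rule imageE)
      then show ?thesis by (intro exI[of _ x]) simp
    qed
    then obtain t where t: "\<And>i. t i \<notin> Z i" "\<And>i. card {z \<in> Z i. z < t i} = c i" by metis
    show "c \<in> \<phi> ` S"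
      by (rule image_eqI[of _ _ "\<chi> i. t i"]) (simp_all add: \<phi>_def S_def t)
  qed
  show "finite (components S)"
    using bij_betw_finite[OF bij] img by (simp add: finite_PiE)
  show "card (components S) = (\<Prod>i\<in>UNIV. card (Z i) + 1)"
    using bij_betw_same_card[OF bij] img by (simp add: card_PiE)
qed

section \<open>Lattice points in a simplex\<close>

text \<open>
  The two sides of the mean value inequality for $t^{s+1}$, by an induction that uses no calculus.
  They bound a Riemann sum of $t^s$ by telescoping sums.
\<close>

lemma power_Suc_diff_bounds:
  fixes x y :: real
  assumes "0 \<le> y" "y \<le> x"
  shows "real (Suc s) * (x - y) * y ^ s \<le> x ^ Suc s - y ^ Suc s"
    and "x ^ Suc s - y ^ Suc s \<le> real (Suc s) * (x - y) * x ^ s"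
proof (induction s)
  case (Suc s)
  have eq: "x ^ Suc (Suc s) - y ^ Suc (Suc s) = x * (x ^ Suc s - y ^ Suc s) + (x - y) * y ^ Suc s"
    by (simp add: algebra_simps)
  { case 1
    have "real (Suc s) * (x - y) * y ^ s * y \<le> (x ^ Suc s - y ^ Suc s) * x"
      by (rule mult_mono) (use Suc assms power_mono[OF assms(2,1), of "Suc s"] in auto)
    then show ?case unfolding eq by (simp add: algebra_simps)
  next
    case 2
    have "x * (x ^ Suc s - y ^ Suc s) \<le> x * (real (Suc s) * (x - y) * x ^ s)"
      using Suc(2) assms by (intro mult_left_mono) auto
    moreover have "(x - y) * y ^ Suc s \<le> (x - y) * x ^ Suc s"
      using assms by (intro mult_left_mono power_mono) auto
    ultimately show ?case unfolding eq by (simp add: algebra_simps)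
  }
qed auto

text \<open>
  Multi-indices are functions in \<open>PiE I (\<lambda>_. UNIV)\<close>, so that the index set can grow by induction.
\<close>

definition lattice_simplex :: "'i set \<Rightarrow> ('i \<Rightarrow> real) \<Rightarrow> real \<Rightarrow> ('i \<Rightarrow> nat) set" where
  "lattice_simplex I b L = {m \<in> PiE I (\<lambda>_. UNIV). (\<Sum>i\<in>I. b i * real (m i)) \<le> L}"

text \<open>
  Slicing the simplex by the value $t$ of the new coordinate.
\<close>

lemma lattice_simplex_insert:
  assumes "finite I" "j \<notin> I" "b j > 0" "\<forall>i\<in>I. b i > 0" "L \<ge> 0"
  shows "lattice_simplex (insert j I) b L =
     (\<lambda>(t, m). m(j := t)) ` (SIGMA t:{..nat \<lfloor>L / b j\<rfloor>}. lattice_simplex I b (L - b j * real t))"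
    (is "?L = ?R")
proof (intro equalityI subsetI)
  fix m assume m: "m \<in> ?L"
  let ?m = "restrict m I"
  have sum: "(\<Sum>i\<in>I. b i * real (m i)) \<le> L - b j * real (m j)"
    using m assms by (simp add: lattice_simplex_def)
  moreover have "0 \<le> (\<Sum>i\<in>I. b i * real (m i))"
    using assms by (intro sum_nonneg) (simp add: less_imp_le)
  ultimately have "real (m j) \<le> L / b j"
    using assms by (simp add: field_simps)
  then have "m j \<le> nat \<lfloor>L / b j\<rfloor>" by (simp add: le_nat_floor)
  moreover have "?m \<in> lattice_simplex I b (L - b j * real (m j))"
    using sum by (simp add: lattice_simplex_def cong: sum.cong)
  moreover have "m = ?m(j := m j)"
  proof
    fix i show "m i = (?m(j := m j)) i"
      using m by (auto simp: lattice_simplex_def PiE_def extensional_def restrict_def)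
  qed
  ultimately show "m \<in> ?R"
    by (intro image_eqI[of _ _ "(m j, ?m)"]) auto
next
  fix m assume "m \<in> ?R"
  then obtain t m' where m': "m' \<in> lattice_simplex I b (L - b j * real t)" and m: "m = m'(j := t)"
    by auto
  have "(\<Sum>i\<in>I. b i * real (m i)) = (\<Sum>i\<in>I. b i * real (m' i))"
    using assms m by (intro sum.cong) auto
  with m' m show "m \<in> ?L"
    using assms by (auto simp: lattice_simplex_def PiE_def extensional_def)
qed

lemma card_lattice_simplex_insert:
  assumes "finite I" "j \<notin> I" "b j > 0" "\<forall>i\<in>I. b i > 0" "L \<ge> 0"
    and fin: "\<And>L. L \<ge> 0 \<Longrightarrow> finite (lattice_simplex I b L)"
  shows "finite (lattice_simplex (insert j I) b L)"
    and "card (lattice_simplex (insert j I) b L) =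
      (\<Sum>t\<le>nat \<lfloor>L / b j\<rfloor>. card (lattice_simplex I b (L - b j * real t)))"
proof -
  let ?S = "SIGMA t:{..nat \<lfloor>L / b j\<rfloor>}. lattice_simplex I b (L - b j * real t)"
  have nonneg: "0 \<le> L - b j * real t" if "t \<le> nat \<lfloor>L / b j\<rfloor>" for t
  proof -
    have "real t \<le> L / b j" using that assms by (simp add: le_nat_iff le_floor_iff)
    then show ?thesis using assms by (simp add: field_simps)
  qed
  have inj: "inj_on (\<lambda>(t, m). m(j := t)) ?S"
  proof (rule inj_onI, clarify)
    fix t m t' m' assume m: "m \<in> lattice_simplex I b (L - b j * real t)"
      "m' \<in> lattice_simplex I b (L - b j * real t')" and eq: "m(j := t) = m'(j := t')"
    have "m i = m' i" for i
      using fun_cong[OF eq, of i] m assms(2)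
      by (cases "i = j") (auto simp: lattice_simplex_def PiE_def extensional_def)
    then show "t = t' \<and> m = m'" using fun_cong[OF eq, of j] by auto
  qed
  have finS: "finite ?S" using fin nonneg by auto
  show "finite (lattice_simplex (insert j I) b L)"
    unfolding lattice_simplex_insert[OF assms(1-5)] using finS by simp
  show "card (lattice_simplex (insert j I) b L) =
      (\<Sum>t\<le>nat \<lfloor>L / b j\<rfloor>. card (lattice_simplex I b (L - b j * real t)))"
    unfolding lattice_simplex_insert[OF assms(1-5)] card_image[OF inj]
    using fin nonneg by (subst card_SigmaI) auto
qed

text \<open>
  The number of lattice points compared with the volume $L^s / (s! \prod_i b_i)$ of the simplex and
  with that of an enlarged simplex. Slicing by one coordinate expresses the count as a sum of counts in
  dimension $s$; by the induction hypothesis it is sandwiched between Riemann sums, which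
  telescope.
\<close>

lemma card_lattice_simplex_bounds:
  assumes "finite I" "\<forall>i\<in>I. b i > 0" "L \<ge> 0"
  shows "finite (lattice_simplex I b L)"
    and "L ^ card I \<le> real (card (lattice_simplex I b L)) * (fact (card I) * (\<Prod>i\<in>I. b i))"
    and "real (card (lattice_simplex I b L)) * (fact (card I) * (\<Prod>i\<in>I. b i)) \<le> (L + (\<Sum>i\<in>I. b i)) ^ card I"
proof -
  have "finite (lattice_simplex I b L) \<and>
    L ^ card I \<le> real (card (lattice_simplex I b L)) * (fact (card I) * (\<Prod>i\<in>I. b i)) \<and>
    real (card (lattice_simplex I b L)) * (fact (card I) * (\<Prod>i\<in>I. b i)) \<le> (L + (\<Sum>i\<in>I. b i)) ^ card I"
    using assms
  proof (induction I arbitrary: L rule: finite_induct)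
    case empty
    have "lattice_simplex {} b L = {\<lambda>_. undefined}"
      using empty by (auto simp: lattice_simplex_def)
    then show ?case by simp
  next
    case (insert j I)
    define s where "s = card I"
    define c where "c = fact s * (\<Prod>i\<in>I. b i)"
    define B where "B = (\<Sum>i\<in>I. b i)"
    \<comment> \<open>the largest value of the new coordinate, so that slice $M + 1$ would be empty\<close>
    define M where "M = nat \<lfloor>L / b j\<rfloor>"
    define N where "N t = real (card (lattice_simplex I b (L - b j * real t)))" for t
    have bj: "b j > 0" and bI: "\<forall>i\<in>I. b i > 0" using insert.prems by auto
    have B0: "B \<ge> 0" using bI unfolding B_def by (intro sum_nonneg) (simp add: less_imp_le)
    have M1: "0 \<le> L - b j * real t" if "t \<le> M" for t
    proof -
      have "real t \<le> L / b j" using that bj insert.prems by (simp add: M_def le_nat_iff le_floor_iff)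
      then show ?thesis using bj by (simp add: field_simps)
    qed
    have M2: "L - b j * real (Suc M) \<le> 0"
    proof -
      have "L / b j < real M + 1" using insert.prems bj by (simp add: M_def)
      then show ?thesis using bj by (simp add: field_simps)
    qed
    have lo: "(L - b j * real t) ^ s \<le> N t * c" and up: "N t * c \<le> (L - b j * real t + B) ^ s"
      if "t \<le> M" for t
      using insert.IH[OF bI M1[OF that]] by (auto simp: N_def s_def c_def B_def)
    have card: "card (insert j I) = Suc s" using insert.hyps by (simp add: s_def)
    have const: "fact (Suc s) * (\<Prod>i\<in>insert j I. b i) = real (Suc s) * b j * c"
      using insert.hyps by (simp add: c_def algebra_simps)
    have N: "real (card (lattice_simplex (insert j I) b L)) = (\<Sum>t\<le>M. N t)"
      and fin: "finite (lattice_simplex (insert j I) b L)"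
      using card_lattice_simplex_insert[of I j b L] insert.hyps bj bI insert
      by (auto simp: M_def N_def)
    have lower: "L ^ Suc s \<le> (\<Sum>t\<le>M. N t) * (real (Suc s) * b j * c)"
    proof -
      \<comment> \<open>truncation at zero makes the last term of the telescoping sum vanish\<close>
      define v where "v t = max 0 (L - b j * real t)" for t
      have step: "v t ^ Suc s - v (Suc t) ^ Suc s \<le> N t * (real (Suc s) * b j * c)" if "t \<le> M" for t
      proof -
        have v: "0 \<le> v (Suc t)" "v (Suc t) \<le> v t" "v t - v (Suc t) \<le> b j" "v t = L - b j * real t"
          using bj M1[OF that] by (auto simp: v_def algebra_simps)
        have "v t ^ Suc s - v (Suc t) ^ Suc s \<le> real (Suc s) * (v t - v (Suc t)) * v t ^ s"
          by (rule power_Suc_diff_bounds(2)[OF v(1,2)])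
        also have "\<dots> \<le> real (Suc s) * b j * (N t * c)"
          using v bj lo[OF that] by (intro mult_mono) auto
        finally show ?thesis by (simp add: algebra_simps)
      qed
      have "L ^ Suc s = v 0 ^ Suc s - v (Suc M) ^ Suc s"
        using insert.prems M2 by (simp add: v_def)
      also have "\<dots> = (\<Sum>t\<le>M. v t ^ Suc s - v (Suc t) ^ Suc s)"
        by (rule sum_telescope[symmetric])
      also have "\<dots> \<le> (\<Sum>t\<le>M. N t * (real (Suc s) * b j * c))"
        by (intro sum_mono step) simp
      finally show ?thesis by (simp add: sum_distrib_right)
    qed
    have upper: "(\<Sum>t\<le>M. N t) * (real (Suc s) * b j * c) \<le> (L + (b j + B)) ^ Suc s"
    proof -
      \<comment> \<open>shifted by one step, so that the bound for slice $t$ appears as the value at $t + 1$\<close>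
      define v where "v t = L + (b j + B) - b j * real t" for t
      have step: "N t * (real (Suc s) * b j * c) \<le> v t ^ Suc s - v (Suc t) ^ Suc s" if "t \<le> M" for t
      proof -
        have v: "0 \<le> v (Suc t)" "v (Suc t) \<le> v t" "v t - v (Suc t) = b j" "v (Suc t) = L - b j * real t + B"
          using bj M1[OF that] B0 by (auto simp: v_def algebra_simps)
        have "N t * (real (Suc s) * b j * c) = real (Suc s) * b j * (N t * c)"
          by (simp add: algebra_simps)
        also have "\<dots> \<le> real (Suc s) * b j * v (Suc t) ^ s"
          using up[OF that] bj v(4) by (intro mult_left_mono) auto
        also have "\<dots> \<le> v t ^ Suc s - v (Suc t) ^ Suc s"
          using power_Suc_diff_bounds(1)[OF v(1,2), of s] v(3) by simp
        finally show ?thesis .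
      qed
      have "(\<Sum>t\<le>M. N t) * (real (Suc s) * b j * c) \<le> (\<Sum>t\<le>M. v t ^ Suc s - v (Suc t) ^ Suc s)"
        unfolding sum_distrib_right by (intro sum_mono step) simp
      also have "\<dots> = v 0 ^ Suc s - v (Suc M) ^ Suc s"
        by (rule sum_telescope)
      also have "\<dots> \<le> v 0 ^ Suc s"
        using zero_le_power[of "v (Suc M)" "Suc s"] M1[of M] B0 by (simp add: v_def algebra_simps)
      finally show ?thesis by (simp add: v_def)
    qed
    show ?case
      using fin lower upper insert.hyps unfolding card N const by (simp add: B_def)
  qed
  then show "finite (lattice_simplex I b L)"
    and "L ^ card I \<le> real (card (lattice_simplex I b L)) * (fact (card I) * (\<Prod>i\<in>I. b i))"
    and "real (card (lattice_simplex I b L)) * (fact (card I) * (\<Prod>i\<in>I. b i)) \<le> (L + (\<Sum>i\<in>I. b i)) ^ card I"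
    by blast+
qed

section \<open>The limit superior of product over rank\<close>

text \<open>
  The sequence of indices need not be monotone, only tend to infinity.
\<close>

lemma limsup_ge_along:
  fixes u :: "nat \<Rightarrow> ereal"
  assumes K: "filterlim K at_top sequentially" and le: "eventually (\<lambda>t. v t \<le> u (K t)) sequentially"
    and lim: "v \<longlonglongrightarrow> c"
  shows "c \<le> limsup u"
proof (rule dense_ge)
  fix y assume y: "limsup u < y"
  then have "eventually (\<lambda>k. u k < y) sequentially"
    using Limsup_le_iff[of sequentially u "limsup u"] by simp
  then have "eventually (\<lambda>t. u (K t) < y) sequentially"
    using K by (rule eventually_compose_filterlim)
  with le have "eventually (\<lambda>t. v t \<le> y) sequentially"
    by eventually_elim (meson le_less_trans less_imp_le)
  then show "c \<le> y"
    using lim by (intro tendsto_upperbound[OF lim]) auto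
qed

lemma prod_le_mean_power:
  fixes y :: "'n::finite \<Rightarrow> real"
  assumes "\<And>i. y i \<ge> 0"
  shows "(\<Prod>i\<in>UNIV. y i) \<le> ((\<Sum>i\<in>UNIV. y i) / real CARD('n)) ^ CARD('n)"
proof -
  define p where "p = (\<Prod>i\<in>UNIV. y i)"
  have p: "p \<ge> 0" using assms by (auto simp: p_def intro!: prod_nonneg)
  have "p powr (1 / real CARD('n)) \<le> (\<Sum>i\<in>UNIV. y i) / real CARD('n)"
    using arith_geom_mean[of "UNIV :: 'n set" y] assms by (simp add: p_def sum_divide_distrib)
  then have "(p powr (1 / real CARD('n))) ^ CARD('n) \<le> ((\<Sum>i\<in>UNIV. y i) / real CARD('n)) ^ CARD('n)"
    by (intro power_mono) auto
  also have "(p powr (1 / real CARD('n))) ^ CARD('n) = p"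
    using p by (cases "p = 0") (auto simp: powr_powr simp flip: powr_realpow)
  finally show ?thesis unfolding p_def .
qed

lemma quotient_le_of_product_le:
  fixes p q x y k c :: real
  assumes "p > 0" "x > 0" "k > 0" "p * q * x \<le> y * (k * (c * p))"
  shows "q / k \<le> c * (y / x)"
  using assms by (simp add: field_simps)

text \<open>
  Upper bound: the inequality of arithmetic and geometric means for the numerator against the lower
  bound for the rank. Lower bound: along the multi-indices with $m_i = \lfloor t / b_i \rfloor$ the numerator
  is at least $t^n / \prod_i b_i$, while the upper bound for the rank is evaluated at
  $L \le n t$. The error factors $1 + B/L$ with $B = \sum_i b_i$ disappear in the limit, since only finitely
  many ranks belong to bounded $L$.
\<close>

lemma limsup_product_over_rank:
  fixes b :: "'n::finite \<Rightarrow> real" and m :: "nat \<Rightarrow> 'n \<Rightarrow> nat"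
  assumes b: "\<And>i. b i > 0" and bij: "bij_betw m {1..} UNIV"
    and rank: "\<And>k. k \<ge> 1 \<Longrightarrow> card (lattice_simplex UNIV b (\<Sum>i\<in>UNIV. b i * real (m k i))) = k"
  shows "limsup (\<lambda>k. ereal (real (\<Prod>i\<in>UNIV. m k i + 1) / real k)) = ereal (fact CARD('n) / real CARD('n) ^ CARD('n))"
proof (rule antisym)
  define n where "n = CARD('n)"
  define B where "B = (\<Sum>i\<in>UNIV. b i)"
  define P where "P = (\<Prod>i\<in>UNIV. b i)"
  define L where "L k = (\<Sum>i\<in>UNIV. b i * real (m k i))" for k
  define c where "c = fact n / real n ^ n"
  have n: "n > 0" by (simp add: n_def)
  have B: "B > 0" unfolding B_def using b by (intro sum_pos) auto
  have P: "P > 0" unfolding P_def using b by (intro prod_pos) auto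
  have L0: "L k \<ge> 0" for k
    unfolding L_def using b by (intro sum_nonneg mult_nonneg_nonneg) (auto intro: less_imp_le)
  have b': "\<forall>i\<in>UNIV. b i > 0" using b by simp
  have lo: "L k ^ n \<le> real k * (fact n * P)" and up: "real k * (fact n * P) \<le> (L k + B) ^ n"
    if "k \<ge> 1" for k
    using card_lattice_simplex_bounds(2,3)[OF finite_class.finite_UNIV b' L0[of k]] rank[OF that]
    unfolding n_def P_def B_def L_def by simp_all
  have finL: "finite {k. k \<ge> 1 \<and> L k \<le> x}" for x
  proof -
    have "m ` {k. k \<ge> 1 \<and> L k \<le> x} \<subseteq> lattice_simplex UNIV b (max 0 x)"
      by (auto simp: lattice_simplex_def L_def PiE_UNIV_domain)
    then have "finite (m ` {k. k \<ge> 1 \<and> L k \<le> x})"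
      using card_lattice_simplex_bounds(1)[OF finite_class.finite_UNIV b', of "max 0 x"] finite_subset by auto
    moreover have "inj_on m {k. k \<ge> 1 \<and> L k \<le> x}"
      using bij_betw_imp_inj_on[OF bij] by (rule inj_on_subset) auto
    ultimately show ?thesis by (rule finite_imageD)
  qed
  have Linf: "filterlim L at_top sequentially"
    unfolding filterlim_at_top_dense
  proof
    fix x
    have "eventually (\<lambda>k. k > Max (insert 0 {k. k \<ge> 1 \<and> L k \<le> x})) sequentially"
      by (rule eventually_gt_at_top)
    then show "eventually (\<lambda>k. x < L k) sequentially"
    proof eventually_elim
      case (elim k)
      have "k \<notin> {k. k \<ge> 1 \<and> L k \<le> x}"
        using elim Max_ge[of "insert 0 {k. k \<ge> 1 \<and> L k \<le> x}" k] finL[of x]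
        by (meson finite_insert insertI2 leD)
      moreover have "k \<ge> 1" using elim by simp
      ultimately show ?case by auto
    qed
  qed
  show "limsup (\<lambda>k. ereal (real (\<Prod>i\<in>UNIV. m k i + 1) / real k)) \<le> ereal (fact CARD('n) / real CARD('n) ^ CARD('n))"
  proof -
    have "eventually (\<lambda>k. ereal (real (\<Prod>i\<in>UNIV. m k i + 1) / real k) \<le> ereal (c * (1 + B / L k) ^ n)) sequentially"
      using eventually_ge_at_top[of 1] filterlim_at_top_dense[THEN iffD1, OF Linf, rule_format, of 0]
    proof eventually_elim
      case (elim k)
      have "P * real (\<Prod>i\<in>UNIV. m k i + 1) = (\<Prod>i\<in>UNIV. b i * (real (m k i) + 1))"
        by (simp add: P_def prod.distrib add.commute)
      also have "\<dots> \<le> ((\<Sum>i\<in>UNIV. b i * (real (m k i) + 1)) / real n) ^ n"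
        unfolding n_def using b by (intro prod_le_mean_power) (simp add: less_imp_le)
      also have "(\<Sum>i\<in>UNIV. b i * (real (m k i) + 1)) = L k + B"
        by (simp add: L_def B_def algebra_simps sum.distrib)
      finally have 1: "P * real (\<Prod>i\<in>UNIV. m k i + 1) \<le> ((L k + B) / real n) ^ n" .
      have 2: "L k ^ n \<le> real k * (fact n * P)" using lo elim by simp
      have "P * real (\<Prod>i\<in>UNIV. m k i + 1) * L k ^ n \<le> ((L k + B) / real n) ^ n * (real k * (fact n * P))"
        using 1 2 elim P B by (intro mult_mono) (auto intro!: prod_nonneg)
      then have "real (\<Prod>i\<in>UNIV. m k i + 1) / real k \<le> fact n * (((L k + B) / real n) ^ n / L k ^ n)"
        using elim P by (intro quotient_le_of_product_le) auto
      also have "\<dots> = c * (1 + B / L k) ^ n"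
        using elim n by (simp add: c_def power_divide add_divide_distrib[symmetric] field_simps flip: power_mult_distrib)
      finally show ?case by simp
    qed
    then have "limsup (\<lambda>k. ereal (real (\<Prod>i\<in>UNIV. m k i + 1) / real k))
        \<le> limsup (\<lambda>k. ereal (c * (1 + B / L k) ^ n))"
      by (rule Limsup_mono)
    also have "\<dots> = ereal c"
    proof -
      have "(\<lambda>k. c * (1 + B / L k) ^ n) \<longlonglongrightarrow> c * (1 + 0) ^ n"
        by (intro tendsto_intros tendsto_divide_0[OF tendsto_const] filterlim_at_top_imp_at_infinity Linf)
      then show ?thesis by (intro lim_imp_Limsup) auto
    qed
    finally show ?thesis by (simp add: c_def n_def)
  qed
  show "ereal (fact CARD('n) / real CARD('n) ^ CARD('n)) \<le> limsup (\<lambda>k. ereal (real (\<Prod>i\<in>UNIV. m k i + 1) / real k))"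
  proof -
    \<comment> \<open>the multi-indices with all $b_i m_i$ nearly equal to $t$, where the mean inequality is nearly sharp\<close>
    define w where "w t = (\<lambda>i. nat \<lfloor>real t / b i\<rfloor>)" for t :: nat
    define K where "K t = inv_into {1..} m (w t)" for t
    have K: "m (K t) = w t" "K t \<ge> 1" for t
      using bij_betw_inv_into_right[OF bij] bij_betw_imp_surj_on[OF bij] inv_into_into[of "w t" m "{1..}"]
      unfolding K_def by auto
    have w: "real (w t i) \<le> real t / b i" "real t / b i \<le> real (w t i) + 1" for t i
      using b[of i] by (auto simp: w_def le_nat_iff)
    have LK: "L (K t) \<le> real n * real t" "real n * real t \<le> L (K t) + B" for t
    proof -
      have "L (K t) \<le> (\<Sum>i\<in>(UNIV :: 'n set). real t)"
        unfolding L_def K using w(1)[of t] b by (intro sum_mono) (simp add: field_simps)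
      then show "L (K t) \<le> real n * real t" by (simp add: n_def)
      have "(\<Sum>i\<in>(UNIV :: 'n set). real t) \<le> (\<Sum>i\<in>UNIV. b i * real (m (K t) i) + b i)"
        unfolding K using w(2)[of t] b by (intro sum_mono) (simp add: field_simps)
      then show "real n * real t \<le> L (K t) + B" by (simp add: n_def L_def B_def sum.distrib)
    qed
    have Kinf: "filterlim K at_top sequentially"
    proof -
      have "filterlim (\<lambda>t. real n * real t - B) at_top sequentially"
        using n by real_asymp
      then have LKinf: "filterlim (\<lambda>t. L (K t)) at_top sequentially"
        by (rule filterlim_at_top_mono) (use LK(2) in \<open>auto simp: algebra_simps intro!: always_eventually\<close>)
      show ?thesis unfolding filterlim_at_top
      proof
        fix k0
        have "eventually (\<lambda>t. L (K t) > Max (L ` {..k0})) sequentially"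
          using LKinf unfolding filterlim_at_top_dense by blast
        then show "eventually (\<lambda>t. k0 \<le> K t) sequentially"
        proof eventually_elim
          case (elim t)
          show ?case
          proof (rule ccontr)
            assume "\<not> k0 \<le> K t"
            then have "L (K t) \<le> Max (L ` {..k0})" by (intro Max_ge) auto
            moreover have "Max (L ` {..k0}) < L (K t)" using elim by blast
            ultimately show False by (meson leD)
          qed
        qed
      qed
    qed
    have "eventually (\<lambda>t. ereal (c * (1 / (1 + B / (real n * real t))) ^ n) \<le> 
        ereal (real (\<Prod>i\<in>UNIV. m (K t) i + 1) / real (K t))) sequentially"
      using eventually_ge_at_top[of 1]
    proof eventually_elim
      case (elim t)
      have "real t ^ n = (\<Prod>i\<in>(UNIV :: 'n set). real t)" by (simp add: n_def)
      also have "\<dots> \<le> (\<Prod>i\<in>UNIV. b i * (real (m (K t) i) + 1))"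
        unfolding K using w(2)[of t] b by (intro prod_mono) (simp add: field_simps)
      also have "\<dots> = P * real (\<Prod>i\<in>UNIV. m (K t) i + 1)"
        by (simp add: P_def prod.distrib add.commute)
      finally have 1: "real t ^ n \<le> P * real (\<Prod>i\<in>UNIV. m (K t) i + 1)" .
      have 2: "real (K t) * (fact n * P) \<le> (real n * real t + B) ^ n"
        using up[OF K(2)[of t]] power_mono[of "L (K t) + B" "real n * real t + B" n] LK(1)[of t] L0[of "K t"] B
        by linarith
      have "real t ^ n * (real (K t) * (fact n * P)) \<le> 
         (P * real (\<Prod>i\<in>UNIV. m (K t) i + 1)) * (real n * real t + B) ^ n"
        using 1 2 P by (intro mult_mono) (auto intro!: mult_nonneg_nonneg prod_nonneg)
      moreover have "(real n * real t + B) ^ n > 0" "real (K t) > 0" using B K(2)[of t] by (auto intro!: zero_less_power add_nonneg_pos)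
      ultimately have "fact n * (real t ^ n / (real n * real t + B) ^ n) \<le> real (\<Prod>i\<in>UNIV. m (K t) i + 1) / real (K t)"
        using P by (simp add: field_simps)
      moreover have "fact n * (real t ^ n / (real n * real t + B) ^ n) = c * (1 / (1 + B / (real n * real t))) ^ n"
      proof -
        have nt: "real n * real t > 0" using n elim by simp
        have "1 / (1 + B / (real n * real t)) = real n * real t / (real n * real t + B)"
        proof -
          have "1 + B / (real n * real t) = (real n * real t + B) / (real n * real t)"
            unfolding add_divide_distrib using less_imp_neq[OF nt] by (metis divide_self)
          then show ?thesis by (simp only: divide_divide_eq_right mult_1)
        qed
        then show ?thesis using n by (simp add: c_def power_divide power_mult_distrib)
      qed
      ultimately show ?case by simp
    qed
    moreover have "(\<lambda>t. c * (1 / (1 + B / (real n * real t))) ^ n) \<longlonglongrightarrow> c * (1 / (1 + 0)) ^ n"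
    proof -
      have "(\<lambda>t. B / (real n * real t)) \<longlonglongrightarrow> 0" using n by real_asymp
      then show ?thesis by (intro tendsto_intros) auto
    qed
    then have "(\<lambda>t. ereal (c * (1 / (1 + B / (real n * real t))) ^ n)) \<longlonglongrightarrow> ereal c" by simp
    ultimately have "ereal c \<le> limsup (\<lambda>k. ereal (real (\<Prod>i\<in>UNIV. m k i + 1) / real k))"
      by (rule limsup_ge_along[OF Kinf])
    then show ?thesis by (simp add: c_def n_def)
  qed
qed

section \<open>Nodal counts of the oscillator\<close>

lemma nodal_count_hermite_product:
  fixes a :: "real^'n"
  assumes a: "\<forall>i. a $ i > 0" and c: "c \<noteq> 0" and f: "\<And>x. complex_of_real (f x) = c * hermite_state a k x"
  shows "nodal_count f = enat (\<Prod>i\<in>UNIV. k i + 1)"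
proof -
  define Z where "Z i = {t. hermite_fun (a $ i) (k i) t = 0}" for i
  have Z: "finite (Z i)" "card (Z i) = k i" for i
    unfolding Z_def using card_hermite_fun_zeros[of "a $ i" "k i"] a by auto
  have "f x \<noteq> 0 \<longleftrightarrow> (\<forall>i. x $ i \<notin> Z i)" for x
  proof -
    have "f x = 0 \<longleftrightarrow> hermite_product a k x = 0"
      using f[of x] c by (metis mult_eq_0_iff of_real_eq_0_iff hermite_state_def)
    then show ?thesis by (simp add: hermite_product_def Z_def)
  qed
  then have "nodal_domains f = components {x. \<forall>i. x $ i \<notin> Z i}"
    by (simp add: nodal_domains_def)
  then show ?thesis
    using card_components_grid_complement[of Z, OF Z(1)] by (simp add: nodal_count_def Z(2))
qed

theorem theorem1p3:
  fixes a :: "real^'n"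
    and lam :: "nat \<Rightarrow> real"
    and f :: "nat \<Rightarrow> real^'n \<Rightarrow> real"
  assumes "\<forall>i. a $ i > 0"
    and "rationally_independent a"
    and "strict_mono_on {1..} lam"
    and "{z. eigenvalue (oscillator a) z} = (\<lambda>k. complex_of_real (lam k)) ` {1..}"
    and "\<forall>k\<ge>1. continuous_on UNIV (f k) \<and>
           eigenfunction (oscillator a) (complex_of_real (lam k)) (\<lambda>x. complex_of_real (f k x))"
  shows "(\<forall>k\<ge>1. simple_eigenvalue (oscillator a) (complex_of_real (lam k))) \<and>
         limsup (\<lambda>k. ereal_of_enat (nodal_count (f k)) / ereal (real k)) =
           ereal (fact (CARD('n)) / real (CARD('n)) ^ CARD('n))"
proof
  interpret oscillator_setting a
    using assms(1,2) by unfold_locales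
  show "\<forall>k\<ge>1. simple_eigenvalue (oscillator a) (complex_of_real (lam k))"
    using assms(5) simple_eigenvalue_oscillator unfolding eigenvalue_def by blast
  have "\<exists>m c. lam k = osc_value a m \<and> c \<noteq> 0 \<and> (\<forall>x. complex_of_real (f k x) = c * hermite_state a m x)"
    if k: "k \<ge> 1" for k
  proof -
    have cont: "continuous_on UNIV (f k)"
      and eig: "eigenfunction (oscillator a) (complex_of_real (lam k)) (\<lambda>x. complex_of_real (f k x))"
      using assms(5) k by auto
    obtain m c where m: "complex_of_real (lam k) = complex_of_real (osc_value a m)" "c \<noteq> 0"
      "ae_eq (\<lambda>x. complex_of_real (f k x)) (\<lambda>x. c * hermite_state a m x)"
      using eigenfunction_oscillator[OF eig] by (elim exE conjE)
    have "(\<lambda>x. complex_of_real (f k x)) = (\<lambda>x. c * hermite_state a m x)"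
      by (rule continuous_ae_eq_imp_eq[OF _ _ m(3)])
         (intro continuous_intros cont continuous_hermite_state[OF assms(1)])+
    then show ?thesis using m(1,2) by (intro exI[of _ m] exI[of _ c]) (auto simp: fun_eq_iff)
  qed
  then obtain m c where m: "\<And>k. k \<ge> 1 \<Longrightarrow> lam k = osc_value a (m k)"
    and c: "\<And>k. k \<ge> 1 \<Longrightarrow> c k \<noteq> 0" "\<And>k x. k \<ge> 1 \<Longrightarrow> complex_of_real (f k x) = c k * hermite_state a (m k) x"
    by metis
  have mono: "lam j \<le> lam k \<longleftrightarrow> j \<le> k" if "j \<ge> 1" "k \<ge> 1" for j k
    using strict_mono_on_less_eq[OF assms(3)] that by simp
  have surj: "\<exists>k\<ge>1. m k = l" for l
  proof -
    have "complex_of_real (osc_value a l) \<in> (\<lambda>k. complex_of_real (lam k)) ` {1..}"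
      using assms(4) eigenvalue_oscillator by blast
    then obtain k where "k \<ge> 1" "osc_value a l = lam k" by auto
    then show ?thesis using osc_value_inj[OF assms(2), of l "m k"] m by (intro exI[of _ k]) auto
  qed
  have inj: "inj_on m {1..}"
    by (rule inj_onI) (metis atLeast_iff m mono order_antisym order_refl)
  have bij: "bij_betw m {1..} UNIV"
    unfolding bij_betw_def
  proof (intro conjI inj equalityI subsetI)
    fix l assume "l \<in> (UNIV :: ('n \<Rightarrow> nat) set)"
    obtain k where "k \<ge> 1" "m k = l" using surj by blast
    then show "l \<in> m ` {1..}" by auto
  qed simp
  have rank: "card (lattice_simplex UNIV (\<lambda>i. a $ i) (\<Sum>i\<in>UNIV. a $ i * real (m k i))) = k" if k: "k \<ge> 1" for k
  proof -
    \<comment> \<open>eigenvalues are ordered like the linear forms $\sum_i a_i l_i$\<close>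
    have osc: "osc_value a l = 2 * (\<Sum>i\<in>UNIV. a $ i * real (l i)) + (\<Sum>i\<in>UNIV. a $ i)" for l
      by (simp add: osc_value_def algebra_simps sum.distrib sum_distrib_left)
    have "l \<in> lattice_simplex UNIV (\<lambda>i. a $ i) (\<Sum>i\<in>UNIV. a $ i * real (m k i)) \<longleftrightarrow> l \<in> m ` {1..k}" for l
    proof -
      obtain j where j: "j \<ge> 1" "m j = l" using surj by blast
      have "l \<in> lattice_simplex UNIV (\<lambda>i. a $ i) (\<Sum>i\<in>UNIV. a $ i * real (m k i)) \<longleftrightarrow>
          osc_value a (m j) \<le> osc_value a (m k)"
        using j by (simp add: lattice_simplex_def osc PiE_UNIV_domain)
      also have "\<dots> \<longleftrightarrow> j \<le> k" using mono[OF j(1) k] unfolding m[OF j(1)] m[OF k] .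
      also have "\<dots> \<longleftrightarrow> l \<in> m ` {1..k}"
      proof
        assume "l \<in> m ` {1..k}"
        then obtain i where i: "i \<in> {1..k}" "l = m i" by auto
        then have "j = i" using j by (intro inj_onD[OF inj]) auto
        then show "j \<le> k" using i by simp
      qed (use j in auto)
      finally show ?thesis .
    qed
    then have "lattice_simplex UNIV (\<lambda>i. a $ i) (\<Sum>i\<in>UNIV. a $ i * real (m k i)) = m ` {1..k}" by blast
    moreover have "inj_on m {1..k}" using inj by (rule inj_on_subset) auto
    ultimately show ?thesis by (simp add: card_image)
  qed
  have "eventually (\<lambda>k. ereal_of_enat (nodal_count (f k)) / ereal (real k) =
      ereal (real (\<Prod>i\<in>UNIV. m k i + 1) / real k)) sequentially"
    using eventually_ge_at_top[of 1]
  proof eventually_elim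
    case (elim k)
    have "nodal_count (f k) = enat (\<Prod>i\<in>UNIV. m k i + 1)"
      by (rule nodal_count_hermite_product[OF assms(1) c(1)[OF elim] c(2)[OF elim]])
    then show ?case using elim by simp
  qed
  then have "limsup (\<lambda>k. ereal_of_enat (nodal_count (f k)) / ereal (real k)) =
      limsup (\<lambda>k. ereal (real (\<Prod>i\<in>UNIV. m k i + 1) / real k))"
    by (rule Limsup_eq)
  also have "\<dots> = ereal (fact (CARD('n)) / real (CARD('n)) ^ CARD('n))"
    by (rule limsup_product_over_rank[OF _ bij rank]) (use assms(1) in auto)
  finally show "limsup (\<lambda>k. ereal_of_enat (nodal_count (f k)) / ereal (real k)) =
      ereal (fact (CARD('n)) / real (CARD('n)) ^ CARD('n))" .
qed

end
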